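(* Let $F_j$ denote the $j$-th Fibonacci number ($F_1=F_2=1$, $F_3=2$, and so on). The following hold for all sufficiently large $n$ (depending on $k$). (1) $n-1\le \mathrm{bal}(n,T_6)\le 2n-2$. (2) For every $k\ge 7$, $$F_{k-4}(n-F_{k-4})\le \mathrm{bal}(n,T_k)\le (F_{k-2}-2)n-\binom{F_{k-2}-1}{2}+\delta_{k=7},$$ where $\delta_{k=7}=1$ if $k=7$ and is zero otherwise. (3) For every $k\ge 5$, $$2^{k-5}(n-2^{k-5})\le \mathrm{bal}(n,A_k)\le \mathrm{bal}(n,B_k)\le (2^{k-3}-1)n-\binom{2^{k-3}}{2}.$$
   Context: In a 2-edge-coloring of the complete graph $K_n$, a copy of a graph $G$ with $e(G)$ edges is balanced if it has $\lfloor e(G)/2\rfloor$ edges in one of the colors and $\lceil e(G)/2\rceil$ in the other. The balancing number $\mathrm{bal}(n,G)$ is the smallest integer $t\ge 0$ such that every 2-edge-coloring of $K_n$ with more than $t$ edges in each color contains a balanced copy of $G$. Trees $T_k$: $T_1\cong T_2\cong K_2$; for $k\ge 3$, $T_k$ is obtained from the disjoint union of a copy $H$ of $T_{k-1}$ and a copy $J$ of $T_{k-2}$ by adding an edge joining a vertex of maximum degree in $H$ to a vertex of maximum degree in $J$. Trees $A_k$: $A_1$ is a single vertex; for $k\ge 2$, $A_k$ is obtained from two disjoint copies of $A_{k-1}$ by adding an edge joining a vertex of maximum degree in one copy to a vertex of maximum degree in the other. Trees $B_k$: for $k\ge 1$, $B_k=A_k+uz$, where $u$ is a vertex of maximum degree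 in $A_k$ and $z$ is a new vertex. (All are well defined up to isomorphism, since vertices of maximum degree in $T_k$, and in $A_k$, are equivalent under automorphisms.) *)

theory Defs
  imports "HOL-Number_Theory.Fib"
begin

text \<open>Finite simple graphs; edges are two-element subsets of the vertex set.\<close>

record 'a ugraph =
  verts :: "'a set"
  edges :: "'a set set"

definition complete_graph :: "'a set \<Rightarrow> 'a ugraph" where
  "complete_graph S = \<lparr>verts = S, edges = {e. e \<subseteq> S \<and> card e = 2}\<rparr>"

definition subgraph :: "'a ugraph \<Rightarrow> 'a ugraph \<Rightarrow> bool" where
  "subgraph H G \<longleftrightarrow>
     verts H \<subseteq> verts G \<and> edges H \<subseteq> edges G \<and> (\<forall>e\<in>edges H. e \<subseteq> verts H)"

definition graph_iso :: "'a ugraph \<Rightarrow> 'b ugraph \<Rightarrow> bool" where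
  "graph_iso G H \<longleftrightarrow>
     (\<exists>f. bij_betw f (verts G) (verts H) \<and> edges H = (\<lambda>e. f ` e) ` edges G)"

definition degree :: "'a ugraph \<Rightarrow> 'a \<Rightarrow> nat" where
  "degree G v = card {e \<in> edges G. v \<in> e}"

definition max_degree_vertex :: "'a ugraph \<Rightarrow> 'a \<Rightarrow> bool" where
  "max_degree_vertex G v \<longleftrightarrow> v \<in> verts G \<and> (\<forall>w\<in>verts G. degree G w \<le> degree G v)"

text \<open>
  The vertex set of K_n is {..<n}. An edge-coloring is a total function on sets, but only its
  values on the edges of K_n are ever used.
\<close>

datatype color = Red | Blue

definition color_class :: "nat \<Rightarrow> (nat set \<Rightarrow> color) \<Rightarrow> color \<Rightarrow> nat set set" where
  "color_class n c x = {e \<in> edges (complete_graph {..<n}). c e = x}"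

definition balanced_copy ::
    "nat \<Rightarrow> (nat set \<Rightarrow> color) \<Rightarrow> 'a ugraph \<Rightarrow> nat ugraph \<Rightarrow> bool" where
  "balanced_copy n c G C \<longleftrightarrow>
     subgraph C (complete_graph {..<n}) \<and> graph_iso G C \<and>
     (\<exists>x y. x \<noteq> y \<and>
        card (edges C \<inter> color_class n c x) = card (edges G) div 2 \<and>
        card (edges C \<inter> color_class n c y) = (card (edges G) + 1) div 2)"

text \<open>The set over which the minimum is taken is never empty: it contains n choose 2.\<close>

definition bal :: "nat \<Rightarrow> 'a ugraph \<Rightarrow> nat" where
  "bal n G = (LEAST t. \<forall>c.
     (\<forall>x. card (color_class n c x) > t) \<longrightarrow> (\<exists>C. balanced_copy n c G C))"

definition join_by_edge :: "'a ugraph \<Rightarrow> 'a \<Rightarrow> 'a ugraph \<Rightarrow> 'a \<Rightarrow> 'a ugraph" where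
  "join_by_edge H u J v =
     \<lparr>verts = verts H \<union> verts J, edges = insert {u, v} (edges H \<union> edges J)\<rparr>"

text \<open>
  The trees T_k, A_k, B_k are defined only up to isomorphism, so each is given as the predicate
  of being a realization of the tree on vertices of the given type.
\<close>

inductive T_tree :: "nat \<Rightarrow> 'a ugraph \<Rightarrow> bool" where
  T_1: "card S = 2 \<Longrightarrow> T_tree 1 (complete_graph S)"
| T_2: "card S = 2 \<Longrightarrow> T_tree 2 (complete_graph S)"
| T_step: "\<lbrakk>k \<ge> 3; T_tree (k - 1) H; T_tree (k - 2) J; verts H \<inter> verts J = {};
            max_degree_vertex H u; max_degree_vertex J v\<rbrakk>
           \<Longrightarrow> T_tree k (join_by_edge H u J v)"

inductive A_tree :: "nat \<Rightarrow> 'a ugraph \<Rightarrow> bool" where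
  A_1: "A_tree 1 \<lparr>verts = {v}, edges = {}\<rparr>"
| A_step: "\<lbrakk>k \<ge> 2; A_tree (k - 1) H; A_tree (k - 1) J; verts H \<inter> verts J = {};
            max_degree_vertex H u; max_degree_vertex J v\<rbrakk>
           \<Longrightarrow> A_tree k (join_by_edge H u J v)"

definition B_tree :: "nat \<Rightarrow> 'a ugraph \<Rightarrow> bool" where
  "B_tree k G \<longleftrightarrow>
     (\<exists>H u z. A_tree k H \<and> max_degree_vertex H u \<and> z \<notin> verts H \<and>
        G = \<lparr>verts = insert z (verts H), edges = insert {u, z} (edges H)\<rparr>)"

text \<open>The predicates are inhabited over every infinite vertex type.\<close>

lemma ex_max_degree_vertex:
  assumes "finite (verts G)" "verts G \<noteq> {}"
  shows "\<exists>v. max_degree_vertex G v"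
proof -
  obtain v where "v \<in> verts G" "degree G v = Max (degree G ` verts G)"
    using Max_in[of "degree G ` verts G"] assms by fastforce
  then show ?thesis
    using assms by (auto simp: max_degree_vertex_def)
qed

lemma T_tree_exists:
  assumes "infinite X" "k \<ge> 1"
  shows "\<exists>G. T_tree k G \<and> verts G \<subseteq> X \<and> finite (verts G) \<and> verts G \<noteq> {}"
  using assms
proof (induction k arbitrary: X rule: less_induct)
  case (less k)
  show ?case
  proof (cases "k \<ge> 3")
    case False
    obtain S where S: "S \<subseteq> X" "card S = 2" "finite S"
      using infinite_arbitrarily_large[OF less.prems(1)] by blast
    moreover have "k = 1 \<or> k = 2" using False less.prems by linarith
    ultimately have "T_tree k (complete_graph S)" "S \<noteq> {}"
      using T_1 T_2 by auto
    with S show ?thesis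
      by (intro exI[of _ "complete_graph S"]) (simp add: complete_graph_def)
  next
    case True
    then have le: "k - 1 < k" "k - 2 < k" "1 \<le> k - 1" "1 \<le> k - 2"
      by linarith+
    obtain H where H: "T_tree (k - 1) H" "verts H \<subseteq> X" "finite (verts H)" "verts H \<noteq> {}"
      using less.IH[OF le(1) less.prems(1) le(3)] by blast
    obtain J where J: "T_tree (k - 2) J" "verts J \<subseteq> X - verts H" "finite (verts J)" "verts J \<noteq> {}"
      using less.IH[OF le(2) Diff_infinite_finite[OF H(3) less.prems(1)] le(4)] by blast
    obtain u v where "max_degree_vertex H u" "max_degree_vertex J v"
      using ex_max_degree_vertex H J by metis
    then have "T_tree k (join_by_edge H u J v)"
      by (intro T_step) (use True H J in auto)
    then show ?thesis
      using H J by (intro exI[of _ "join_by_edge H u J v"]) (auto simp: join_by_edge_def)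
  qed
qed

lemma A_tree_exists:
  assumes "infinite X" "k \<ge> 1"
  shows "\<exists>G. A_tree k G \<and> verts G \<subseteq> X \<and> finite (verts G) \<and> verts G \<noteq> {}"
  using assms(2,1)
proof (induction k arbitrary: X rule: dec_induct)
  case base
  then obtain x where "x \<in> X" by fastforce
  then show ?case
    using A_1[of x] by (intro exI[of _ "\<lparr>verts = {x}, edges = {}\<rparr>"]) auto
next
  case (step k)
  obtain H where H: "A_tree k H" "verts H \<subseteq> X" "finite (verts H)" "verts H \<noteq> {}"
    using step by blast
  obtain J where J: "A_tree k J" "verts J \<subseteq> X - verts H" "finite (verts J)" "verts J \<noteq> {}"
    using step.IH[of "X - verts H"] step.prems H by auto
  obtain u v where uv: "max_degree_vertex H u" "max_degree_vertex J v"
    using ex_max_degree_vertex H J by metis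
  have "A_tree (Suc k) (join_by_edge H u J v)"
    by (rule A_step) (use step.hyps H J uv in auto)
  then show ?case
    using H J by (intro exI[of _ "join_by_edge H u J v"]) (auto simp: join_by_edge_def)
qed

lemma B_tree_exists:
  assumes "infinite (UNIV :: 'a set)" "k \<ge> 1"
  shows "\<exists>G :: 'a ugraph. B_tree k G"
  using A_tree_exists[OF assms] ex_max_degree_vertex ex_new_if_finite[OF assms(1)]
  unfolding B_tree_def by metis

end

theory Submission
  imports Defs "HOL-Library.Ramsey"
begin

text \<open>
  Lower bounds. Color the complete bipartite graph between \<open>s\<close> vertices and the remaining \<open>n - s\<close>
  vertices red and all other edges blue. The red edges of a copy of a tree are touched by a set of at
  most \<open>s\<close> of its vertices. Cut the tree into pieces of maximum degree at most four. Then \<open>s\<close> vertices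
  touch at most \<open>4 * s\<close> edges inside pieces, and fewer edges than there are pieces run between pieces.
  For \<open>T_k\<close>, cut into copies of \<open>T_5\<close> and \<open>T_4\<close>, and \<open>s = fib (k - 4)\<close>, as well as for \<open>A_k\<close>, cut into
  copies of \<open>A_5\<close>, and \<open>s = 2 ^ (k - 5)\<close>, this is less than half of the edges, so that no copy is
  balanced (\<open>bal_lower_bound\<close>).

  Upper bounds. If both colors contain a large clique, then a balanced copy of any tree is found
  between the two cliques (\<open>half_copy_clique_indep\<close>). So some color, say red, has no large clique, and by
  Ramsey's theorem every large set of vertices contains a large blue clique. If there are more than
  \<open>(t - 1) * n - (t choose 2)\<close> red edges, then either there is a large induced red matching, or there
  are \<open>t\<close> vertices of large red degree, called hubs, or there are \<open>t - 1\<close> hubs and a red edge that avoids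
  them (\<open>dense_half_copy\<close>). An induced red matching gives a balanced copy because the trees \<open>T_k\<close> and \<open>B_k\<close>
  have a matching that consists of half of their edges (\<open>half_copy_far_edges\<close>). In the other cases, place
  hubs on suitable vertices of the tree and the other vertices into a blue clique that contains many
  red neighbours of each hub (\<open>hub_embedding\<close>). Then the edges at hubs are red and the others are blue,
  except that the colors of edges between two hubs are beyond control.

  It remains to find \<open>t\<close> positions for hubs in the tree that make exactly half of the edges red. In
  \<open>B_k\<close> there are \<open>2 ^ (k - 3)\<close> pairwise nonadjacent positions which give two red edges each on average
  (\<open>B_tree_hub_placement\<close>). In \<open>T_k\<close> the best positions are the vertices of maximum degree of the copies
  of \<open>T_5\<close> and \<open>T_4\<close> of which \<open>T_k\<close> consists, together with some leaves. These are adjacent, and a possible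
  surplus of red edges is removed by giving up hubs one by one (\<open>T_tree_hub_placement\<close>).

  Finally, \<open>bal n A \<le> bal n B\<close> since deleting the additional edge of \<open>B_k\<close>, which has an even number of
  edges, from a balanced copy leaves a balanced copy of \<open>A_k\<close>.
\<close>

section \<open>Selecting vertices and edges in a graph without large cliques\<close>

text \<open>
  The common tool for building embeddings: the label of a vertex prescribes the set in which its
  image has to lie. Injectivity then only has to be arranged separately inside each label class.
\<close>

lemma embed_by_labels:
  assumes "finite V"
    and fin: "\<And>i. i \<in> l ` V \<Longrightarrow> finite (B i)"
    and size: "\<And>i. i \<in> l ` V \<Longrightarrow> card {w \<in> V. l w = i} \<le> card (B i)"
    and disj: "\<And>i j. i \<in> l ` V \<Longrightarrow> j \<in> l ` V \<Longrightarrow> i \<noteq> j \<Longrightarrow> B i \<inter> B j = {}"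
  shows "\<exists>g. inj_on g V \<and> (\<forall>w\<in>V. g w \<in> B (l w))"
proof -
  define h where "h i = (SOME f. f ` {w \<in> V. l w = i} \<subseteq> B i \<and> inj_on f {w \<in> V. l w = i})" for i
  have h: "h i ` {w \<in> V. l w = i} \<subseteq> B i \<and> inj_on (h i) {w \<in> V. l w = i}"
    if "i \<in> l ` V" for i
  proof -
    have "\<exists>f. f ` {w \<in> V. l w = i} \<subseteq> B i \<and> inj_on f {w \<in> V. l w = i}"
      using assms(1) fin[OF that] size[OF that] by (intro card_le_inj) auto
    from someI_ex[OF this] show ?thesis by (simp add: h_def)
  qed
  have mem: "h (l w) w \<in> B (l w)" if "w \<in> V" for w
    using h[of "l w"] that by auto
  have "inj_on (\<lambda>w. h (l w) w) V"
  proof (rule inj_onI)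
    fix x y assume xy: "x \<in> V" "y \<in> V" "h (l x) x = h (l y) y"
    have "l x = l y"
      using mem[OF xy(1)] mem[OF xy(2)] disj[of "l x" "l y"] xy by auto
    then show "x = y"
      using h[of "l x"] xy by (auto simp: inj_on_def)
  qed
  then show ?thesis using mem by auto
qed

text \<open>
  Each vertex of \<open>X\<close> is adjacent to one of \<open>2 ^ card Q\<close> subsets of \<open>Q\<close>, so one of these subsets,
  \<open>S\<close>, is shared by many vertices. This replaces a bipartite Ramsey theorem below.
\<close>

lemma uniform_to_set:
  fixes R :: "'a set set"
  assumes "finite Q" "card X \<ge> s * 2 ^ card Q" "s > 0"
  shows "\<exists>X' S. X' \<subseteq> X \<and> card X' \<ge> s \<and> S \<subseteq> Q \<and>
           (\<forall>x\<in>X'. \<forall>q\<in>S. {x, q} \<in> R) \<and> (\<forall>x\<in>X'. \<forall>q\<in>Q - S. {x, q} \<notin> R)"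
proof -
  define f where "f x = {q \<in> Q. {x, q} \<in> R}" for x
  have "0 < s * 2 ^ card Q" using assms(3) by simp
  then have "card X > 0" using assms(2) by linarith
  then have fX: "finite X" by (simp add: card_ge_0_finite)
  have "\<exists>S\<in>Pow Q. card {x \<in> X. f x = S} \<ge> s"
  proof (rule ccontr)
    assume "\<not> ?thesis"
    then have lt: "card {x \<in> X. f x = S} < s" if "S \<in> Pow Q" for S
      using that by (meson not_le)
    have "f x \<in> Pow Q" for x by (simp add: f_def)
    then have "(\<Union>S\<in>Pow Q. {x \<in> X. f x = S}) = X" by blast
    then have "card X = (\<Sum>S\<in>Pow Q. card {x \<in> X. f x = S})"
      using card_UN_disjoint[of "Pow Q" "\<lambda>S. {x \<in> X. f x = S}"] fX assms(1) by auto
    also have "\<dots> < (\<Sum>S\<in>Pow Q. s)"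
      by (rule sum_strict_mono) (use lt assms(1) in auto)
    finally show False using assms by (simp add: card_Pow mult.commute)
  qed
  then obtain S where "S \<subseteq> Q" "card {x \<in> X. f x = S} \<ge> s" by blast
  then show ?thesis
    by (intro exI[of _ "{x \<in> X. f x = S}"] exI[of _ S]) (auto simp: f_def)
qed

text \<open>
  A large induced complete bipartite graph. A tree has a half copy in it, because every set of edges
  of a tree is a cut.
\<close>

definition indep_biclique :: "nat \<Rightarrow> 'a set \<Rightarrow> 'a set set \<Rightarrow> bool" where
  "indep_biclique s V R \<longleftrightarrow> (\<exists>X Y. X \<subseteq> V \<and> Y \<subseteq> V \<and> X \<inter> Y = {} \<and> card X \<ge> s \<and> card Y \<ge> s \<and>
     indep X R \<and> indep Y R \<and> (\<forall>x\<in>X. \<forall>y\<in>Y. {x, y} \<in> R))"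

text \<open>
  If the graph \<open>R\<close> has neither a large clique nor a large induced complete bipartite graph, then from
  very large sets \<open>A i\<close> one can select disjoint parts whose union is independent. The sets are treated
  one after the other: Ramsey's theorem gives an independent set inside the new \<open>A k\<close>, and after
  thinning it out its vertices all have the same neighbours among the vertices that were selected
  before. These neighbours are fewer than \<open>s\<close>, as otherwise they would form an induced complete
  bipartite graph; throwing them away costs each earlier part fewer than \<open>s\<close> vertices. This is why the
  induction hypothesis is used for parts of size \<open>a + s\<close>. The bound \<open>D\<close> depends on the index set only
  through its size, as it has to serve all trees with a given number of vertices.
\<close>

lemma disjoint_family_in_indep:
  assumes "s > 0"
  shows "\<exists>D. \<forall>(I :: 'i set) (V :: 'a set) R A. finite I \<and> card I = p \<longrightarrow> finite V \<longrightarrow>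
     \<not> (\<exists>K\<subseteq>V. card K = N \<and> clique K R) \<longrightarrow> \<not> indep_biclique s V R \<longrightarrow>
     (\<forall>i\<in>I. A i \<subseteq> V \<and> card (A i) \<ge> D) \<longrightarrow>
     (\<exists>B. (\<forall>i\<in>I. B i \<subseteq> A i \<and> card (B i) \<ge> a) \<and>
        (\<forall>i\<in>I. \<forall>j\<in>I. i \<noteq> j \<longrightarrow> B i \<inter> B j = {}) \<and> indep (\<Union>i\<in>I. B i) R)"
proof (induction p arbitrary: a)
  case 0
  show ?case by (intro exI[of _ 0] allI impI, elim conjE) (simp add: indep_def)
next
  case (Suc p)
  define b where "b = a + s"
  define m where "m = p * b"
  obtain D where D: "\<forall>(I :: 'i set) (V :: 'a set) R A. finite I \<and> card I = p \<longrightarrow> finite V \<longrightarrow>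
     \<not> (\<exists>K\<subseteq>V. card K = N \<and> clique K R) \<longrightarrow> \<not> indep_biclique s V R \<longrightarrow>
     (\<forall>i\<in>I. A i \<subseteq> V \<and> card (A i) \<ge> D) \<longrightarrow>
     (\<exists>B. (\<forall>i\<in>I. B i \<subseteq> A i \<and> card (B i) \<ge> b) \<and>
        (\<forall>i\<in>I. \<forall>j\<in>I. i \<noteq> j \<longrightarrow> B i \<inter> B j = {}) \<and> indep (\<Union>i\<in>I. B i) R)"
    by (rule exE[OF Suc.IH[of b]])
  obtain r where r: "1 \<le> r \<and> (\<forall>(V :: 'a set) (E :: 'a set set). finite V \<and> card V \<ge> r \<longrightarrow>
      (\<exists>R \<subseteq> V. card R = N \<and> clique R E \<or> card R = b * 2 ^ m \<and> indep R E))"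
    by (rule exE[OF ramsey2[of N "b * 2 ^ m"]])
  show ?case
  proof (intro exI[of _ "D + m + r"] allI impI)
    fix kI :: "'i set" and V :: "'a set" and R :: "'a set set" and A :: "'i \<Rightarrow> 'a set"
    assume kI: "finite kI \<and> card kI = Suc p"
    then obtain k I where I: "kI = insert k I" "k \<notin> I" "card I = p" "finite I"
      by (metis card_Suc_eq finite_insert)
    assume fV: "finite V" and noK: "\<not> (\<exists>K\<subseteq>V. card K = N \<and> clique K R)"
      and noB: "\<not> indep_biclique s V R"
      and "\<forall>i\<in>kI. A i \<subseteq> V \<and> card (A i) \<ge> D + m + r"
    then have A: "\<forall>i\<in>insert k I. A i \<subseteq> V \<and> card (A i) \<ge> D + m + r" by (simp add: I(1))
    have "\<exists>B. (\<forall>i\<in>I. B i \<subseteq> A i \<and> card (B i) \<ge> b) \<and>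
        (\<forall>i\<in>I. \<forall>j\<in>I. i \<noteq> j \<longrightarrow> B i \<inter> B j = {}) \<and> indep (\<Union>i\<in>I. B i) R"
    proof -
      have AI: "\<forall>i\<in>I. A i \<subseteq> V \<and> card (A i) \<ge> D" using A by auto
      show ?thesis
        by (rule D[THEN spec, THEN spec, THEN spec, THEN spec, THEN mp, THEN mp, THEN mp, THEN mp,
              THEN mp, OF conjI[OF I(4,3)] fV noK noB AI])
    qed
    then obtain B0 where B0all: "(\<forall>i\<in>I. B0 i \<subseteq> A i \<and> card (B0 i) \<ge> b) \<and>
        (\<forall>i\<in>I. \<forall>j\<in>I. i \<noteq> j \<longrightarrow> B0 i \<inter> B0 j = {}) \<and> indep (\<Union>i\<in>I. B0 i) R"
      by (rule exE)
    then have B0: "\<And>i. i \<in> I \<Longrightarrow> B0 i \<subseteq> A i \<and> card (B0 i) \<ge> b"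
      "\<And>i j. i \<in> I \<Longrightarrow> j \<in> I \<Longrightarrow> i \<noteq> j \<Longrightarrow> B0 i \<inter> B0 j = {}" "indep (\<Union>i\<in>I. B0 i) R" by simp_all
    have "\<forall>i\<in>I. \<exists>B. B \<subseteq> B0 i \<and> card B = b"
    proof
      fix i assume "i \<in> I"
      then have "b \<le> card (B0 i)" using B0(1) by simp
      then obtain B where "B \<subseteq> B0 i" "card B = b" by (rule obtain_subset_with_card_n)
      then show "\<exists>B. B \<subseteq> B0 i \<and> card B = b" by blast
    qed
    from bchoice[OF this] obtain B1 where
      "\<forall>i\<in>I. B1 i \<subseteq> B0 i \<and> card (B1 i) = b" by (rule exE)
    then have B1: "\<And>i. i \<in> I \<Longrightarrow> B1 i \<subseteq> B0 i \<and> card (B1 i) = b" by simp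
    define Q where "Q = (\<Union>i\<in>I. B1 i)"
    have QV: "Q \<subseteq> V" using B1 B0(1) A unfolding Q_def by blast
    then have fQ: "finite Q" using fV finite_subset by blast
    have iQ: "indep Q R" using B0(3) B1 unfolding Q_def indep_def by blast
    have cQ: "card Q \<le> m"
      using card_UN_le[OF I(4), of B1] B1 I(3) by (simp add: Q_def m_def)
    have "card (A k - Q) \<ge> r"
      using A cQ diff_card_le_card_Diff[OF fQ, of "A k"] by force
    moreover have AkV: "A k \<subseteq> V" using A by auto
    moreover have "finite (A k - Q)" using AkV fV finite_subset by blast
    ultimately obtain X where "X \<subseteq> A k - Q"
        "card X = N \<and> clique X R \<or> card X = b * 2 ^ m \<and> indep X R"
      using r by meson
    then have X: "X \<subseteq> A k - Q" "card X = b * 2 ^ m" "indep X R"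
      using noK AkV by auto
    have "b * 2 ^ card Q \<le> card X" using X(2) cQ by simp
    from uniform_to_set[OF fQ this, of R] obtain X' S where X': "X' \<subseteq> X" "card X' \<ge> b" "S \<subseteq> Q"
      "\<forall>x\<in>X'. \<forall>q\<in>S. {x, q} \<in> R" "\<forall>x\<in>X'. \<forall>q\<in>Q - S. {x, q} \<notin> R"
      using assms by (auto simp: b_def)
    have cS: "card S < s"
    proof (rule ccontr)
      assume "\<not> card S < s"
      then have "s \<le> card S" "s \<le> card X'" using X'(2) by (auto simp: b_def)
      moreover have "indep X' R" "indep S R"
        using X(3) X'(1,3) iQ unfolding indep_def by blast+
      moreover have "X' \<inter> S = {}" "X' \<subseteq> V" "S \<subseteq> V" using X(1) X'(1,3) AkV QV by auto
      ultimately have "indep_biclique s V R" unfolding indep_biclique_def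
        using X'(4) by blast
      then show False using noB by simp
    qed
    have fS: "finite S" using X'(3) fQ finite_subset by blast
    define B where "B i = (if i = k then X' else B1 i - S)" for i
    have ne: "i \<noteq> k" if "i \<in> I" for i using that I(2) by auto
    have BQ: "B i \<subseteq> Q - S" if "i \<in> I" for i
      using that ne[OF that] by (auto simp: B_def Q_def)
    show "\<exists>B. (\<forall>i\<in>kI. B i \<subseteq> A i \<and> card (B i) \<ge> a) \<and>
        (\<forall>i\<in>kI. \<forall>j\<in>kI. i \<noteq> j \<longrightarrow> B i \<inter> B j = {}) \<and>
        indep (\<Union>i\<in>kI. B i) R"
      unfolding I(1)
    proof (intro exI[of _ B] conjI ballI impI)
      fix i assume i: "i \<in> insert k I"
      show "B i \<subseteq> A i"
      proof (cases "i = k")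
        case True then show ?thesis using X(1) X'(1) by (auto simp: B_def)
      next
        case False
        then have "B1 i \<subseteq> A i" using B0(1)[of i] B1[of i] i by auto
        then show ?thesis using False by (auto simp: B_def)
      qed
      show "a \<le> card (B i)"
      proof (cases "i = k")
        case True then show ?thesis using X'(2) by (simp add: B_def b_def)
      next
        case False
        then have "card (B1 i) = b" using B1 i by auto
        then show ?thesis using diff_card_le_card_Diff[OF fS, of "B1 i"] cS False
          by (simp add: B_def b_def)
      qed
    next
      fix i j assume ij: "i \<in> insert k I" "j \<in> insert k I" "i \<noteq> j"
      have XQ: "X' \<inter> Q = {}" using X(1) X'(1) by auto
      consider "i = k" "j \<in> I" | "j = k" "i \<in> I" | "i \<in> I" "j \<in> I" using ij by auto
      then show "B i \<inter> B j = {}"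
      proof cases
        case 1 then show ?thesis using BQ[of j] XQ by (auto simp: B_def)
      next
        case 2 then show ?thesis using BQ[of i] XQ by (auto simp: B_def)
      next
        case 3
        then have "B1 i \<inter> B1 j = {}" using B0(2)[of i j] B1[of i] B1[of j] ij(3) by blast
        then show ?thesis using 3 ne by (auto simp: B_def)
      qed
    next
      have "(\<Union>i\<in>insert k I. B i) \<subseteq> X' \<union> (Q - S)"
      proof -
        have "B k = X'" by (simp add: B_def)
        then show ?thesis using BQ by auto
      qed
      moreover have "indep (X' \<union> (Q - S)) R"
        unfolding indep_def
      proof (intro ballI impI)
        fix x y assume xy: "x \<in> X' \<union> (Q - S)" "y \<in> X' \<union> (Q - S)" "x \<noteq> y"
        have "{x, y} \<notin> R" if "x \<in> X'" "y \<in> X'" using that X(3) X'(1) xy(3) by (auto simp: indep_def)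
        moreover have "{x, y} \<notin> R" if "x \<in> Q" "y \<in> Q" using that iQ xy(3) by (auto simp: indep_def)
        moreover have "{x, y} \<notin> R" if "x \<in> X'" "y \<in> Q - S" using that X'(5) by auto
        moreover have "{x, y} \<notin> R" if "y \<in> X'" "x \<in> Q - S"
          using that X'(5) by (auto simp: insert_commute)
        ultimately show "{x, y} \<notin> R" using xy by blast
      qed
      ultimately show "indep (\<Union>i\<in>insert k I. B i) R"
        by (meson indep_def subsetD)
    qed
  qed
qed

definition far :: "'a set set \<Rightarrow> 'a set \<Rightarrow> 'a set \<Rightarrow> bool" where
  "far R e f \<longleftrightarrow> e \<inter> f = {} \<and> (\<forall>x\<in>e. \<forall>y\<in>f. {x, y} \<notin> R)"

lemma far_sym: "far R e f \<Longrightarrow> far R f e"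
  unfolding far_def by (metis Int_commute insert_commute)

text \<open>
  Greedy choice of an induced matching: \<open>k\<close> edges together with their neighbours cover at most
  \<open>2 * k * (D + 1)\<close> vertices, and these meet at most \<open>D\<close> times as many edges.
\<close>

lemma many_far_edges:
  assumes "finite F" "\<forall>e\<in>F. card e = 2"
    and deg: "\<And>x. card {e \<in> F. x \<in> e} \<le> D"
    and F: "\<And>x y. x \<in> \<Union>F \<Longrightarrow> y \<in> \<Union>F \<Longrightarrow> {x, y} \<in> R \<Longrightarrow> {x, y} \<in> F"
    and big: "card F > s * (2 * (D + 1) * D)"
  shows "\<exists>M\<subseteq>F. card M = s \<and> pairwise (far R) M"
proof -
  have "k \<le> s \<Longrightarrow> \<exists>M\<subseteq>F. card M = k \<and> pairwise (far R) M" for k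
  proof (induction k)
    case 0
    show ?case by (intro exI[of _ "{}"]) (auto simp: pairwise_def)
  next
    case (Suc k)
    then obtain M where M: "M \<subseteq> F" "card M = k" "pairwise (far R) M" by auto
    have fM: "finite M" using M(1) assms(1) finite_subset by blast
    define near where "near x = {e \<in> F. x \<in> e}" for x
    have fin_e: "finite e" "card e = 2" if "e \<in> F" for e
      using assms(2) that by (auto intro: card_ge_0_finite)
    define W where "W = (\<Union>x\<in>\<Union>M. insert x ((\<Union>(near x)) - {x}))"
    have fUM: "finite (\<Union>M)" using fM fin_e M(1) by auto
    have cUM: "card (\<Union>M) \<le> 2 * k"
    proof -
      have "card (\<Union>M) \<le> (\<Sum>e\<in>M. card e)"
        using card_UN_le[OF fM, of id] by simp
      also have "\<dots> = 2 * k" using fin_e M by (simp add: subset_iff)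
      finally show ?thesis .
    qed
    have cnb: "card (insert x (\<Union>(near x) - {x})) \<le> D + 1" for x
    proof -
      have fn: "finite (near x)" using assms(1) by (simp add: near_def)
      have "\<Union>(near x) - {x} = (\<Union>e\<in>near x. e - {x})" by auto
      moreover have "card (\<Union>e\<in>near x. e - {x}) \<le> (\<Sum>e\<in>near x. card (e - {x}))"
        by (rule card_UN_le[OF fn])
      moreover have "(\<Sum>e\<in>near x. card (e - {x})) \<le> (\<Sum>e\<in>near x. 1)"
        by (rule sum_mono) (use fin_e in \<open>auto simp: near_def\<close>)
      moreover have "card (near x) \<le> D" using deg by (simp add: near_def)
      ultimately have "card (\<Union>(near x) - {x}) \<le> D" by simp
      moreover have "finite (\<Union>(near x) - {x})" using fn fin_e by (auto simp: near_def)
      ultimately show ?thesis by (subst card_insert_disjoint) auto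
    qed
    have cW: "card W \<le> 2 * k * (D + 1)"
    proof -
      have "card W \<le> (\<Sum>x\<in>\<Union>M. card (insert x (\<Union>(near x) - {x})))"
        unfolding W_def by (rule card_UN_le[OF fUM])
      also have "\<dots> \<le> (\<Sum>x\<in>\<Union>M. D + 1)" by (rule sum_mono) (rule cnb)
      also have "\<dots> = card (\<Union>M) * (D + 1)" by simp
      also have "\<dots> \<le> 2 * k * (D + 1)" using cUM by (rule mult_le_mono1)
      finally show ?thesis .
    qed
    have fW: "finite W"
      unfolding W_def by (rule finite_UN_I[OF fUM]) (use fin_e assms(1) in \<open>auto simp: near_def\<close>)
    have "card (\<Union>x\<in>W. near x) \<le> (\<Sum>x\<in>W. card (near x))" by (rule card_UN_le[OF fW])
    also have "\<dots> \<le> (\<Sum>x\<in>W. D)" by (rule sum_mono) (use deg in \<open>simp add: near_def\<close>)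
    also have "\<dots> = card W * D" by simp
    also have "\<dots> \<le> (2 * k * (D + 1)) * D" using cW by (rule mult_le_mono1)
    also have "\<dots> = k * (2 * (D + 1) * D)" by (simp add: algebra_simps)
    also have "\<dots> \<le> s * (2 * (D + 1) * D)" using Suc.prems by (intro mult_le_mono1) simp
    also have "\<dots> < card F" by (rule big)
    finally have "card (\<Union>x\<in>W. near x) < card F" .
    moreover have "finite (\<Union>x\<in>W. near x)" using fW assms(1) by (auto simp: near_def)
    ultimately have "\<not> F \<subseteq> (\<Union>x\<in>W. near x)"
      using card_mono by (metis not_le)
    then obtain e where e: "e \<in> F" "e \<inter> W = {}" by (auto simp: near_def)
    have far_e: "far R f e" if "f \<in> M" for f
      unfolding far_def
    proof (intro conjI ballI)
      have "f \<subseteq> W" using that by (auto simp: W_def)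
      then show "f \<inter> e = {}" using e by auto
      fix x y assume xy: "x \<in> f" "y \<in> e"
      show "{x, y} \<notin> R"
      proof
        assume "{x, y} \<in> R"
        then have "{x, y} \<in> F" using F[of x y] xy that M(1) e(1) by auto
        then have "{x, y} \<in> near x" by (simp add: near_def)
        then have "y \<in> W" using xy that unfolding W_def by blast
        then show False using e xy by auto
      qed
    qed
    have "e \<notin> M" using far_e[of e] e(1) fin_e[of e] by (auto simp: far_def)
    moreover have "pairwise (far R) (insert e M)"
      unfolding pairwise_insert using M(3) far_e far_sym[OF far_e] by blast
    ultimately show ?case
      by (intro exI[of _ "insert e M"]) (use M e fM in auto)
  qed
  then show ?thesis by blast
qed

section \<open>Edges inside and across a vertex set\<close>

definition simple_graph :: "'a ugraph \<Rightarrow> bool" where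
  "simple_graph G \<longleftrightarrow> finite (verts G) \<and> (\<forall>e\<in>edges G. e \<subseteq> verts G \<and> card e = 2)"

lemma simple_graphD:
  assumes "simple_graph G"
  shows "finite (verts G)" "finite (edges G)"
    and "e \<in> edges G \<Longrightarrow> e \<subseteq> verts G" "e \<in> edges G \<Longrightarrow> card e = 2"
proof -
  show "finite (verts G)" using assms by (simp add: simple_graph_def)
  then show "finite (edges G)"
    using assms by (intro finite_subset[of "edges G" "Pow (verts G)"]) (auto simp: simple_graph_def)
qed (use assms in \<open>simp_all add: simple_graph_def\<close>)

lemma simple_graph_edgeE:
  assumes "simple_graph G" "e \<in> edges G"
  obtains x y where "e = {x, y}" "x \<noteq> y" "x \<in> verts G" "y \<in> verts G"
  using simple_graphD(3,4)[OF assms] unfolding card_2_iff by auto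

definition inner :: "'a ugraph \<Rightarrow> 'a set \<Rightarrow> 'a set set" where
  "inner G X = {e \<in> edges G. e \<subseteq> X}"

definition boundary :: "'a ugraph \<Rightarrow> 'a set \<Rightarrow> 'a set set" where
  "boundary G X = {e \<in> edges G. \<not> e \<subseteq> X \<and> e \<inter> X \<noteq> {}}"

definition touched :: "'a ugraph \<Rightarrow> 'a set \<Rightarrow> 'a set set" where
  "touched G X = {e \<in> edges G. e \<inter> X \<noteq> {}}"

lemma inner_cong:
  assumes "simple_graph G" "X \<inter> verts G = Y \<inter> verts G"
  shows "inner G X = inner G Y"
  using assms unfolding inner_def simple_graph_def by blast

lemma boundary_cong:
  assumes "simple_graph G" "X \<inter> verts G = Y \<inter> verts G"
  shows "boundary G X = boundary G Y"
  using assms unfolding boundary_def simple_graph_def by blast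

lemma boundary_compl:
  assumes "simple_graph G"
  shows "boundary G (verts G - X) = boundary G X"
  using assms unfolding boundary_def simple_graph_def by blast

lemma boundary_empty [simp]: "boundary G {} = {}"
  by (simp add: boundary_def)

lemma inner_empty: "simple_graph G \<Longrightarrow> inner G {} = {}"
  by (auto simp: inner_def simple_graph_def)

lemma touched_le_degree:
  assumes G: "simple_graph G" and deg: "\<And>v. v \<in> verts G \<Longrightarrow> degree G v \<le> d"
  shows "card (touched G X) \<le> d * card (X \<inter> verts G)"
proof -
  have fin: "finite (X \<inter> verts G)" using simple_graphD(1)[OF G] by simp
  have "touched G X = (\<Union>v\<in>X \<inter> verts G. {e \<in> edges G. v \<in> e})"
    using simple_graphD(3)[OF G] by (auto simp: touched_def)
  then have "card (touched G X) \<le> (\<Sum>v\<in>X \<inter> verts G. card {e \<in> edges G. v \<in> e})"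
    using card_UN_le[OF fin] by simp
  also have "\<dots> \<le> (\<Sum>v\<in>X \<inter> verts G. d)"
    by (rule sum_mono) (use deg in \<open>auto simp: degree_def\<close>)
  finally show ?thesis by (simp add: mult.commute)
qed

text \<open>
  All trees of the theorem arise by joining two smaller trees by an edge, so each quantity below is
  computed from its values on the two parts.
\<close>

locale edge_join =
  fixes H :: "'a ugraph" and u :: 'a and J :: "'a ugraph" and v :: 'a
  assumes simple_H: "simple_graph H" and simple_J: "simple_graph J"
    and disjoint: "verts H \<inter> verts J = {}"
    and u: "u \<in> verts H" and v: "v \<in> verts J"
begin

abbreviation "G \<equiv> join_by_edge H u J v"

lemma verts_G: "verts G = verts H \<union> verts J"
  by (simp add: join_by_edge_def)

lemma edges_G: "edges G = insert {u, v} (edges H \<union> edges J)"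
  by (simp add: join_by_edge_def)

lemma u_neq_v: "u \<noteq> v" "u \<notin> verts J" "v \<notin> verts H"
  using disjoint u v by auto

lemma simple_G: "simple_graph G"
  using simple_H simple_J u v u_neq_v
  by (auto simp: simple_graph_def verts_G edges_G)

lemma edges_disjoint: "edges H \<inter> edges J = {}" "{u, v} \<notin> edges H" "{u, v} \<notin> edges J"
proof -
  have "e \<noteq> {}" if "e \<in> edges H" for e using simple_graphD(4)[OF simple_H that] by auto
  then show "edges H \<inter> edges J = {}"
    using simple_graphD(3)[OF simple_H] simple_graphD(3)[OF simple_J] disjoint by blast
  show "{u, v} \<notin> edges H" "{u, v} \<notin> edges J"
    using simple_graphD(3)[OF simple_H, of "{u,v}"] simple_graphD(3)[OF simple_J, of "{u,v}"] u_neq_v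
    by auto
qed

lemma card_edges_G: "card (edges G) = card (edges H) + card (edges J) + 1"
  using edges_disjoint simple_graphD(2)[OF simple_H] simple_graphD(2)[OF simple_J]
  by (simp add: edges_G card_Un_disjoint)

lemma card_verts_G: "card (verts G) = card (verts H) + card (verts J)"
  using disjoint simple_graphD(1)[OF simple_H] simple_graphD(1)[OF simple_J]
  by (simp add: verts_G card_Un_disjoint)

lemma inner_G: "inner G X = inner H X \<union> inner J X \<union> (if u \<in> X \<and> v \<in> X then {{u, v}} else {})"
  by (auto simp: inner_def edges_G)

lemma boundary_G:
  "boundary G X = boundary H X \<union> boundary J X \<union> (if (u \<in> X) \<noteq> (v \<in> X) then {{u, v}} else {})"
  by (auto simp: boundary_def edges_G)

lemma card_split:
  assumes "A \<subseteq> edges H" "B \<subseteq> edges J"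
  shows "card (A \<union> B \<union> (if P then {{u, v}} else {})) = card A + card B + (if P then 1 else 0)"
proof -
  have "finite A" "finite B" "A \<inter> B = {}" "{u, v} \<notin> A \<union> B"
    using assms edges_disjoint simple_graphD(2)[OF simple_H] simple_graphD(2)[OF simple_J]
    by (auto dest: finite_subset)
  then show ?thesis by (simp add: card_Un_disjoint)
qed

lemma card_inner_G:
  "card (inner G X) = card (inner H X) + card (inner J X) + (if u \<in> X \<and> v \<in> X then 1 else 0)"
  unfolding inner_G by (rule card_split) (auto simp: inner_def)

lemma card_boundary_G:
  "card (boundary G X) = card (boundary H X) + card (boundary J X) +
     (if (u \<in> X) \<noteq> (v \<in> X) then 1 else 0)"
  unfolding boundary_G by (rule card_split) (auto simp: boundary_def)

lemma card_touched_G: "card (touched G X) \<le> card (touched H X) + card (touched J X) + 1"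
proof -
  have "touched G X \<subseteq> touched H X \<union> touched J X \<union> {{u, v}}"
    by (auto simp: touched_def edges_G)
  then have "card (touched G X) \<le> card (touched H X \<union> touched J X \<union> {{u, v}})"
    using simple_graphD(2)[OF simple_H] simple_graphD(2)[OF simple_J]
    by (intro card_mono) (auto simp: touched_def)
  also have "\<dots> \<le> card (touched H X) + card (touched J X) + 1"
    using card_Un_le[of "touched H X \<union> touched J X" "{{u, v}}"]
      card_Un_le[of "touched H X" "touched J X"] by simp
  finally show ?thesis .
qed

lemma degree_G:
  "x \<in> verts H \<Longrightarrow> degree G x = degree H x + (if x = u then 1 else 0)"
  "x \<in> verts J \<Longrightarrow> degree G x = degree J x + (if x = v then 1 else 0)"
proof -
  assume x: "x \<in> verts H"
  have "{e \<in> edges G. x \<in> e} = {e \<in> edges H. x \<in> e} \<union> {} \<union> (if x = u then {{u, v}} else {})"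
    using x disjoint v simple_graphD(3)[OF simple_J] by (auto simp: edges_G)
  then show "degree G x = degree H x + (if x = u then 1 else 0)"
    unfolding degree_def by (simp only:) (subst card_split, auto)
next
  assume x: "x \<in> verts J"
  have "{e \<in> edges G. x \<in> e} = {} \<union> {e \<in> edges J. x \<in> e} \<union> (if x = v then {{u, v}} else {})"
    using x disjoint u simple_graphD(3)[OF simple_H] by (auto simp: edges_G)
  then show "degree G x = degree J x + (if x = v then 1 else 0)"
    unfolding degree_def by (simp only:) (subst card_split, auto)
qed

end

section \<open>Trees\<close>

text \<open>
  Exactly the finite trees, with the induction principle that fits the three families.
\<close>

inductive join_tree :: "'a ugraph \<Rightarrow> bool" where
  single: "join_tree \<lparr>verts = {x}, edges = {}\<rparr>"
| join: "\<lbrakk>join_tree H; join_tree J; verts H \<inter> verts J = {}; u \<in> verts H; v \<in> verts J\<rbrakk>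
    \<Longrightarrow> join_tree (join_by_edge H u J v)"

lemma join_tree_simple: "join_tree G \<Longrightarrow> simple_graph G"
proof (induction rule: join_tree.induct)
  case (join H J u v)
  then interpret edge_join H u J v by unfold_locales auto
  show ?case by (rule simple_G)
qed (simp add: simple_graph_def)

lemma edge_joinI:
  assumes "join_tree H" "join_tree J" "verts H \<inter> verts J = {}" "u \<in> verts H" "v \<in> verts J"
  shows "edge_join H u J v"
  using assms join_tree_simple by unfold_locales auto

lemma join_tree_card: "join_tree G \<Longrightarrow> card (verts G) = card (edges G) + 1"
proof (induction rule: join_tree.induct)
  case (join H J u v)
  then interpret edge_join H u J v by (intro edge_joinI)
  show ?case using join.IH by (simp add: card_edges_G card_verts_G)
qed simp

text \<open>
  A subtree containing \<open>r\<close> can have any number of edges. Prescribing \<open>r\<close> makes the induction work: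
  once one part is used up completely, the subtree of the other part must contain the end of the
  joining edge.
\<close>

lemma join_tree_inner:
  "join_tree G \<Longrightarrow> r \<in> verts G \<Longrightarrow> j \<le> card (edges G) \<Longrightarrow>
     \<exists>X\<subseteq>verts G. r \<in> X \<and> card (inner G X) = j"
proof (induction arbitrary: r j rule: join_tree.induct)
  case (single x)
  then show ?case by (intro exI[of _ "{x}"]) (simp add: inner_def)
next
  case (join H J u v)
  then interpret edge_join H u J v by (intro edge_joinI)
  have all: "inner H (verts H \<union> Y) = edges H" "inner J (verts J \<union> Y) = edges J" for Y
    using simple_graphD(3)[OF simple_H] simple_graphD(3)[OF simple_J] by (auto simp: inner_def)
  have congH: "inner H (X \<union> Y) = inner H X" if "Y \<inter> verts H = {}" for X Y
    by (rule inner_cong[OF simple_H]) (use that in auto)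
  have congJ: "inner J (X \<union> Y) = inner J Y" if "X \<inter> verts J = {}" for X Y
    by (rule inner_cong[OF simple_J]) (use that in auto)
  have nil: "inner H X = {}" if "X \<inter> verts H = {}" for X
    using inner_cong[OF simple_H, of X "{}"] inner_empty[OF simple_H] that by simp
  have nilJ: "inner J X = {}" if "X \<inter> verts J = {}" for X
    using inner_cong[OF simple_J, of X "{}"] inner_empty[OF simple_J] that by simp
  consider "r \<in> verts H" "j \<le> card (edges H)" | "r \<in> verts H" "j > card (edges H)"
    | "r \<in> verts J" "j \<le> card (edges J)" | "r \<in> verts J" "j > card (edges J)"
    using join.prems(1) by (fastforce simp: verts_G)
  then show ?case
  proof cases
    case 1
    then obtain X where X: "X \<subseteq> verts H" "r \<in> X" "card (inner H X) = j" using join.IH(1) by blast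
    then have "v \<notin> X" "X \<inter> verts J = {}" using u_neq_v disjoint by auto
    then show ?thesis using X by (intro exI[of _ X]) (auto simp: card_inner_G verts_G nilJ)
  next
    case 2
    have "j - card (edges H) - 1 \<le> card (edges J)" using join.prems(2) by (simp add: card_edges_G)
    then obtain X where X: "X \<subseteq> verts J" "v \<in> X" "card (inner J X) = j - card (edges H) - 1"
      using join.IH(2)[OF v] by blast
    moreover have "inner J (verts H \<union> X) = inner J X" using disjoint by (intro congJ) auto
    ultimately show ?thesis using 2 u
      by (intro exI[of _ "verts H \<union> X"]) (auto simp: card_inner_G verts_G all)
  next
    case 3
    then obtain X where X: "X \<subseteq> verts J" "r \<in> X" "card (inner J X) = j" using join.IH(2) by blast
    then have "u \<notin> X" "X \<inter> verts H = {}" using u_neq_v disjoint by auto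
    then show ?thesis using X by (intro exI[of _ X]) (auto simp: card_inner_G verts_G nil)
  next
    case 4
    have "j - card (edges J) - 1 \<le> card (edges H)" using join.prems(2) by (simp add: card_edges_G)
    then obtain X where X: "X \<subseteq> verts H" "u \<in> X" "card (inner H X) = j - card (edges J) - 1"
      using join.IH(1)[OF u] by blast
    moreover have "inner H (verts J \<union> X) = inner H X"
      using disjoint by (subst Un_commute, intro congH) auto
    ultimately show ?thesis using 4 v
      by (intro exI[of _ "verts J \<union> X"]) (auto simp: card_inner_G verts_G all)
  qed
qed

text \<open>
  Complementing a vertex set keeps the edges across it, so the vertex sets found for the two parts can
  be combined in two ways, and one of them is right for the joining edge. Hence trees have no
  obstruction against a half copy in a large induced complete bipartite graph.
\<close>

lemma join_tree_boundary:
  "join_tree G \<Longrightarrow> F \<subseteq> edges G \<Longrightarrow> \<exists>X\<subseteq>verts G. boundary G X = F"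
proof (induction arbitrary: F rule: join_tree.induct)
  case (single x)
  then show ?case by (intro exI[of _ "{}"]) simp
next
  case (join H J u v)
  then interpret edge_join H u J v by (intro edge_joinI)
  obtain X where X: "X \<subseteq> verts H" "boundary H X = F \<inter> edges H" using join.IH(1) by blast
  obtain Y0 where Y0: "Y0 \<subseteq> verts J" "boundary J Y0 = F \<inter> edges J" using join.IH(2) by blast
  \<comment> \<open>Complementing the part in \<open>J\<close> switches only the status of the joining edge.\<close>
  define Y where "Y = (if ({u, v} \<in> F) = ((u \<in> X) \<noteq> (v \<in> Y0)) then Y0 else verts J - Y0)"
  have Y: "Y \<subseteq> verts J" "boundary J Y = F \<inter> edges J" "({u, v} \<in> F) = ((u \<in> X) \<noteq> (v \<in> Y))"
    using Y0 boundary_compl[OF simple_J] v by (auto simp: Y_def)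
  have "boundary H (X \<union> Y) = boundary H X" "boundary J (X \<union> Y) = boundary J Y"
    using X(1) Y(1) disjoint by (auto intro!: boundary_cong simple_H simple_J)
  moreover have "u \<in> X \<union> Y \<longleftrightarrow> u \<in> X" "v \<in> X \<union> Y \<longleftrightarrow> v \<in> Y"
    using X(1) Y(1) u_neq_v by auto
  ultimately have "boundary (join_by_edge H u J v) (X \<union> Y) = F"
    using X(2) Y(2,3) join.prems by (auto simp: boundary_G edges_G)
  then show ?case using X(1) Y(1) by (intro exI[of _ "X \<union> Y"]) (auto simp: verts_G)
qed

lemma max_degree_vertex_in: "max_degree_vertex G x \<Longrightarrow> x \<in> verts G"
  by (simp add: max_degree_vertex_def)

lemma complete_graph_pair:
  assumes "card S = 2"
  obtains a b where "a \<noteq> b" "S = {a, b}"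
    "complete_graph S = join_by_edge \<lparr>verts = {a}, edges = {}\<rparr> a \<lparr>verts = {b}, edges = {}\<rparr> b"
proof -
  obtain a b where ab: "S = {a, b}" "a \<noteq> b" using assms by (auto simp: card_2_iff)
  have "{e. e \<subseteq> S \<and> card e = 2} = {S}"
  proof -
    have "finite S" using assms card_ge_0_finite[of S] by simp
    then have "e = S" if "e \<subseteq> S" "card e = 2" for e
      using that assms by (intro card_subset_eq) auto
    then show ?thesis using assms by auto
  qed
  then have "complete_graph S =
      join_by_edge \<lparr>verts = {a}, edges = {}\<rparr> a \<lparr>verts = {b}, edges = {}\<rparr> b"
    using ab(1) by (auto simp: complete_graph_def join_by_edge_def)
  then show ?thesis using that ab by blast
qed

lemma T_tree_join_tree: "T_tree k G \<Longrightarrow> join_tree G"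
proof (induction rule: T_tree.induct)
  case (T_1 S)
  then show ?case by (elim complete_graph_pair) (auto intro!: join_tree.intros)
next
  case (T_2 S)
  then show ?case by (elim complete_graph_pair) (auto intro!: join_tree.intros)
next
  case (T_step k H J u v)
  then show ?case by (auto intro!: join_tree.intros max_degree_vertex_in)
qed

lemma A_tree_join_tree: "A_tree k G \<Longrightarrow> join_tree G"
  by (induction rule: A_tree.induct) (auto intro!: join_tree.intros max_degree_vertex_in)

section \<open>Half copies\<close>

definition half :: "'a ugraph \<Rightarrow> nat \<Rightarrow> bool" where
  "half G r \<longleftrightarrow> r = card (edges G) div 2 \<or> r = (card (edges G) + 1) div 2"

text \<open>
  With \<open>R\<close> a color class, this is a balanced copy. The set \<open>R\<close> is arbitrary, so that a color class may
  be replaced by its complement, which is how the symmetry of the two colors is used.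
\<close>

definition half_copy :: "'b set \<Rightarrow> 'b set set \<Rightarrow> 'a ugraph \<Rightarrow> bool" where
  "half_copy V R G \<longleftrightarrow> (\<exists>g. inj_on g (verts G) \<and> g ` verts G \<subseteq> V \<and>
     half G (card {e \<in> edges G. g ` e \<in> R}))"

lemma half_compl:
  assumes "r + s = card (edges G)"
  shows "half G r \<longleftrightarrow> half G s"
proof -
  have "card (edges G) - card (edges G) div 2 = (card (edges G) + 1) div 2"
    "card (edges G) - (card (edges G) + 1) div 2 = card (edges G) div 2"
    "card (edges G) div 2 + (card (edges G) + 1) div 2 = card (edges G)"
    by linarith+
  then show ?thesis using assms unfolding half_def by auto
qed

lemma card_filter_compl:
  assumes "finite A"
  shows "card {x \<in> A. P x} + card {x \<in> A. \<not> P x} = card A"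
proof -
  have "card ({x \<in> A. P x} \<union> {x \<in> A. \<not> P x}) = card {x \<in> A. P x} + card {x \<in> A. \<not> P x}"
    using assms by (intro card_Un_disjoint) auto
  moreover have "{x \<in> A. P x} \<union> {x \<in> A. \<not> P x} = A" by auto
  ultimately show ?thesis by simp
qed

lemma half_copy_compl:
  fixes G :: "'b ugraph" and R :: "'c set set"
  assumes "simple_graph G"
  shows "half_copy V (- R) G \<longleftrightarrow> half_copy V R G"
proof -
  have "half G (card {e \<in> edges G. g ` e \<in> - R}) \<longleftrightarrow> half G (card {e \<in> edges G. g ` e \<in> R})"
    for g :: "'b \<Rightarrow> 'c"
    using card_filter_compl[OF simple_graphD(2)[OF assms], of "\<lambda>e. g ` e \<in> R"]
    by (intro half_compl) simp
  then show ?thesis by (simp add: half_copy_def)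
qed

lemma two_part_embedding:
  assumes fin: "finite V" and X: "X \<subseteq> V"
    and KL: "card K \<ge> card V" "card L \<ge> card V" "K \<inter> L = {}" "V \<noteq> {}"
  shows "\<exists>g. inj_on g V \<and> g ` X \<subseteq> K \<and> g ` (V - X) \<subseteq> L"
proof -
  define B where "B b = (if b then K else L)" for b
  have "card V > 0" using fin KL(4) by (simp add: card_gt_0_iff)
  then have fKL: "finite K" "finite L" using KL(1,2) by (auto intro: card_ge_0_finite)
  have "\<exists>g. inj_on g V \<and> (\<forall>w\<in>V. g w \<in> B (w \<in> X))"
  proof (rule embed_by_labels[where l = "\<lambda>w. w \<in> X" and B = B, OF fin])
    fix i
    have "card {w \<in> V. (w \<in> X) = i} \<le> card V" using fin by (intro card_mono) auto
    then show "finite (B i)" "card {w \<in> V. (w \<in> X) = i} \<le> card (B i)"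
      using KL(1,2) fKL by (cases i; simp add: B_def)+
  next
    fix i j :: bool
    assume "i \<noteq> j"
    then show "B i \<inter> B j = {}" using KL(3) by (auto simp: B_def)
  qed
  then obtain g where g: "inj_on g V" "\<And>w. w \<in> V \<Longrightarrow> g w \<in> B (w \<in> X)" by blast
  have "g ` X \<subseteq> K" using g(2) X by (force simp: B_def)
  moreover have "g ` (V - X) \<subseteq> L" using g(2) by (force simp: B_def)
  ultimately show ?thesis using g(1) by blast
qed

lemma join_tree_nonempty: "join_tree G \<Longrightarrow> verts G \<noteq> {}"
  using join_tree_card by fastforce

lemma half_copy_indep_biclique:
  assumes G: "join_tree G" and "indep_biclique (card (verts G)) V R"
  shows "half_copy V R G"
proof -
  note simple = join_tree_simple[OF G]
  obtain K L where KL: "K \<subseteq> V" "L \<subseteq> V" "K \<inter> L = {}" "card K \<ge> card (verts G)"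
      "card L \<ge> card (verts G)" "indep K R" "indep L R" "\<forall>x\<in>K. \<forall>y\<in>L. {x, y} \<in> R"
    using assms(2) unfolding indep_biclique_def by metis
  obtain F where F: "F \<subseteq> edges G" "card F = card (edges G) div 2"
    using obtain_subset_with_card_n[of "card (edges G) div 2" "edges G"] by auto
  obtain X where X: "X \<subseteq> verts G" "boundary G X = F"
    using join_tree_boundary[OF G F(1)] by blast
  obtain g where g: "inj_on g (verts G)" "g ` X \<subseteq> K" "g ` (verts G - X) \<subseteq> L"
    using two_part_embedding[OF simple_graphD(1)[OF simple] X(1) KL(4,5,3) join_tree_nonempty[OF G]]
    by blast
  have "g ` e \<in> R \<longleftrightarrow> e \<in> boundary G X" if e: "e \<in> edges G" for e
  proof -
    obtain x y where xy: "e = {x, y}" "x \<noteq> y" "x \<in> verts G" "y \<in> verts G"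
      using simple_graph_edgeE[OF simple e] .
    have ne: "g x \<noteq> g y" using g(1) xy by (auto simp: inj_on_def)
    have mem: "g w \<in> (if w \<in> X then K else L)" if "w \<in> verts G" for w using g that by auto
    show ?thesis using mem[OF xy(3)] mem[OF xy(4)] KL(6-8) ne e xy
      by (auto simp: boundary_def indep_def insert_commute split: if_splits)
  qed
  then have "{e \<in> edges G. g ` e \<in> R} = F" using X(2) F(1) by auto
  moreover have "g ` verts G \<subseteq> V" using g KL(1,2) by blast
  ultimately show ?thesis
    unfolding half_copy_def using g(1) F(2) by (intro exI[of _ g]) (auto simp: half_def)
qed

lemma half_copy_clique_indep_nonadjacent:
  assumes G: "join_tree G" and KL: "K \<subseteq> V" "L \<subseteq> V" "K \<inter> L = {}" "card K \<ge> card (verts G)"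
      "card L \<ge> card (verts G)" "clique K R" "indep L R" "\<forall>x\<in>K. \<forall>y\<in>L. {x, y} \<notin> R"
  shows "half_copy V R G"
proof -
  note simple = join_tree_simple[OF G]
  obtain r where r: "r \<in> verts G" using join_tree_nonempty[OF G] by blast
  obtain X where X: "X \<subseteq> verts G" "card (inner G X) = card (edges G) div 2"
    using join_tree_inner[OF G r, of "card (edges G) div 2"] by auto
  obtain g where g: "inj_on g (verts G)" "g ` X \<subseteq> K" "g ` (verts G - X) \<subseteq> L"
    using two_part_embedding[OF simple_graphD(1)[OF simple] X(1) KL(4,5,3) join_tree_nonempty[OF G]]
    by blast
  have "g ` e \<in> R \<longleftrightarrow> e \<in> inner G X" if e: "e \<in> edges G" for e
  proof -
    obtain x y where xy: "e = {x, y}" "x \<noteq> y" "x \<in> verts G" "y \<in> verts G"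
      using simple_graph_edgeE[OF simple e] .
    have ne: "g x \<noteq> g y" using g(1) xy by (auto simp: inj_on_def)
    have mem: "g w \<in> (if w \<in> X then K else L)" if "w \<in> verts G" for w using g that by auto
    show ?thesis using mem[OF xy(3)] mem[OF xy(4)] KL(6-8) ne e xy
      by (auto simp: inner_def indep_def clique_def insert_commute split: if_splits)
  qed
  then have "{e \<in> edges G. g ` e \<in> R} = inner G X" by (auto simp: inner_def)
  moreover have "g ` verts G \<subseteq> V" using g KL(1,2) by blast
  ultimately show ?thesis
    unfolding half_copy_def using g(1) X(2) by (intro exI[of _ g]) (auto simp: half_def)
qed

lemma clique_compl: "clique K (- R) \<longleftrightarrow> indep K R" "indep K (- R) \<longleftrightarrow> clique K R"
  by (auto simp: clique_def indep_def)

text \<open>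
  In a coloring in which both colors have a large monochromatic clique, every tree has a balanced
  copy: after thinning out, all edges between the two cliques have the same color as one of the
  cliques. The tree is split into a vertex set with half of the edges inside, for the clique of the
  other color, and the remaining vertices.
\<close>

lemma half_copy_clique_indep:
  assumes G: "join_tree G" and c: "c = card (verts G)"
    and K: "K \<subseteq> V" "clique K R" "card K \<ge> c * 2 ^ (2 * c) + 1"
    and L: "L \<subseteq> V" "indep L R" "card L \<ge> 2 * c + 1"
  shows "half_copy V R G"
proof -
  note simple = join_tree_simple[OF G]
  have c0: "c > 0" using join_tree_card[OF G] c by simp
  \<comment> \<open>A clique and an independent set share at most one vertex, hence the \<open>+ 1\<close> in the assumptions.\<close>
  have fKL: "finite (K \<inter> L)" using K(3) card_ge_0_finite[of K] by simp
  have "a = b" if "a \<in> K \<inter> L" "b \<in> K \<inter> L" for a b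
    using that K(2) L(2) unfolding clique_def indep_def by blast
  then have one: "card (K \<inter> L) \<le> 1" using card_le_Suc0_iff_eq[OF fKL] by simp
  have "L - K = L - K \<inter> L" by auto
  then have "2 * c \<le> card (L - K)"
    using L(3) one diff_card_le_card_Diff[OF fKL, of L] by simp
  then obtain Q where Q: "Q \<subseteq> L - K" "card Q = 2 * c" "finite Q"
    by (rule obtain_subset_with_card_n)
  have "c * 2 ^ card Q \<le> card K" using K(3) Q(2) by simp
  from uniform_to_set[OF Q(3) this c0, of R] obtain K' S where
    K': "K' \<subseteq> K" "card K' \<ge> c" "S \<subseteq> Q" "\<forall>x\<in>K'. \<forall>q\<in>S. {x, q} \<in> R"
      "\<forall>x\<in>K'. \<forall>q\<in>Q - S. {x, q} \<notin> R" by blast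
  have clK: "clique K' R" using K(2) K'(1) by (auto simp: clique_def)
  have inQ: "indep Q R" using L(2) Q(1) by (auto simp: indep_def)
  have "card S + card (Q - S) = 2 * c"
    using Q K'(3) by (metis card_Diff_subset card_mono finite_subset le_add_diff_inverse)
  then consider "card S \<ge> c" | "card (Q - S) \<ge> c" by linarith
  then show ?thesis
  proof cases
    case 1
    have "clique S (- R)" "indep K' (- R)"
      using inQ K'(3) clK by (simp_all add: clique_compl) (auto simp: indep_def)
    moreover have "\<forall>x\<in>S. \<forall>y\<in>K'. {x, y} \<notin> - R" using K'(4) by (metis ComplD insert_commute)
    moreover have "S \<subseteq> V" "K' \<subseteq> V" "S \<inter> K' = {}" using Q(1) K L K'(1,3) by auto
    ultimately have "half_copy V (- R) G"
      using 1 K'(2) c by (intro half_copy_clique_indep_nonadjacent[OF G, of S V K']) auto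
    then show ?thesis using half_copy_compl[OF simple] by blast
  next
    case 2
    have "indep (Q - S) R" "K' \<subseteq> V" "Q - S \<subseteq> V" "K' \<inter> (Q - S) = {}"
      using inQ Q(1) K(1) L(1) K'(1) by (auto simp: indep_def)
    then show ?thesis
      using 2 K'(2,5) clK c
      by (intro half_copy_clique_indep_nonadjacent[OF G, of K' V "Q - S"]) auto
  qed
qed

definition matching :: "'a ugraph \<Rightarrow> 'a set set \<Rightarrow> bool" where
  "matching G M \<longleftrightarrow> M \<subseteq> edges G \<and> pairwise disjnt M"

text \<open>
  The matching edges of the tree are mapped to edges of an induced matching of \<open>R\<close>, and each uncovered
  vertex to an end of a further edge of it. Exactly the matching edges end up in \<open>R\<close>. The trees
  \<open>T_k\<close> and \<open>B_k\<close> have a matching with half of their edges, because all of their vertices, respectively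
  all but one, are matched.
\<close>

lemma half_copy_far_edges:
  assumes G: "simple_graph G" and M: "matching G M" "half G (card M)"
    and F: "F \<subseteq> R" "\<forall>e\<in>F. e \<subseteq> V \<and> card e = 2" "pairwise (far R) F" "card F = card (verts G)" "finite F"
  shows "half_copy V R G"
proof -
  note G_fin = simple_graphD(1,2)[OF G]
  have Me: "e \<in> edges G" if "e \<in> M" for e using M(1) that by (auto simp: matching_def)
  \<comment> \<open>The vertices that have to be mapped into the same edge of \<open>F\<close>.\<close>
  define block where "block w = (if w \<in> \<Union>M then (THE e. e \<in> M \<and> w \<in> e) else {w})" for w
  have block_M: "block w = e" if "w \<in> e" "e \<in> M" for w e
  proof -
    have "pairwise disjnt M" using M(1) by (simp add: matching_def)
    then have "e' = e" if "e' \<in> M" "w \<in> e'" for e'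
      using that \<open>w \<in> e\<close> \<open>e \<in> M\<close> unfolding pairwise_def disjnt_def by blast
    then have "(THE e. e \<in> M \<and> w \<in> e) = e"
      using \<open>w \<in> e\<close> \<open>e \<in> M\<close> by (intro the_equality) blast+
    moreover have "w \<in> \<Union>M" using that by blast
    ultimately show ?thesis by (simp add: block_def)
  qed
  have block_out: "block w = {w}" if "w \<notin> \<Union>M" for w using that by (simp add: block_def)
  have in_block: "w \<in> block w" for w using block_M block_out by (cases "w \<in> \<Union>M") auto
  have card_block: "card {w \<in> verts G. block w = b} \<le> 2" if b: "b \<in> block ` verts G" for b
  proof -
    obtain x where x: "b = block x" using b by auto
    have "card b \<le> 2 \<and> finite b"
    proof (cases "x \<in> \<Union>M")
      case True
      then obtain e where "e \<in> M" "x \<in> e" by auto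
      then show ?thesis
        using x block_M simple_graphD(4)[OF G Me, of e] by (auto intro: card_ge_0_finite)
    qed (use x block_out in simp)
    moreover have "{w \<in> verts G. block w = b} \<subseteq> b" using in_block by auto
    ultimately show ?thesis using card_mono order_trans by blast
  qed
  have "card (block ` verts G) \<le> card F" using F(4) card_image_le[OF G_fin(1)] by metis
  then obtain \<phi> where \<phi>: "\<phi> ` block ` verts G \<subseteq> F" "inj_on \<phi> (block ` verts G)"
    using card_le_inj[of "block ` verts G" F] G_fin(1) F(5) by auto
  have "\<exists>g. inj_on g (verts G) \<and> (\<forall>w\<in>verts G. g w \<in> \<phi> (block w))"
  proof (rule embed_by_labels[where l = block and B = \<phi>, OF G_fin(1)])
    fix b assume b: "b \<in> block ` verts G"
    then have "card (\<phi> b) = 2" using \<phi>(1) F(2) by auto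
    then show "finite (\<phi> b)" "card {w \<in> verts G. block w = b} \<le> card (\<phi> b)"
      using card_block[OF b] by (auto intro: card_ge_0_finite)
  next
    fix b b' assume bb: "b \<in> block ` verts G" "b' \<in> block ` verts G" "b \<noteq> b'"
    then have "\<phi> b \<in> F" "\<phi> b' \<in> F" "\<phi> b \<noteq> \<phi> b'" using \<phi> by (auto simp: inj_on_def)
    then have "far R (\<phi> b) (\<phi> b')" using F(3) by (simp add: pairwise_def)
    then show "\<phi> b \<inter> \<phi> b' = {}" by (simp add: far_def)
  qed
  then obtain g where g: "inj_on g (verts G)" "\<And>w. w \<in> verts G \<Longrightarrow> g w \<in> \<phi> (block w)" by blast
  have "g ` e \<in> R \<longleftrightarrow> e \<in> M" if e: "e \<in> edges G" for e
  proof
    assume eM: "e \<in> M"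
    have ev: "e \<subseteq> verts G" "card e = 2" using simple_graphD(3,4)[OF G e] .
    then obtain w where w: "w \<in> e" by fastforce
    have \<phi>F: "\<phi> e \<in> F" using \<phi>(1) block_M[OF w eM] w ev by (metis imageI subsetD)
    have "g ` e \<subseteq> \<phi> e" using g(2) ev block_M eM by (metis image_subsetI subsetD)
    moreover have "card (g ` e) = card e"
      using inj_on_subset[OF g(1) ev(1)] card_image by blast
    moreover have "card (\<phi> e) = 2" "finite (\<phi> e)"
      using \<phi>F F(2) by (auto intro: card_ge_0_finite)
    ultimately have "g ` e = \<phi> e" using ev(2) card_subset_eq by metis
    then show "g ` e \<in> R" using \<phi>F F(1) by auto
  next
    assume gR: "g ` e \<in> R"
    obtain x y where xy: "e = {x, y}" "x \<noteq> y" "x \<in> verts G" "y \<in> verts G"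
      using simple_graph_edgeE[OF G e] .
    show "e \<in> M"
    proof (rule ccontr)
      assume nM: "e \<notin> M"
      have "block x \<noteq> block y"
      proof
        assume same: "block x = block y"
        show False
        proof (cases "x \<in> \<Union>M")
          case True
          then obtain f where f: "f \<in> M" "x \<in> f" by auto
          then have "y \<in> f" using same block_M in_block[of y] by metis
          moreover have "card f = 2" using simple_graphD(4)[OF G Me[OF f(1)]] .
          ultimately have "f = {x, y}" using f(2) xy(2)
            by (metis card_2_iff doubleton_eq_iff insertE singletonD)
          then show False using nM f(1) xy(1) by simp
        next
          case False
          then show False using same block_out[OF False] in_block[of y] xy(2) by (metis singletonD)
        qed
      qed
      then have "\<phi> (block x) \<noteq> \<phi> (block y)" using \<phi>(2) xy by (auto simp: inj_on_def)
      then have "far R (\<phi> (block x)) (\<phi> (block y))"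
        using F(3) \<phi>(1) xy unfolding pairwise_def by blast
      then have "{g x, g y} \<notin> R" using g(2) xy by (auto simp: far_def)
      then show False using gR xy(1) by simp
    qed
  qed
  then have "{e \<in> edges G. g ` e \<in> R} = M" using Me by auto
  moreover have "g ` verts G \<subseteq> V"
  proof
    fix z assume "z \<in> g ` verts G"
    then obtain w where w: "w \<in> verts G" "z = g w" by auto
    have "\<phi> (block w) \<in> F" using \<phi>(1) w(1) by auto
    then show "z \<in> V" using F(2) g(2)[OF w(1)] w(2) by auto
  qed
  ultimately show ?thesis unfolding half_copy_def using g(1) M(2) by (intro exI[of _ g]) auto
qed

section \<open>Embedding a tree at vertices of large degree\<close>

definition no_shared_neighbour :: "'a ugraph \<Rightarrow> 'a set \<Rightarrow> bool" where
  "no_shared_neighbour G X \<longleftrightarrow> (\<forall>w\<in>verts G - X. \<forall>p\<in>X. \<forall>q\<in>X.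
     {w, p} \<in> edges G \<longrightarrow> {w, q} \<in> edges G \<longrightarrow> p = q)"

lemma finite_neighbours:
  assumes "simple_graph G"
  shows "finite {w. {p, w} \<in> edges G}" "card {w. {p, w} \<in> edges G} \<le> card (verts G)"
proof -
  have "{w. {p, w} \<in> edges G} \<subseteq> verts G" using simple_graphD(3)[OF assms] by auto
  then show "finite {w. {p, w} \<in> edges G}" "card {w. {p, w} \<in> edges G} \<le> card (verts G)"
    using simple_graphD(1)[OF assms] by (auto intro: finite_subset card_mono)
qed

text \<open>
  The vertices \<open>f p\<close> are hubs: vertices with many neighbours in \<open>R\<close>. A vertex set \<open>Q\<close> of the tree is
  mapped to hubs and all other vertices to an independent set, where a neighbour of \<open>p \<in> Q\<close> is mapped
  to a neighbour of \<open>f p\<close>. The choice of this neighbour is free because no vertex has two neighbours in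
  \<open>Q\<close>. So the edges leaving \<open>Q\<close> are in \<open>R\<close>, the edges avoiding \<open>Q\<close> are not, and only for the edges
  inside \<open>Q\<close> the outcome is dictated by the hubs. One pair \<open>f\<close>, \<open>B\<close> serves all subsets \<open>Q\<close> of \<open>P\<close>, which
  allows \<open>Q\<close> to be adapted to the adjacencies between the hubs. The index \<open>None\<close> is for the vertices
  without a neighbour in \<open>Q\<close>.
\<close>

lemma hub_embedding:
  fixes G :: "'a ugraph" and f :: "'a \<Rightarrow> 'b" and B :: "'a option \<Rightarrow> 'b set"
  defines "I P \<equiv> insert None (Some ` P)"
  assumes G: "simple_graph G" and P: "P \<subseteq> verts G"
    and f: "inj_on f P" "f ` P \<subseteq> V"
    and B: "\<And>i. i \<in> I P \<Longrightarrow> finite (B i) \<and> B i \<subseteq> V \<and> f ` P \<inter> B i = {}"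
    and disj: "\<And>i j. i \<in> I P \<Longrightarrow> j \<in> I P \<Longrightarrow> i \<noteq> j \<Longrightarrow> B i \<inter> B j = {}"
    and indep: "indep (\<Union>i\<in>I P. B i) R"
    and size: "card (B None) \<ge> card (verts G)"
      "\<And>p. p \<in> P \<Longrightarrow> card (B (Some p)) \<ge> card {w. {p, w} \<in> edges G}"
    and adj: "\<And>p x. p \<in> P \<Longrightarrow> x \<in> B (Some p) \<Longrightarrow> {f p, x} \<in> R"
    and Q: "Q \<subseteq> P" "no_shared_neighbour G Q"
  shows "\<exists>g. inj_on g (verts G) \<and> g ` verts G \<subseteq> V \<and>
    card {e \<in> edges G. g ` e \<in> R} = card (boundary G Q) + card {e \<in> inner G Q. f ` e \<in> R}"
proof -
  note fin = simple_graphD(1,2)[OF G]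
  define hub where "hub w = (if \<exists>p\<in>Q. {p, w} \<in> edges G then Some (SOME p. p \<in> Q \<and> {p, w} \<in> edges G) else None)" for w
  have hub_Some: "p \<in> Q \<and> {p, w} \<in> edges G" if "hub w = Some p" for w p
    using that someI_ex[of "\<lambda>p. p \<in> Q \<and> {p, w} \<in> edges G"]
    by (auto simp: hub_def split: if_splits)
  have hub_I: "hub w \<in> I P" for w
    using hub_Some Q(1) by (cases "hub w") (auto simp: I_def)
  define l where "l w = (if w \<in> Q then (True, Some w) else (False, hub w))" for w
  define C where "C b = (if fst b then {f (the (snd b))} else B (snd b))" for b
  have "\<exists>g. inj_on g (verts G) \<and> (\<forall>w\<in>verts G. g w \<in> C (l w))"
  proof (rule embed_by_labels[where l = l and B = C, OF fin(1)])
    fix i assume "i \<in> l ` verts G"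
    then obtain x where x: "x \<in> verts G" "i = l x" by auto
    show "finite (C i)" using B hub_I by (auto simp: C_def x l_def)
    show "card {w \<in> verts G. l w = i} \<le> card (C i)"
    proof (cases "x \<in> Q")
      case True
      then have "{w \<in> verts G. l w = i} \<subseteq> {x}" by (auto simp: x l_def split: if_splits)
      then have "card {w \<in> verts G. l w = i} \<le> card {x}" by (intro card_mono) auto
      then show ?thesis using True by (simp add: C_def x l_def)
    next
      case False
      have Ci: "C i = B (hub x)" using False by (simp add: C_def x l_def)
      show ?thesis
      proof (cases "hub x")
        case None
        have "card {w \<in> verts G. l w = i} \<le> card (verts G)" using fin by (intro card_mono) auto
        then show ?thesis using size(1) Ci None by simp
      next
        case (Some p)
        have "p \<in> P" using hub_Some[OF Some] Q(1) by auto
        have "{w \<in> verts G. l w = i} \<subseteq> {w. {p, w} \<in> edges G}"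
          using False Some hub_Some by (auto simp: x l_def split: if_splits)
        then have "card {w \<in> verts G. l w = i} \<le> card {w. {p, w} \<in> edges G}"
          using finite_neighbours[OF G] by (intro card_mono)
        then show ?thesis using size(2)[OF \<open>p \<in> P\<close>] Ci Some by simp
      qed
    qed
  next
    fix i j assume "i \<in> l ` verts G" "j \<in> l ` verts G" and ne: "i \<noteq> j"
    then obtain x y where xy: "i = l x" "j = l y" by auto
    show "C i \<inter> C j = {}"
    proof (cases "x \<in> Q"; cases "y \<in> Q")
      assume "x \<in> Q" "y \<in> Q"
      then have "f x \<noteq> f y" using ne f(1) Q(1) by (auto simp: xy l_def inj_on_def subset_iff)
      then show ?thesis using \<open>x \<in> Q\<close> \<open>y \<in> Q\<close> by (simp add: C_def xy l_def)
    next
      assume "x \<in> Q" "y \<notin> Q"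
      then show ?thesis using B[OF hub_I[of y]] Q(1) by (auto simp: C_def xy l_def)
    next
      assume "x \<notin> Q" "y \<in> Q"
      then show ?thesis using B[OF hub_I[of x]] Q(1) by (auto simp: C_def xy l_def)
    next
      assume "x \<notin> Q" "y \<notin> Q"
      then show ?thesis using disj[OF hub_I[of x] hub_I[of y]] ne by (auto simp: C_def xy l_def)
    qed
  qed
  then obtain g where g: "inj_on g (verts G)" "\<And>w. w \<in> verts G \<Longrightarrow> g w \<in> C (l w)" by blast
  have gQ: "g w = f w" if "w \<in> Q" for w
    using g(2)[of w] that Q(1) P by (auto simp: C_def l_def)
  have gB: "g w \<in> B (hub w)" if "w \<in> verts G" "w \<notin> Q" for w
    using g(2)[of w] that by (auto simp: C_def l_def)
  have mixed: "{g p, g w} \<in> R" if e: "{p, w} \<in> edges G" and pw: "p \<in> Q" "w \<notin> Q" for p w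
  proof -
    have w: "w \<in> verts G" using simple_graphD(3)[OF G e] by auto
    have "hub w \<noteq> None" using e pw by (auto simp: hub_def)
    then obtain q where q: "hub w = Some q" by blast
    then have "q = p"
      using hub_Some[OF q] e pw w Q(2) by (auto simp: no_shared_neighbour_def insert_commute)
    then show ?thesis using adj[of p "g w"] gB[OF w pw(2)] q gQ[OF pw(1)] pw(1) Q(1) by auto
  qed
  have "g ` e \<in> R \<longleftrightarrow> e \<in> boundary G Q \<union> {e \<in> inner G Q. f ` e \<in> R}" if e: "e \<in> edges G" for e
  proof -
    obtain x y where xy: "e = {x, y}" "x \<noteq> y" "x \<in> verts G" "y \<in> verts G"
      using simple_graph_edgeE[OF G e] .
    show ?thesis
    proof (cases "x \<in> Q"; cases "y \<in> Q")
      assume "x \<in> Q" "y \<in> Q"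
      then show ?thesis using gQ e xy(1) by (simp add: boundary_def inner_def)
    next
      assume "x \<in> Q" "y \<notin> Q"
      then show ?thesis using mixed[of x y] e xy(1) by (simp add: boundary_def)
    next
      assume "x \<notin> Q" "y \<in> Q"
      then show ?thesis using mixed[of y x] e xy(1) by (simp add: boundary_def insert_commute)
    next
      assume nQ: "x \<notin> Q" "y \<notin> Q"
      have "g x \<noteq> g y" using g(1) xy by (auto simp: inj_on_def)
      moreover have "g x \<in> (\<Union>i\<in>I P. B i)" "g y \<in> (\<Union>i\<in>I P. B i)"
        using gB xy nQ hub_I by blast+
      ultimately have "{g x, g y} \<notin> R" using indep unfolding indep_def by blast
      then show ?thesis using nQ xy(1) by (simp add: boundary_def inner_def)
    qed
  qed
  then have "{e \<in> edges G. g ` e \<in> R} = boundary G Q \<union> {e \<in> inner G Q. f ` e \<in> R}"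
    by (auto simp: boundary_def inner_def)
  moreover have "finite (boundary G Q)" "finite (inner G Q)"
    using fin(2) by (auto simp: boundary_def inner_def)
  moreover have "boundary G Q \<inter> {e \<in> inner G Q. f ` e \<in> R} = {}"
    by (auto simp: boundary_def inner_def)
  ultimately have "card {e \<in> edges G. g ` e \<in> R} =
      card (boundary G Q) + card {e \<in> inner G Q. f ` e \<in> R}"
    by (simp add: card_Un_disjoint)
  moreover have "g ` verts G \<subseteq> V"
  proof
    fix z assume "z \<in> g ` verts G"
    then obtain w where w: "w \<in> verts G" "z = g w" by auto
    show "z \<in> V"
    proof (cases "w \<in> Q")
      case True then show ?thesis using gQ w f(2) Q(1) by auto
    next
      case False then show ?thesis using gB[OF w(1)] w(2) B[OF hub_I[of w]] by auto
    qed
  qed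
  ultimately show ?thesis using g(1) by (intro exI[of _ g] conjI)
qed

text \<open>
  The predicate \<open>\<kappa>\<close> stands for the unknown adjacencies between the hubs. The vertex \<open>l\<close>, a leaf, makes it
  possible to do with \<open>t - 1\<close> hubs and one disjoint edge: the edge at \<open>l\<close> takes over the role of \<open>l\<close>.
\<close>

definition hub_placement :: "'a ugraph \<Rightarrow> nat \<Rightarrow> 'a set \<Rightarrow> 'a \<Rightarrow> bool" where
  "hub_placement G t P l \<longleftrightarrow> P \<subseteq> verts G \<and> card P = t \<and> l \<in> P \<and> card {w. {l, w} \<in> edges G} \<le> 1 \<and>
     (\<forall>\<kappa>. \<exists>Q\<subseteq>P. no_shared_neighbour G Q \<and>
        half G (card (boundary G Q) + card {e \<in> inner G Q. \<kappa> e}))"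

section \<open>Dense color classes without large cliques\<close>

definition all_pairs :: "'a set \<Rightarrow> 'a set set" where
  "all_pairs V = {e. e \<subseteq> V \<and> card e = 2}"

lemma finite_all_pairs: "finite V \<Longrightarrow> finite (all_pairs V)"
  by (rule finite_subset[of _ "Pow V"]) (auto simp: all_pairs_def)

lemma card_all_pairs: "finite V \<Longrightarrow> card (all_pairs V) = card V choose 2"
  by (simp add: all_pairs_def n_subsets)

lemma card_edges_at:
  assumes "R \<subseteq> all_pairs V"
  shows "card {e \<in> R. x \<in> e} = card {y. {x, y} \<in> R}"
proof -
  have "{e \<in> R. x \<in> e} = (\<lambda>y. {x, y}) ` {y. {x, y} \<in> R}"
  proof (intro subset_antisym subsetI)
    fix e assume e: "e \<in> {e \<in> R. x \<in> e}"
    then have "card e = 2" using assms by (auto simp: all_pairs_def)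
    then obtain y where "e = {x, y}" using e by (auto simp: card_2_iff)
    then show "e \<in> (\<lambda>y. {x, y}) ` {y. {x, y} \<in> R}" using e by auto
  qed auto
  moreover have "inj_on (\<lambda>y. {x, y}) {y. {x, y} \<in> R}"
    by (auto simp: inj_on_def doubleton_eq_iff)
  ultimately show ?thesis by (simp add: card_image)
qed

lemma card_neighbours_le:
  assumes "R \<subseteq> all_pairs V" "finite V"
  shows "{y. {x, y} \<in> R} \<subseteq> V" "card {e \<in> R. x \<in> e} \<le> card V"
proof -
  show 1: "{y. {x, y} \<in> R} \<subseteq> V" using assms(1) by (auto simp: all_pairs_def)
  show "card {e \<in> R. x \<in> e} \<le> card V"
    unfolding card_edges_at[OF assms(1)] by (rule card_mono[OF assms(2) 1])
qed

lemma card_edges_meeting: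
  assumes "R \<subseteq> all_pairs V" "finite V" "finite H"
  shows "card {e \<in> R. e \<inter> H \<noteq> {}} \<le> card H * card V"
proof -
  have "{e \<in> R. e \<inter> H \<noteq> {}} = (\<Union>x\<in>H. {e \<in> R. x \<in> e})" by auto
  then have "card {e \<in> R. e \<inter> H \<noteq> {}} \<le> (\<Sum>x\<in>H. card {e \<in> R. x \<in> e})"
    using card_UN_le[OF assms(3)] by simp
  also have "\<dots> \<le> (\<Sum>x\<in>H. card V)" by (rule sum_mono) (rule card_neighbours_le[OF assms(1,2)])
  finally show ?thesis by simp
qed

lemma card_cover_le:
  assumes "R \<subseteq> all_pairs V" "finite V" "H \<subseteq> V" "\<forall>e\<in>R. e \<inter> H \<noteq> {}"
  shows "card R + ((card V - card H) choose 2) \<le> card V choose 2"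
proof -
  have fV: "finite (V - H)" using assms(2) by simp
  have "R \<inter> all_pairs (V - H) = {}" using assms(4) by (auto simp: all_pairs_def)
  moreover have "finite R" using assms(1) finite_all_pairs[OF assms(2)] finite_subset by blast
  ultimately have "card R + card (all_pairs (V - H)) = card (R \<union> all_pairs (V - H))"
    using finite_all_pairs[OF fV] by (simp add: card_Un_disjoint)
  also have "\<dots> \<le> card (all_pairs V)"
    using assms(1) by (intro card_mono finite_all_pairs[OF assms(2)]) (auto simp: all_pairs_def)
  finally show ?thesis
    using card_all_pairs[OF fV] card_all_pairs[OF assms(2)] card_Diff_subset[OF _ assms(3)]
      finite_subset[OF assms(3,2)] by simp
qed

text \<open>
  The number of pairs that meet a fixed set of \<open>s\<close> vertices. For \<open>s = t - 1\<close> this is the largest number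
  of edges, for large \<open>n\<close>, of a graph without \<open>t\<close> disjoint edges, which is the bound for \<open>bal\<close>.
\<close>

lemma choose_two_cover:
  assumes "s \<le> n"
  shows "(n choose 2) + (Suc s choose 2) = s * n + ((n - s) choose 2)"
proof -
  obtain m where m: "n = m + s" using assms by (metis le_add_diff_inverse2)
  have "2 * (k choose 2) = k * (k - 1)" for k :: nat
  proof -
    have "even (k * (k - 1))" by (cases "even k") auto
    then show ?thesis by (simp add: choose_two)
  qed
  from this[of n] this[of "Suc s"] this[of m] show ?thesis
    unfolding m by (cases m; cases s) (auto simp: algebra_simps binomial_eq_0)
qed

text \<open>
  Let \<open>H\<close> be the set of vertices of degree at least \<open>d\<close>, the hubs. If many edges avoid \<open>H\<close>, then they
  contain a large induced matching. Otherwise almost all edges meet \<open>H\<close>, and as there are more than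
  \<open>(t - 1) * n - (t choose 2)\<close> edges, \<open>H\<close> has at least \<open>t - 1\<close> vertices. If it has at least \<open>t\<close>, these are
  the hubs for the placement. If it has \<open>t - 1\<close>, then the number of edges leaves no choice but that each
  hub is adjacent to all except a bounded number of vertices and that some edge \<open>{x, y}\<close> avoids \<open>H\<close>;
  then \<open>y\<close> replaces the missing hub, and \<open>x\<close> is the only neighbour it needs.
\<close>

lemma dense_half_copy:
  fixes c t N :: nat
  assumes t: "t > 0"
  shows "\<exists>n0. \<forall>n\<ge>n0. \<forall>(G :: 'a ugraph) M P l R. join_tree G \<longrightarrow> card (verts G) = c \<longrightarrow>
     matching G M \<longrightarrow> half G (card M) \<longrightarrow> hub_placement G t P l \<longrightarrow>
     R \<subseteq> all_pairs {..<n} \<longrightarrow> card R + (t choose 2) > (t - 1) * n \<longrightarrow>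
     \<not> (\<exists>K\<subseteq>{..<n}. card K = N \<and> clique K R) \<longrightarrow> half_copy {..<n} R G"
proof (cases "c = 0")
  case True
  then show ?thesis using join_tree_card by fastforce
next
  case False
  obtain D where D: "\<forall>(I :: 'a option set) (V :: nat set) R A. finite I \<and> card I = t + 1 \<longrightarrow> finite V \<longrightarrow>
     \<not> (\<exists>K\<subseteq>V. card K = N \<and> clique K R) \<longrightarrow> \<not> indep_biclique c V R \<longrightarrow>
     (\<forall>i\<in>I. A i \<subseteq> V \<and> card (A i) \<ge> D) \<longrightarrow>
     (\<exists>B. (\<forall>i\<in>I. B i \<subseteq> A i \<and> card (B i) \<ge> c) \<and>
        (\<forall>i\<in>I. \<forall>j\<in>I. i \<noteq> j \<longrightarrow> B i \<inter> B j = {}) \<and> indep (\<Union>i\<in>I. B i) R)"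
    by (rule exE[OF disjoint_family_in_indep[of c "t + 1" N c]]) (use False in simp_all)
  \<comment> \<open>The degree of a hub: \<open>D\<close> neighbours must remain after deleting the \<open>t\<close> hubs.\<close>
  define d where "d = D + t"
  \<comment> \<open>More than \<open>r\<close> edges off the hubs contain an induced matching of size \<open>c\<close>.\<close>
  define r where "r = c * (2 * (d + 1) * d)"
  \<comment> \<open>In the case of \<open>t - 1\<close> hubs, a bound for the non-neighbours of each of them.\<close>
  define m where "m = (t choose 2) + r"
  define n0 where "n0 = D + t + 2 + d + t * (m + 1) + m"
  show ?thesis
  proof (intro exI[of _ n0] allI impI)
    fix n and G :: "'a ugraph" and M P l R
    assume n: "n0 \<le> n" and jt: "join_tree G" and c: "card (verts G) = c" and M: "matching G M"
      and hM: "half G (card M)" and hp: "hub_placement G t P l" and R: "R \<subseteq> all_pairs {..<n}"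
      and big: "card R + (t choose 2) > (t - 1) * n"
      and noK: "\<not> (\<exists>K\<subseteq>{..<n}. card K = N \<and> clique K R)"
    define V where "V = {..<n}"
    have fV: "finite V" and cV: "card V = n" by (simp_all add: V_def)
    note R = R[folded V_def]
    note G = join_tree_simple[OF jt]
    have fR: "finite R" using R finite_all_pairs[OF fV] finite_subset by blast
    have P: "P \<subseteq> verts G" "card P = t" "l \<in> P" "card {w. {l, w} \<in> edges G} \<le> 1"
      using hp by (simp_all add: hub_placement_def)
    have fP: "finite P" using P(1) simple_graphD(1)[OF G] finite_subset by blast
    define I where "I = insert None (Some ` P)"
    have I: "finite I \<and> card I = t + 1" using fP P(2) by (auto simp: I_def card_image)
    define H where "H = {x \<in> V. card {e \<in> R. x \<in> e} \<ge> d}"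
    have HV: "H \<subseteq> V" and fH: "finite H" using fV by (auto simp: H_def)
    define F where "F = {e \<in> R. e \<inter> H = {}}"
    show "half_copy {..<n} R G"
      unfolding V_def[symmetric]
    proof (cases "indep_biclique c V R")
      case True
      then show "half_copy V R G" using half_copy_indep_biclique[OF jt] c by simp
    next
      case noB: False
      have split_R: "card R \<le> card {e \<in> R. e \<inter> H \<noteq> {}} + card F"
        using card_filter_compl[OF fR, of "\<lambda>e. e \<inter> H \<noteq> {}"] by (simp add: F_def)
      have finish: "half_copy V R G"
        if f: "inj_on f P" "f ` P \<subseteq> V"
          and B: "\<And>i. i \<in> I \<Longrightarrow> finite (B i) \<and> B i \<subseteq> V \<and> f ` P \<inter> B i = {}"
          and disj: "\<And>i j. i \<in> I \<Longrightarrow> j \<in> I \<Longrightarrow> i \<noteq> j \<Longrightarrow> B i \<inter> B j = {}"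
          and indep: "indep (\<Union>i\<in>I. B i) R"
          and size: "card (B None) \<ge> card (verts G)"
            "\<And>p. p \<in> P \<Longrightarrow> card (B (Some p)) \<ge> card {w. {p, w} \<in> edges G}"
          and adj: "\<And>p x. p \<in> P \<Longrightarrow> x \<in> B (Some p) \<Longrightarrow> {f p, x} \<in> R"
        for f and B :: "'a option \<Rightarrow> nat set"
      proof -
        have "\<forall>\<kappa>. \<exists>Q\<subseteq>P. no_shared_neighbour G Q \<and>
            half G (card (boundary G Q) + card {e \<in> inner G Q. \<kappa> e})"
          using hp unfolding hub_placement_def by (elim conjE)
        from this[THEN spec, of "\<lambda>e. f ` e \<in> R"] obtain Q where Q: "Q \<subseteq> P" "no_shared_neighbour G Q"
            "half G (card (boundary G Q) + card {e \<in> inner G Q. f ` e \<in> R})"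
          by (elim exE conjE) (rule that)
        have "\<exists>g. inj_on g (verts G) \<and> g ` verts G \<subseteq> V \<and>
            card {e \<in> edges G. g ` e \<in> R} =
              card (boundary G Q) + card {e \<in> inner G Q. f ` e \<in> R}"
          by (rule hub_embedding[where B = B and P = P])
            (fact G P(1) f(1) f(2) B[unfolded I_def] disj[unfolded I_def] indep[unfolded I_def]
              size(1) size(2) adj Q(1) Q(2))+
        then obtain g where "inj_on g (verts G)" "g ` verts G \<subseteq> V"
            "card {e \<in> edges G. g ` e \<in> R} =
              card (boundary G Q) + card {e \<in> inner G Q. f ` e \<in> R}"
          by (elim exE conjE) (rule that)
        then show ?thesis
          unfolding half_copy_def using Q(3) by (intro exI[of _ g]) simp
      qed
      have family: "\<exists>B. (\<forall>i\<in>I. B i \<subseteq> A i \<and> card (B i) \<ge> c) \<and>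
        (\<forall>i\<in>I. \<forall>j\<in>I. i \<noteq> j \<longrightarrow> B i \<inter> B j = {}) \<and> indep (\<Union>i\<in>I. B i) R"
        if A: "\<forall>i\<in>I. A i \<subseteq> V \<and> card (A i) \<ge> D" for A
        by (rule D[THEN spec, THEN spec, THEN spec, THEN spec, THEN mp, THEN mp, THEN mp, THEN mp,
              THEN mp, OF I fV noK[folded V_def] noB A])
      have nb_le: "card {w. {p, w} \<in> edges G} \<le> c" for p
        using finite_neighbours(2)[OF G] c by simp
      consider (matching) "card F > r" | (hubs) "card H \<ge> t"
        | (few) "card H + 1 < t" "card F \<le> r" | (tight) "card H + 1 = t" "card F \<le> r"
        by linarith
      then show "half_copy V R G"
      proof cases
        case matching
        have fF: "finite F" using fR by (simp add: F_def)
        have F2: "\<forall>e\<in>F. e \<subseteq> V \<and> card e = 2" using R by (auto simp: F_def all_pairs_def)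
        have "\<exists>M'\<subseteq>F. card M' = c \<and> pairwise (far R) M'"
        proof (rule many_far_edges[OF fF])
          show "\<forall>e\<in>F. card e = 2" using F2 by simp
          show "c * (2 * (d + 1) * d) < card F" using matching by (simp add: r_def)
          show "{x, y} \<in> F" if "x \<in> \<Union>F" "y \<in> \<Union>F" "{x, y} \<in> R" for x y
            using that by (auto simp: F_def)
          fix x
          show "card {e \<in> F. x \<in> e} \<le> d"
          proof (cases "x \<in> V - H")
            case True
            have "card {e \<in> F. x \<in> e} \<le> card {e \<in> R. x \<in> e}"
              using fR by (intro card_mono) (auto simp: F_def)
            moreover have "card {e \<in> R. x \<in> e} < d" using True by (auto simp: H_def)
            ultimately show ?thesis by linarith
          next
            case False
            then have "{e \<in> F. x \<in> e} = {}" using F2 by (auto simp: F_def)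
            then show ?thesis by (simp only: card.empty)
          qed
        qed
        then obtain M' where M': "M' \<subseteq> F" "card M' = c" "pairwise (far R) M'" by blast
        show ?thesis
          by (rule half_copy_far_edges[OF G M hM, of M'])
            (use M' F2 c fF in \<open>auto simp: F_def intro: finite_subset\<close>)
      next
        case hubs
        then obtain f where f: "f ` P \<subseteq> H" "inj_on f P"
          using card_le_inj[OF fP fH] P(2) by auto
        define A where "A i = (case i of None \<Rightarrow> V | Some p \<Rightarrow> {y. {f p, y} \<in> R}) - f ` P" for i
        have cfP: "card (f ` P) \<le> t" using card_image_le[OF fP, of f] P(2) by simp
        have ffP: "finite (f ` P)" using fP by simp
        have "\<forall>i\<in>I. A i \<subseteq> V \<and> card (A i) \<ge> D"
        proof
          fix i assume i: "i \<in> I"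
          define Z where "Z = (case i of None \<Rightarrow> V | Some p \<Rightarrow> {y. {f p, y} \<in> R})"
          have "Z \<subseteq> V \<and> card Z \<ge> d"
          proof (cases i)
            case None
            then show ?thesis using n cV by (simp add: Z_def n0_def d_def)
          next
            case (Some p)
            then have "f p \<in> H" using i f(1) by (auto simp: I_def)
            then show ?thesis
              using Some card_neighbours_le(1)[OF R fV] card_edges_at[OF R, of "f p"]
              by (simp add: Z_def H_def)
          qed
          moreover have "A i = Z - f ` P" by (simp add: A_def Z_def)
          ultimately show "A i \<subseteq> V \<and> card (A i) \<ge> D"
            using diff_card_le_card_Diff[OF ffP, of Z] cfP by (auto simp: d_def)
        qed
        from family[OF this] obtain B where
          B: "\<forall>i\<in>I. B i \<subseteq> A i \<and> card (B i) \<ge> c" "\<forall>i\<in>I. \<forall>j\<in>I. i \<noteq> j \<longrightarrow> B i \<inter> B j = {}"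
            "indep (\<Union>i\<in>I. B i) R"
          by (elim exE conjE) (rule that)
        have AV: "A i \<subseteq> V" for i
          using card_neighbours_le(1)[OF R fV] by (auto simp: A_def split: option.splits)
        show ?thesis
        proof (rule finish[OF f(2), of B])
          show "f ` P \<subseteq> V" using f(1) HV by simp
          show "indep (\<Union>i\<in>I. B i) R" by (rule B(3))
          show "card (verts G) \<le> card (B None)" using B(1) c by (simp add: I_def)
          fix i assume i: "i \<in> I"
          have "B i \<subseteq> A i" using B(1) i by simp
          moreover have "f ` P \<inter> A i = {}" by (auto simp: A_def)
          ultimately show "finite (B i) \<and> B i \<subseteq> V \<and> f ` P \<inter> B i = {}"
            using AV[of i] fV finite_subset[of "B i" V] by blast
          show "B i \<inter> B j = {}" if "j \<in> I" "i \<noteq> j" for j using B(2) i that by blast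
        next
          fix p assume p: "p \<in> P"
          then have pI: "Some p \<in> I" by (simp add: I_def)
          show "card {w. {p, w} \<in> edges G} \<le> card (B (Some p))"
            using B(1) pI nb_le[of p] by force
          have "B (Some p) \<subseteq> A (Some p)" using B(1) pI by blast
          then show "{f p, x} \<in> R" if "x \<in> B (Some p)" for x
            using that by (auto simp: A_def)
        qed
      next
        case few
        have "card R \<le> card H * n + r"
          using split_R card_edges_meeting[OF R fV fH] few(2) cV by simp
        moreover have "card H * n + n \<le> (t - 1) * n"
        proof -
          have "Suc (card H) \<le> t - 1" using few(1) by linarith
          from mult_le_mono1[OF this, of n] show ?thesis by simp
        qed
        ultimately have "n < m" using big by (simp add: m_def)
        then show ?thesis using n by (simp add: n0_def)
      next
        case tight
        have "F \<noteq> {}"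
        proof
          assume "F = {}"
          then have "\<forall>e\<in>R. e \<inter> H \<noteq> {}" by (auto simp: F_def)
          from card_cover_le[OF R fV HV this]
          have "card R + ((n - card H) choose 2) \<le> n choose 2" using cV by simp
          moreover have "(n choose 2) + (t choose 2) = (t - 1) * n + ((n - card H) choose 2)"
            using choose_two_cover[of "card H" n] tight(1) card_mono[OF fV HV] cV by auto
          ultimately show False using big by linarith
        qed
        then obtain e where e: "e \<in> R" "e \<inter> H = {}" by (auto simp: F_def)
        then have e2: "e \<subseteq> V" "card e = 2" using R by (auto simp: all_pairs_def)
        then obtain x y where xy: "e = {x, y}" "x \<noteq> y" by (auto simp: card_2_iff)
        have xH: "x \<in> V - H" "y \<in> V - H" using e e2 xy by auto
        have miss: "card (V - {w. {h, w} \<in> R}) \<le> m" if h: "h \<in> H" for h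
        proof -
          have "{e \<in> R. e \<inter> H \<noteq> {}} \<subseteq> {e \<in> R. h \<in> e} \<union> {e \<in> R. e \<inter> (H - {h}) \<noteq> {}}" by auto
          then have "card {e \<in> R. e \<inter> H \<noteq> {}} \<le>
              card ({e \<in> R. h \<in> e} \<union> {e \<in> R. e \<inter> (H - {h}) \<noteq> {}})"
            using fR by (intro card_mono) auto
          also have "\<dots> \<le> card {e \<in> R. h \<in> e} + card {e \<in> R. e \<inter> (H - {h}) \<noteq> {}}"
            by (rule card_Un_le)
          also have "\<dots> \<le> card {w. {h, w} \<in> R} + (card H - 1) * n"
            using card_edges_at[OF R] card_edges_meeting[OF R fV, of "H - {h}"] fH h cV by simp
          finally have "card R \<le> card {w. {h, w} \<in> R} + (card H - 1) * n + r"
            using split_R tight(2) by linarith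
          moreover have "(t - 1) * n = (card H - 1) * n + n"
          proof -
            have "card H > 0" using h fH by (auto simp: card_gt_0_iff)
            then have "t - 1 = Suc (card H - 1)" using tight(1) by linarith
            then show ?thesis by simp
          qed
          ultimately have "n \<le> card {w. {h, w} \<in> R} + m" using big by (simp add: m_def)
          moreover have "card (V - {w. {h, w} \<in> R}) = n - card {w. {h, w} \<in> R}"
            using card_Diff_subset[OF finite_subset[OF card_neighbours_le(1)[OF R fV] fV]
                card_neighbours_le(1)[OF R fV]] cV by simp
          ultimately show ?thesis by simp
        qed
        \<comment> \<open>Outside \<open>bad\<close>, every vertex is adjacent to all hubs and not adjacent to \<open>x\<close>.\<close>
        define bad where "bad = H \<union> {x, y} \<union> {w. {x, w} \<in> R} \<union> (\<Union>h\<in>H. V - {w. {h, w} \<in> R})"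
        have fbad: "finite bad"
          using fH fV finite_subset[OF card_neighbours_le(1)[OF R fV] fV] by (auto simp: bad_def)
        have "card bad \<le> card H + 2 + d + card H * m"
        proof -
          have "card (\<Union>h\<in>H. V - {w. {h, w} \<in> R}) \<le> (\<Sum>h\<in>H. card (V - {w. {h, w} \<in> R}))"
            by (rule card_UN_le[OF fH])
          also have "\<dots> \<le> (\<Sum>h\<in>H. m)" by (rule sum_mono) (rule miss)
          finally have 1: "card (\<Union>h\<in>H. V - {w. {h, w} \<in> R}) \<le> card H * m" by simp
          have 2: "card {w. {x, w} \<in> R} \<le> d"
            using xH(1) card_edges_at[OF R, of x] by (auto simp: H_def)
          have "card {x, y} = 2" using xy(2) by simp
          then show ?thesis
            using 1 2 card_Un_le[of H "{x, y}"] card_Un_le[of "H \<union> {x, y}" "{w. {x, w} \<in> R}"]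
              card_Un_le[of "H \<union> {x, y} \<union> {w. {x, w} \<in> R}" "\<Union>h\<in>H. V - {w. {h, w} \<in> R}"]
            unfolding bad_def by linarith
        qed
        also have "\<dots> \<le> t + 2 + d + t * (m + 1)"
        proof -
          have "card H \<le> t" using tight(1) by linarith
          moreover from this have "card H * m \<le> t * m" by (rule mult_le_mono1)
          ultimately have "card H + card H * m \<le> t + t * m" by (rule add_mono)
          moreover have "t * (m + 1) = t * m + t" by simp
          ultimately show ?thesis by linarith
        qed
        finally have "D \<le> card (V - bad)"
          using n cV diff_card_le_card_Diff[OF fbad, of V] by (simp add: n0_def)
        then have "\<forall>i\<in>I. V - bad \<subseteq> V \<and> card (V - bad) \<ge> D" by auto
        from family[OF this] obtain B where
          B: "\<forall>i\<in>I. B i \<subseteq> V - bad \<and> card (B i) \<ge> c" "\<forall>i\<in>I. \<forall>j\<in>I. i \<noteq> j \<longrightarrow> B i \<inter> B j = {}"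
            "indep (\<Union>i\<in>I. B i) R"
          by (elim exE conjE) (rule that)
        have "card (P - {l}) \<le> card H" using P(2,3) tight(1) by simp
        then obtain f0 where f0: "f0 ` (P - {l}) \<subseteq> H" "inj_on f0 (P - {l})"
          using card_le_inj[of "P - {l}" H] fP fH by auto
        \<comment> \<open>The edge \<open>{x, y}\<close> becomes the image of the edge at the leaf \<open>l\<close>.\<close>
        define f where "f = f0(l := y)"
        define B' where "B' = B(Some l := {x})"
        have Bi: "B' i \<subseteq> insert x (V - bad)" "i \<noteq> Some l \<Longrightarrow> B' i \<subseteq> V - bad"
          if "i \<in> I" for i using B(1) that by (auto simp: B'_def)
        have x_bad: "x \<in> bad" "y \<in> bad" "H \<subseteq> bad" by (auto simp: bad_def)
        have fl: "f l = y" by (simp add: f_def)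
        have fp: "f p \<in> H" if "p \<in> P" "p \<noteq> l" for p using that f0(1) by (auto simp: f_def)
        show ?thesis
        proof (rule finish[of f B'])
          have "inj_on f (P - {l})" using f0(2) by (auto simp: f_def inj_on_def)
          moreover have "y \<notin> f ` (P - {l})" using fp xH(2) by auto
          ultimately have "inj_on f (insert l (P - {l}))" using fl by (simp only: inj_on_insert) auto
          then show "inj_on f P" by (simp only: insert_Diff[OF P(3)])
          show "f ` P \<subseteq> V"
          proof
            fix z assume "z \<in> f ` P"
            then show "z \<in> V" using fp fl xH(2) HV by (cases "z = y") auto
          qed
          show "indep (\<Union>i\<in>I. B' i) R"
            unfolding indep_def
          proof (intro ballI impI)
            fix a b assume ab: "a \<in> (\<Union>i\<in>I. B' i)" "b \<in> (\<Union>i\<in>I. B' i)" "a \<noteq> b"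
            have mem: "z = x \<or> z \<in> (\<Union>i\<in>I. B i) \<and> {x, z} \<notin> R" if "z \<in> (\<Union>i\<in>I. B' i)" for z
            proof (cases "z = x")
              case False
              then obtain i where "i \<in> I" "z \<in> B i"
                using \<open>z \<in> (\<Union>i\<in>I. B' i)\<close> by (auto simp: B'_def split: if_splits)
              moreover from this have "z \<notin> bad" using B(1) by auto
              ultimately show ?thesis by (auto simp: bad_def)
            qed simp
            show "{a, b} \<notin> R"
              using mem[OF ab(1)] mem[OF ab(2)] ab(3) B(3)
              unfolding indep_def by (metis insert_commute)
          qed
          show "card (verts G) \<le> card (B' None)" using B(1) c by (simp add: B'_def I_def)
          fix i assume i: "i \<in> I"
          have sub: "B' i \<subseteq> insert x (V - bad)" using Bi(1)[OF i] .
          moreover have "f ` P \<inter> insert x (V - bad) = {}"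
          proof -
            have "f p \<in> bad \<and> f p \<noteq> x" if "p \<in> P" for p
              using that fp[of p] fl x_bad xH(1) xy(2) by (cases "p = l") auto
            then show ?thesis by auto
          qed
          moreover have "insert x (V - bad) \<subseteq> V" using xH(1) by auto
          ultimately show "finite (B' i) \<and> B' i \<subseteq> V \<and> f ` P \<inter> B' i = {}"
            using fV finite_subset[of "B' i" V] by blast
          show "B' i \<inter> B' j = {}" if j: "j \<in> I" "i \<noteq> j" for j
          proof (cases "i = Some l \<or> j = Some l")
            case True
            then show ?thesis
              using Bi(2)[OF i] Bi(2)[OF j(1)] j(2) x_bad(1) by (auto simp: B'_def)
          next
            case False
            then show ?thesis using B(2) i j by (auto simp: B'_def)
          qed
        next
          fix p assume p: "p \<in> P"
          then have pI: "Some p \<in> I" by (simp add: I_def)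
          show "card {w. {p, w} \<in> edges G} \<le> card (B' (Some p))"
          proof (cases "p = l")
            case True then show ?thesis using P(4) by (simp add: B'_def)
          next
            case False
            then show ?thesis using B(1) pI nb_le[of p] by (force simp: B'_def)
          qed
          show "{f p, z} \<in> R" if z: "z \<in> B' (Some p)" for z
          proof (cases "p = l")
            case True
            then show ?thesis using z fl e(1) xy(1) by (simp add: B'_def insert_commute)
          next
            case False
            then have "z \<in> V - bad" using Bi(2)[OF pI] z by auto
            then show ?thesis using fp[OF p False] by (auto simp: bad_def)
          qed
        qed
      qed
    qed
  qed
qed

section \<open>Bounds for the balancing number\<close>

lemma color_class_pairs: "color_class n c x \<subseteq> all_pairs {..<n}"
  by (auto simp: color_class_def complete_graph_def all_pairs_def)

lemma color_class_Blue: "e \<in> all_pairs {..<n} \<Longrightarrow> e \<in> color_class n c Blue \<longleftrightarrow> e \<notin> color_class n c Red"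
  by (cases "c e") (auto simp: color_class_def complete_graph_def all_pairs_def)

lemma image_edge_pair:
  assumes "simple_graph G" "inj_on g (verts G)" "g ` verts G \<subseteq> V" "e \<in> edges G"
  shows "g ` e \<in> all_pairs V"
proof -
  have e: "e \<subseteq> verts G" "card e = 2" using simple_graphD(3,4)[OF assms(1,4)] .
  then have "card (g ` e) = 2" using card_image[OF inj_on_subset[OF assms(2) e(1)]] by simp
  then show ?thesis using e(1) assms(3) by (auto simp: all_pairs_def)
qed

lemma card_image_edges:
  assumes "simple_graph G" "inj_on g (verts G)"
  shows "card ((\<lambda>e. g ` e) ` edges G \<inter> S) = card {e \<in> edges G. g ` e \<in> S}"
proof -
  have "inj_on (\<lambda>e. g ` e) (Pow (verts G))" by (rule inj_on_image_Pow[OF assms(2)])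
  then have "inj_on (\<lambda>e. g ` e) {e \<in> edges G. g ` e \<in> S}"
    by (rule inj_on_subset) (use simple_graphD(3)[OF assms(1)] in auto)
  moreover have "(\<lambda>e. g ` e) ` edges G \<inter> S = (\<lambda>e. g ` e) ` {e \<in> edges G. g ` e \<in> S}" by auto
  ultimately show ?thesis by (simp add: card_image)
qed

lemma ex_balanced_copy_iff:
  fixes G :: "'a ugraph"
  assumes G: "simple_graph G"
  shows "(\<exists>C. balanced_copy n c G C) \<longleftrightarrow> half_copy {..<n} (color_class n c Red) G"
proof
  assume "\<exists>C. balanced_copy n c G C"
  then obtain C where C: "balanced_copy n c G C" by blast
  obtain f where f: "bij_betw f (verts G) (verts C)" and E: "edges C = (\<lambda>e. f ` e) ` edges G"
    using C unfolding balanced_copy_def graph_iso_def by blast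
  obtain x y where xy: "x \<noteq> y"
      "card (edges C \<inter> color_class n c x) = card (edges G) div 2"
      "card (edges C \<inter> color_class n c y) = (card (edges G) + 1) div 2"
    using C unfolding balanced_copy_def by blast
  have CV: "verts C \<subseteq> {..<n}"
    using C by (simp add: balanced_copy_def subgraph_def complete_graph_def)
  have inj: "inj_on f (verts G)" using f by (rule bij_betw_imp_inj_on)
  have "x = Red \<or> y = Red" using xy(1) by (cases x; cases y) auto
  then have "half G (card {e \<in> edges G. f ` e \<in> color_class n c Red})"
    using xy(2,3) unfolding E card_image_edges[OF G inj] half_def by auto
  moreover have "f ` verts G \<subseteq> {..<n}" using f CV by (simp add: bij_betw_imp_surj_on)
  ultimately show "half_copy {..<n} (color_class n c Red) G"
    using inj unfolding half_copy_def by blast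
next
  assume "half_copy {..<n} (color_class n c Red) G"
  then obtain g where g: "inj_on g (verts G)" "g ` verts G \<subseteq> {..<n}"
      "half G (card {e \<in> edges G. g ` e \<in> color_class n c Red})"
    unfolding half_copy_def by blast
  define C where "C = \<lparr>verts = g ` verts G, edges = (\<lambda>e. g ` e) ` edges G\<rparr>"
  have pair: "g ` e \<in> all_pairs {..<n}" if "e \<in> edges G" for e
    by (rule image_edge_pair[OF G g(1,2) that])
  have count: "card (edges C \<inter> color_class n c x) = card {e \<in> edges G. g ` e \<in> color_class n c x}" for x
    unfolding C_def by (simp add: card_image_edges[OF G g(1)])
  have "{e \<in> edges G. g ` e \<in> color_class n c Blue} = {e \<in> edges G. g ` e \<notin> color_class n c Red}"
    using color_class_Blue[OF pair] by blast
  then have sum: "card (edges C \<inter> color_class n c Red) + card (edges C \<inter> color_class n c Blue) = card (edges G)"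
    using card_filter_compl[OF simple_graphD(2)[OF G], of "\<lambda>e. g ` e \<in> color_class n c Red"]
    by (simp add: count)
  have "\<exists>x y. x \<noteq> y \<and> card (edges C \<inter> color_class n c x) = card (edges G) div 2 \<and>
      card (edges C \<inter> color_class n c y) = (card (edges G) + 1) div 2"
  proof (cases "card (edges C \<inter> color_class n c Red) = card (edges G) div 2")
    case True
    then show ?thesis using sum by (intro exI[of _ Red] exI[of _ Blue]) auto
  next
    case False
    then show ?thesis using sum g(3) unfolding half_def count[symmetric]
      by (intro exI[of _ Blue] exI[of _ Red]) auto
  qed
  moreover have "subgraph C (complete_graph {..<n})"
    unfolding subgraph_def
  proof (intro conjI ballI)
    show "verts C \<subseteq> verts (complete_graph {..<n})"
      using g(2) by (simp add: C_def complete_graph_def)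
    show "edges C \<subseteq> edges (complete_graph {..<n})"
      using pair by (auto simp only: C_def complete_graph_def all_pairs_def ugraph.simps)
    show "e \<subseteq> verts C" if "e \<in> edges C" for e
      using that simple_graphD(3)[OF G] by (auto simp: C_def image_mono)
  qed
  moreover have "graph_iso G C"
    unfolding graph_iso_def by (intro exI[of _ g]) (simp add: C_def inj_on_imp_bij_betw g(1))
  ultimately show "\<exists>C. balanced_copy n c G C" unfolding balanced_copy_def by blast
qed

text \<open>
  The least element exists because the condition is void for \<open>n choose 2\<close>.
\<close>

lemma bal_property:
  assumes "\<And>x. card (color_class n c x) > bal n G"
  shows "\<exists>C. balanced_copy n c G C"
proof -
  let ?P = "\<lambda>t. \<forall>c. (\<forall>x. card (color_class n c x) > t) \<longrightarrow> (\<exists>C. balanced_copy n c G C)"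
  have "\<not> card (color_class n c x) > n choose 2" for c x
    using card_mono[OF finite_all_pairs color_class_pairs[of n c x]] card_all_pairs[of "{..<n}"] by simp
  then have "?P (n choose 2)" by blast
  then have "?P (bal n G)" unfolding bal_def by (rule LeastI)
  then show ?thesis using assms by blast
qed

lemma bal_le:
  assumes "\<And>c. (\<And>x. card (color_class n c x) > m) \<Longrightarrow> \<exists>C. balanced_copy n c G C"
  shows "bal n G \<le> m"
  unfolding bal_def by (rule Least_le) (use assms in blast)

lemma bal_mono:
  assumes "\<And>c. \<exists>C. balanced_copy n c H C \<Longrightarrow> \<exists>C. balanced_copy n c G C"
  shows "bal n G \<le> bal n H"
  by (rule bal_le) (use assms bal_property in blast)

text \<open>
  The tree enters into \<open>n0\<close> only through its number of vertices and \<open>t\<close>. If both color classes have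
  a large clique, then \<open>half_copy_clique_indep\<close> applies. Otherwise a color class without a large clique
  is dense enough for \<open>dense_half_copy\<close>.
\<close>

lemma bal_upper_bound:
  fixes c t :: nat
  assumes t: "t > 0"
  shows "\<exists>n0. \<forall>n\<ge>n0. \<forall>(G :: 'a ugraph) M P l. join_tree G \<longrightarrow> card (verts G) = c \<longrightarrow>
     matching G M \<longrightarrow> half G (card M) \<longrightarrow> hub_placement G t P l \<longrightarrow>
     int (bal n G) \<le> (int t - 1) * int n - int (t choose 2)"
proof -
  define N where "N = c * 2 ^ (2 * c) + 2 * c + 1"
  obtain n1 where n1: "\<forall>n\<ge>n1. \<forall>(G :: 'a ugraph) M P l R. join_tree G \<longrightarrow> card (verts G) = c \<longrightarrow>
     matching G M \<longrightarrow> half G (card M) \<longrightarrow> hub_placement G t P l \<longrightarrow>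
     R \<subseteq> all_pairs {..<n} \<longrightarrow> card R + (t choose 2) > (t - 1) * n \<longrightarrow>
     \<not> (\<exists>K\<subseteq>{..<n}. card K = N \<and> clique K R) \<longrightarrow> half_copy {..<n} R G"
    by (rule exE[OF dense_half_copy[OF t, of c N]])
  show ?thesis
  proof (intro exI[of _ "n1 + t"] allI impI)
    fix n and G :: "'a ugraph" and M P l
    assume n: "n1 + t \<le> n" and jt: "join_tree G" and c: "card (verts G) = c" and M: "matching G M"
      and hM: "half G (card M)" and hp: "hub_placement G t P l"
    note G = join_tree_simple[OF jt]
    have dense: "half_copy {..<n} R G"
      if "R \<subseteq> all_pairs {..<n}" "card R + (t choose 2) > (t - 1) * n"
        "\<not> (\<exists>K\<subseteq>{..<n}. card K = N \<and> clique K R)" for R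
      by (rule n1[THEN spec, THEN mp, THEN spec, THEN spec, THEN spec, THEN spec, THEN spec, THEN mp,
            THEN mp, THEN mp, THEN mp, THEN mp, THEN mp, THEN mp, THEN mp, OF _ jt c M hM hp that])
        (use n in simp)
    define m where "m = (t - 1) * n - (t choose 2)"
    have tn: "t choose 2 \<le> (t - 1) * n"
    proof -
      have "t choose 2 \<le> t * (t - 1)" by (simp add: choose_two)
      also have "\<dots> \<le> n * (t - 1)" using n by (intro mult_le_mono1) simp
      finally show ?thesis by (simp add: mult.commute)
    qed
    have "bal n G \<le> m"
    proof (rule bal_le)
      fix col assume big: "\<And>x. card (color_class n col x) > m"
      define R where "R = color_class n col Red"
      define S where "S = color_class n col Blue"
      have RS: "R \<subseteq> all_pairs {..<n}" "S \<subseteq> all_pairs {..<n}" "card R + (t choose 2) > (t - 1) * n"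
          "card S + (t choose 2) > (t - 1) * n"
        using big[of Red] big[of Blue] tn color_class_pairs by (auto simp: R_def S_def m_def)
      have swap: "{a, b} \<notin> R" if "a \<noteq> b" "{a, b} \<in> S" for a b
        using that color_class_Blue[of "{a, b}" n col] RS(2) by (auto simp: R_def S_def)
      have "half_copy {..<n} R G"
      proof (cases "\<exists>K\<subseteq>{..<n}. card K = N \<and> clique K R")
        case False
        then show ?thesis by (rule dense[OF RS(1,3)])
      next
        case noR: True
        show ?thesis
        proof (cases "\<exists>L\<subseteq>{..<n}. card L = N \<and> clique L S")
          case True
          then obtain L where L: "L \<subseteq> {..<n}" "card L = N" "clique L S" by blast
          then have "indep L R" using swap by (auto simp: clique_def indep_def)
          moreover obtain K where "K \<subseteq> {..<n}" "card K = N" "clique K R" using noR by blast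
          ultimately show ?thesis
            using L c half_copy_clique_indep[OF jt, of c K "{..<n}" R L] by (simp add: N_def)
        next
          case False
          then have "half_copy {..<n} S G" by (rule dense[OF RS(2,4)])
          then obtain g where g: "inj_on g (verts G)" "g ` verts G \<subseteq> {..<n}"
              "half G (card {e \<in> edges G. g ` e \<in> S})" unfolding half_copy_def by blast
          have "{e \<in> edges G. g ` e \<in> S} = {e \<in> edges G. g ` e \<in> - R}"
            using color_class_Blue[OF image_edge_pair[OF G g(1,2)]] by (auto simp: R_def S_def)
          then have "half_copy {..<n} (- R) G"
            unfolding half_copy_def using g by (intro exI[of _ g]) simp
          then show ?thesis using half_copy_compl[OF G] by blast
        qed
      qed
      then show "\<exists>C. balanced_copy n col G C"
        using ex_balanced_copy_iff[OF G] by (simp add: R_def)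
    qed
    then have "int (bal n G) \<le> int m" by simp
    also have "\<dots> = (int t - 1) * int n - int (t choose 2)"
      using tn t by (simp add: m_def of_nat_diff)
    finally show "int (bal n G) \<le> (int t - 1) * int n - int (t choose 2)" .
  qed
qed

text \<open>
  The coloring in which the red edges form the complete bipartite graph between \<open>s\<close> vertices and the
  rest. The red edges of a copy are the edges leaving a set of at most \<open>s\<close> vertices.
\<close>

lemma bal_lower_bound:
  assumes G: "simple_graph G" and n: "n \<ge> 3 * s + 1"
    and few: "\<And>S. S \<subseteq> verts G \<Longrightarrow> card S \<le> s \<Longrightarrow> card (boundary G S) < card (edges G) div 2"
  shows "s * (n - s) \<le> bal n G"
proof (rule ccontr)
  assume "\<not> s * (n - s) \<le> bal n G"
  then have lt: "bal n G < s * (n - s)" by simp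
  define col where "col e = (if \<exists>a\<in>e. \<exists>b\<in>e. a < s \<and> s \<le> b then Red else Blue)" for e :: "nat set"
  have fin: "finite (color_class n col x)" for x
    using finite_subset[OF color_class_pairs] finite_all_pairs by blast
  have "s * (n - s) \<le> card (color_class n col Red)"
  proof -
    have "inj_on (\<lambda>(a, b). {a, b}) ({..<s} \<times> {s..<n})"
      by (auto simp: inj_on_def doubleton_eq_iff)
    then have "card ((\<lambda>(a, b). {a, b}) ` ({..<s} \<times> {s..<n})) = s * (n - s)"
      by (simp add: card_image)
    moreover have "(\<lambda>(a, b). {a, b}) ` ({..<s} \<times> {s..<n}) \<subseteq> color_class n col Red"
      using n by (force simp: color_class_def complete_graph_def col_def card_2_iff)
    ultimately show ?thesis using card_mono[OF fin] by metis
  qed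
  moreover have "s * (n - s) \<le> card (color_class n col Blue)"
  proof -
    have "2 * s \<le> n - s - 1" using n by linarith
    then have "(n - s) * (2 * s) \<le> (n - s) * (n - s - 1)" by (rule mult_le_mono2)
    from div_le_mono[OF this, of 2] have "s * (n - s) \<le> (n - s) choose 2"
      by (simp add: choose_two mult.commute)
    also have "\<dots> = card (all_pairs {s..<n})" by (simp add: card_all_pairs)
    also have "\<dots> \<le> card (color_class n col Blue)"
      by (intro card_mono fin)
        (auto simp: all_pairs_def color_class_def complete_graph_def col_def subset_iff)
    finally show ?thesis .
  qed
  ultimately have "card (color_class n col x) > bal n G" for x
    using lt by (cases x) auto
  then have "half_copy {..<n} (color_class n col Red) G"
    using bal_property ex_balanced_copy_iff[OF G] by blast
  then obtain g where g: "inj_on g (verts G)" "g ` verts G \<subseteq> {..<n}"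
      "half G (card {e \<in> edges G. g ` e \<in> color_class n col Red})" unfolding half_copy_def by blast
  define S where "S = {w \<in> verts G. g w < s}"
  have "card S = card (g ` S)"
    using g(1) by (intro card_image[symmetric]) (auto simp: S_def intro: inj_on_subset)
  also have "\<dots> \<le> card {..<s}" by (intro card_mono) (auto simp: S_def)
  finally have "card (boundary G S) < card (edges G) div 2"
    by (intro few) (auto simp: S_def)
  moreover have "g ` e \<in> color_class n col Red \<longleftrightarrow> e \<in> boundary G S" if e: "e \<in> edges G" for e
  proof -
    obtain x y where xy: "e = {x, y}" "x \<noteq> y" "x \<in> verts G" "y \<in> verts G"
      using simple_graph_edgeE[OF G e] .
    have "g ` e \<in> all_pairs {..<n}" by (rule image_edge_pair[OF G g(1,2) e])
    then have "g ` e \<in> color_class n col Red \<longleftrightarrow> col (g ` e) = Red"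
      by (auto simp: color_class_def complete_graph_def all_pairs_def)
    also have "\<dots> \<longleftrightarrow> e \<in> boundary G S"
      using e xy by (auto simp: col_def boundary_def S_def)
    finally show ?thesis .
  qed
  then have "{e \<in> edges G. g ` e \<in> color_class n col Red} = boundary G S"
    by (auto simp: boundary_def)
  ultimately show False using g(3) by (auto simp: half_def)
qed

lemma half_copy_iso:
  assumes H: "half_copy V R H" and \<phi>: "bij_betw \<phi> (verts G) (verts H)"
    and E: "edges H = (\<lambda>e. \<phi> ` e) ` edges G" and G: "simple_graph G"
  shows "half_copy V R G"
proof -
  obtain g where g: "inj_on g (verts H)" "g ` verts H \<subseteq> V" "half H (card {e \<in> edges H. g ` e \<in> R})"
    using H unfolding half_copy_def by blast
  have inj: "inj_on \<phi> (verts G)" using \<phi> by (rule bij_betw_imp_inj_on)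
  have im: "\<phi> ` verts G = verts H" using \<phi> by (rule bij_betw_imp_surj_on)
  have "{e \<in> edges H. g ` e \<in> R} = (\<lambda>e. \<phi> ` e) ` edges G \<inter> {e. g ` e \<in> R}" by (auto simp: E)
  then have "card {e \<in> edges H. g ` e \<in> R} = card {e \<in> edges G. (g \<circ> \<phi>) ` e \<in> R}"
    using card_image_edges[OF G inj, of "{e. g ` e \<in> R}"] by (simp add: image_comp)
  moreover have "card (edges H) = card (edges G)"
    using card_image_edges[OF G inj, of UNIV] by (simp add: E)
  ultimately have "half G (card {e \<in> edges G. (g \<circ> \<phi>) ` e \<in> R})" using g(3) by (simp add: half_def)
  moreover have "inj_on (g \<circ> \<phi>) (verts G)" using inj g(1) im by (intro comp_inj_on) auto
  moreover have "(g \<circ> \<phi>) ` verts G \<subseteq> V" using g(2) im by (auto simp: image_comp[symmetric])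
  ultimately show ?thesis unfolding half_copy_def by blast
qed

section \<open>Joining trees at vertices of maximum degree\<close>

lemma ex_max_degree_vertex_tree: "join_tree G \<Longrightarrow> \<exists>x. max_degree_vertex G x"
  using ex_max_degree_vertex simple_graphD(1)[OF join_tree_simple] join_tree_nonempty by blast

lemma (in edge_join) max_degree_vertex_G:
  assumes mu: "max_degree_vertex H u" and mv: "max_degree_vertex J v"
    and le: "degree J v \<le> degree H u" and x: "max_degree_vertex G x"
  shows "degree G x = degree H u + 1" "x = u \<or> x = v \<and> degree J v = degree H u"
proof -
  have "degree G u \<le> degree G x" "x \<in> verts H \<union> verts J"
    using x u by (auto simp: max_degree_vertex_def verts_G)
  then have ge: "degree H u + 1 \<le> degree G x" using degree_G(1)[OF u] by simp
  have "degree H y \<le> degree H u" if "y \<in> verts H" for y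
    using mu that by (simp add: max_degree_vertex_def)
  moreover have "degree J y \<le> degree J v" if "y \<in> verts J" for y
    using mv that by (simp add: max_degree_vertex_def)
  ultimately show "x = u \<or> x = v \<and> degree J v = degree H u" "degree G x = degree H u + 1"
    using ge degree_G[of x] le \<open>x \<in> verts H \<union> verts J\<close> by (fastforce split: if_splits)+
qed

lemma join_by_edge_commute: "join_by_edge H u J v = join_by_edge J v H u"
  by (simp add: join_by_edge_def Un_commute insert_commute)

lemma edge_join_commute: "edge_join H u J v \<Longrightarrow> edge_join J v H u"
  by (auto simp: edge_join_def)

lemma (in edge_join) neighbours_G:
  assumes "l \<in> verts H" "l \<noteq> u"
  shows "{w. {l, w} \<in> edges G} = {w. {l, w} \<in> edges H}"
  using assms u_neq_v disjoint v simple_graphD(3)[OF simple_J]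
  by (auto simp: edges_G doubleton_eq_iff)

lemma (in edge_join) no_shared_neighbour_G:
  assumes H: "no_shared_neighbour H X" "X \<subseteq> verts H" and J: "no_shared_neighbour J Y" "Y \<subseteq> verts J"
    and u_nb: "u \<notin> X \<Longrightarrow> v \<in> Y \<Longrightarrow> \<forall>p\<in>X. {u, p} \<notin> edges H"
    and v_nb: "v \<notin> Y \<Longrightarrow> u \<in> X \<Longrightarrow> \<forall>p\<in>Y. {v, p} \<notin> edges J"
  shows "no_shared_neighbour G (X \<union> Y)"
  unfolding no_shared_neighbour_def
proof (intro ballI impI)
  fix w p q assume w: "w \<in> verts G - (X \<union> Y)" and p: "p \<in> X \<union> Y" and q: "q \<in> X \<union> Y"
    and wp: "{w, p} \<in> edges G" and wq: "{w, q} \<in> edges G"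
  have inH: "a \<in> verts H \<and> b \<in> verts H" if "{a, b} \<in> edges H" for a b
    using simple_graphD(3)[OF simple_H that] by simp
  have inJ: "a \<in> verts J \<and> b \<in> verts J" if "{a, b} \<in> edges J" for a b
    using simple_graphD(3)[OF simple_J that] by simp
  have edge_cases: "{a, b} \<in> edges H \<or> {a, b} \<in> edges J \<or> a = u \<and> b = v \<or> a = v \<and> b = u"
    if "{a, b} \<in> edges G" for a b
    using that by (auto simp: edges_G doubleton_eq_iff)
  have cases: "r \<in> X \<and> {w, r} \<in> edges H \<or> r = v \<and> w = u \<and> v \<in> Y"
    if "w \<in> verts H" "r \<in> X \<union> Y" "{w, r} \<in> edges G" for r
    using edge_cases[OF that(3)] inH[of w r] inJ[of w r] that(1,2) H(2) J(2) disjoint u v by blast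
  have cases': "r \<in> Y \<and> {w, r} \<in> edges J \<or> r = u \<and> w = v \<and> u \<in> X"
    if "w \<in> verts J" "r \<in> X \<union> Y" "{w, r} \<in> edges G" for r
    using edge_cases[OF that(3)] inH[of w r] inJ[of w r] that(1,2) H(2) J(2) disjoint u v by blast
  show "p = q"
  proof (cases "w \<in> verts H")
    case True
    then show ?thesis
      using cases[OF True p wp] cases[OF True q wq] H(1) u_nb w
      unfolding no_shared_neighbour_def by blast
  next
    case False
    then have wJ: "w \<in> verts J" using w by (simp add: verts_G)
    then show ?thesis
      using cases'[OF wJ p wp] cases'[OF wJ q wq] J(1) v_nb w
      unfolding no_shared_neighbour_def by blast
  qed
qed

lemma (in edge_join) card_boundary_Un:
  assumes "X \<subseteq> verts H" "Y \<subseteq> verts J"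
  shows "card (boundary G (X \<union> Y)) = card (boundary H X) + card (boundary J Y) +
     (if (u \<in> X) \<noteq> (v \<in> Y) then 1 else 0)"
proof -
  have "boundary H (X \<union> Y) = boundary H X" "boundary J (X \<union> Y) = boundary J Y"
    using assms disjoint by (auto intro!: boundary_cong simple_H simple_J)
  moreover have "u \<in> X \<union> Y \<longleftrightarrow> u \<in> X" "v \<in> X \<union> Y \<longleftrightarrow> v \<in> Y" using assms u_neq_v by auto
  ultimately show ?thesis by (simp add: card_boundary_G)
qed

lemma (in edge_join) card_inner_Un:
  assumes "X \<subseteq> verts H" "Y \<subseteq> verts J"
  shows "card (inner G (X \<union> Y)) = card (inner H X) + card (inner J Y) +
     (if u \<in> X \<and> v \<in> Y then 1 else 0)"
proof -
  have "inner H (X \<union> Y) = inner H X" "inner J (X \<union> Y) = inner J Y"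
    using assms disjoint by (auto intro!: inner_cong simple_H simple_J)
  moreover have "u \<in> X \<union> Y \<longleftrightarrow> u \<in> X" "v \<in> X \<union> Y \<longleftrightarrow> v \<in> Y" using assms u_neq_v by auto
  ultimately show ?thesis by (simp add: card_inner_G)
qed

lemma inner_single:
  assumes "simple_graph G"
  shows "inner G {x} = {}"
proof -
  have "\<not> e \<subseteq> {x}" if "e \<in> edges G" for e
    using simple_graphD(4)[OF assms that] card_mono[of "{x}" e] by auto
  then show ?thesis by (auto simp: inner_def)
qed

lemma card_boundary_single:
  assumes "simple_graph G"
  shows "card (boundary G {x}) = degree G x"
proof -
  have "\<not> e \<subseteq> {x}" if "e \<in> edges G" for e
    using simple_graphD(4)[OF assms that] card_mono[of "{x}" e] by auto
  then have "boundary G {x} = {e \<in> edges G. x \<in> e}" by (auto simp: boundary_def)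
  then show ?thesis by (simp add: degree_def)
qed

lemma no_shared_neighbour_single: "no_shared_neighbour G {x}"
  by (simp add: no_shared_neighbour_def)

lemma no_shared_neighbour_empty: "no_shared_neighbour G {}"
  by (simp add: no_shared_neighbour_def)

lemma (in edge_join) matching_G:
  assumes "matching H M" "matching J N"
  shows "matching G (M \<union> N)" "card (M \<union> N) = card M + card N"
proof -
  have M: "M \<subseteq> edges H" "pairwise disjnt M" and N: "N \<subseteq> edges J" "pairwise disjnt N"
    using assms by (auto simp: matching_def)
  have "disjnt e f" if "e \<in> M" "f \<in> N" for e f
    using simple_graphD(3)[OF simple_H] simple_graphD(3)[OF simple_J] M(1) N(1) that disjoint
    unfolding disjnt_def by blast
  then have "pairwise disjnt (M \<union> N)"
    using M(2) N(2) by (auto simp: pairwise_def disjnt_sym)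
  then show "matching G (M \<union> N)" using M N by (auto simp: matching_def edges_G)
  show "card (M \<union> N) = card M + card N"
    using M(1) N(1) edges_disjoint(1) simple_graphD(2)[OF simple_H] simple_graphD(2)[OF simple_J]
    by (intro card_Un_disjoint) (auto intro: finite_subset)
qed

lemma matching_single_edge: "e \<in> edges G \<Longrightarrow> matching G {e}"
  by (simp add: matching_def pairwise_def)

section \<open>The structure of \<open>T_k\<close>\<close>

lemma T_tree_small:
  assumes "T_tree k G" "k < 3"
  shows "\<exists>S. card S = 2 \<and> G = complete_graph S"
  using assms by (cases rule: T_tree.cases) auto

lemma T_tree_joinE:
  assumes "T_tree k G" "k \<ge> 3"
  obtains H u J v where "G = join_by_edge H u J v" "T_tree (k - 1) H" "T_tree (k - 2) J"
    "max_degree_vertex H u" "max_degree_vertex J v" "edge_join H u J v"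
  using assms
proof (cases rule: T_tree.cases)
  case (T_step H J u v)
  then have "edge_join H u J v"
    by (intro edge_joinI T_tree_join_tree max_degree_vertex_in)
  then show ?thesis using T_step by (intro that)
qed auto

lemma complete_graph_2:
  assumes "card S = 2"
  shows "verts (complete_graph S) = S" "edges (complete_graph S) = {S}"
proof -
  obtain a b where "a \<noteq> b" "S = {a, b}"
    "complete_graph S = join_by_edge \<lparr>verts = {a}, edges = {}\<rparr> a \<lparr>verts = {b}, edges = {}\<rparr> b"
    using complete_graph_pair[OF assms] .
  then show "verts (complete_graph S) = S" "edges (complete_graph S) = {S}"
    by (simp_all add: join_by_edge_def insert_commute)
qed

lemma degree_complete_graph_2:
  assumes "card S = 2" "x \<in> S"
  shows "degree (complete_graph S) x = 1"
proof -
  have "{e \<in> {S}. x \<in> e} = {S}" using assms(2) by auto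
  then show ?thesis by (simp add: degree_def complete_graph_2[OF assms(1)])
qed

lemma T_tree_max_degree:
  "T_tree k G \<Longrightarrow> max_degree_vertex G x \<Longrightarrow> degree G x = max (k - 1) 1"
proof (induction k arbitrary: G x rule: less_induct)
  case (less k)
  show ?case
  proof (cases "k \<ge> 3")
    case False
    then obtain S where S: "card S = 2" "G = complete_graph S"
      using T_tree_small[OF less.prems(1)] by auto
    have "x \<in> S" using max_degree_vertex_in[OF less.prems(2)] S complete_graph_2(1) by auto
    then have "degree G x = 1" using degree_complete_graph_2[OF S(1)] S(2) by simp
    then show ?thesis using False by simp
  next
    case True
    obtain H u J v where J: "G = join_by_edge H u J v" "T_tree (k - 1) H" "T_tree (k - 2) J"
      "max_degree_vertex H u" "max_degree_vertex J v" "edge_join H u J v"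
      using T_tree_joinE[OF less.prems(1) True] .
    have dH: "degree H u = max (k - 2) 1" using less.IH[OF _ J(2,4)] True by simp
    have dJ: "degree J v = max (k - 3) 1" using less.IH[OF _ J(3,5)] True by simp
    have "degree G x = degree H u + 1"
      using edge_join.max_degree_vertex_G(1)[OF J(6,4,5)] less.prems(2) J(1) dH dJ by simp
    then show ?thesis using dH True by simp
  qed
qed

text \<open>
  From \<open>k = 4\<close> on the vertex of maximum degree is unique, so every such vertex is an end of the edge by
  which \<open>T_k\<close> was built.
\<close>

lemma T_tree_rootE:
  assumes "T_tree k G" "max_degree_vertex G x" "k \<ge> 4"
  obtains H J v where "G = join_by_edge H x J v" "T_tree (k - 1) H" "T_tree (k - 2) J"
    "max_degree_vertex H x" "max_degree_vertex J v" "edge_join H x J v"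
proof -
  obtain H u J v where J: "G = join_by_edge H u J v" "T_tree (k - 1) H" "T_tree (k - 2) J"
    "max_degree_vertex H u" "max_degree_vertex J v" "edge_join H u J v"
  proof -
    have "k \<ge> 3" using assms(3) by simp
    from T_tree_joinE[OF assms(1) this] show thesis using that .
  qed
  have "degree H u = max (k - 2) 1" "degree J v = max (k - 3) 1"
    using T_tree_max_degree[OF J(2,4)] T_tree_max_degree[OF J(3,5)] by simp_all
  then have lt: "degree J v < degree H u" using assms(3) by linarith
  have "x = u"
    using edge_join.max_degree_vertex_G(2)[OF J(6,4,5), of x] assms(2) J(1) lt by auto
  then show ?thesis using that J by blast
qed

text \<open>
  \<open>T_3\<close> and \<open>A_3\<close> are paths on four vertices, here with the vertex of maximum degree \<open>x\<close> in second
  position.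
\<close>

definition path4 :: "'a ugraph \<Rightarrow> 'a \<Rightarrow> 'a \<Rightarrow> 'a \<Rightarrow> 'a \<Rightarrow> bool" where
  "path4 G a x w l \<longleftrightarrow> distinct [a, x, w, l] \<and> verts G = {a, x, w, l} \<and>
     edges G = {{a, x}, {x, w}, {w, l}}"

lemma path4_join:
  assumes j: "edge_join H u J v" and H: "verts H = S" "edges H = {S}" "card S = 2"
    and J: "verts J = S'" "edges J = {S'}" "card S' = 2" and x: "x \<in> {u, v}"
  shows "\<exists>a w l. path4 (join_by_edge H u J v) a x w l"
proof -
  interpret edge_join H u J v by (rule j)
  have other: "\<exists>b. A = {z, b} \<and> b \<noteq> z" if "card A = 2" "z \<in> A" for A :: "'a set" and z
    using that by (auto simp: card_2_iff)
  obtain a where a: "S = {u, a}" "a \<noteq> u" using other[of S u] u H by auto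
  obtain b where b: "S' = {v, b}" "b \<noteq> v" using other[of S' v] v J by auto
  show ?thesis
  proof (cases "x = u")
    case True
    then have "path4 (join_by_edge H u J v) a x v b"
      using a b H J disjoint by (auto simp: path4_def verts_G edges_G insert_commute)
    then show ?thesis by blast
  next
    case False
    then have "path4 (join_by_edge H u J v) b x u a"
      using a b H J disjoint x by (auto simp: path4_def verts_G edges_G insert_commute)
    then show ?thesis by blast
  qed
qed

lemma path4_end:
  assumes p: "path4 G a x w l" and G: "simple_graph G"
  shows "boundary G {l} = {{w, l}}" "{z. {l, z} \<in> edges G} = {w}"
    "degree G w = 2" "degree G x = 2"
    "no_shared_neighbour G {w}" "boundary G {w} = {{x, w}, {w, l}}"
proof -
  show "boundary G {l} = {{w, l}}"
    using p by (auto simp: path4_def boundary_def)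
  show "{z. {l, z} \<in> edges G} = {w}"
    using p by (auto simp: path4_def doubleton_eq_iff)
  show "boundary G {w} = {{x, w}, {w, l}}"
    using p by (auto simp: path4_def boundary_def)
  have "{e \<in> edges G. w \<in> e} = {{x, w}, {w, l}}" "{e \<in> edges G. x \<in> e} = {{a, x}, {x, w}}"
    using p by (auto simp: path4_def)
  then show "degree G w = 2" "degree G x = 2"
    using p by (auto simp: degree_def path4_def doubleton_eq_iff)
qed (rule no_shared_neighbour_single)

lemma T_tree_3_path4:
  assumes "T_tree 3 G" "max_degree_vertex G x"
  shows "\<exists>a w l. path4 G a x w l"
proof -
  obtain H u J v where J: "G = join_by_edge H u J v" "T_tree (3 - 1) H" "T_tree (3 - 2) J"
    "max_degree_vertex H u" "max_degree_vertex J v" "edge_join H u J v"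
    using T_tree_joinE[OF assms(1)] by blast
  obtain S where S: "card S = 2" "H = complete_graph S" using T_tree_small[OF J(2)] by auto
  obtain S' where S': "card S' = 2" "J = complete_graph S'" using T_tree_small[OF J(3)] by auto
  have "degree H u = 1" "degree J v = 1"
    using T_tree_max_degree[OF J(2,4)] T_tree_max_degree[OF J(3,5)] by simp_all
  then have x: "x \<in> {u, v}"
    using edge_join.max_degree_vertex_G(2)[OF J(6,4,5)] assms(2) J(1) by auto
  show ?thesis
    unfolding J(1)
    by (rule path4_join[where S = S and S' = S', OF J(6) _ _ _ _ _ _ x])
      (simp_all add: S S' complete_graph_2)
qed

lemma T_tree_card: "T_tree k G \<Longrightarrow> card (verts G) = 2 * fib k"
proof (induction rule: T_tree.induct)
  case (T_step k H J u v)
  have "edge_join H u J v"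
    using T_step by (intro edge_joinI T_tree_join_tree max_degree_vertex_in)
  moreover obtain m where "k = Suc (Suc m)" using T_step.hyps(1)
    by (metis add_2_eq_Suc le_Suc_ex numeral_3_eq_3 add_Suc_right add_Suc)
  ultimately show ?case
    using T_step.IH by (simp add: edge_join.card_verts_G)
qed (simp_all add: complete_graph_2)

text \<open>
  The matching is perfect: it is inherited from the two copies of \<open>K_2\<close> at which the recursion starts.
\<close>

lemma T_tree_matching: "T_tree k G \<Longrightarrow> \<exists>M. matching G M \<and> card M = fib k"
proof (induction rule: T_tree.induct)
  case (T_1 S)
  then show ?case
    by (intro exI[of _ "{S}"]) (simp add: complete_graph_2 matching_single_edge)
next
  case (T_2 S)
  then show ?case
    by (intro exI[of _ "{S}"]) (simp add: complete_graph_2 matching_single_edge)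
next
  case (T_step k H J u v)
  interpret edge_join H u J v
    using T_step by (intro edge_joinI T_tree_join_tree max_degree_vertex_in)
  obtain M N where M: "matching H M" "card M = fib (k - 1)" "matching J N" "card N = fib (k - 2)"
    using T_step.IH by blast
  obtain m where "k = Suc (Suc m)" using T_step.hyps(1)
    by (metis add_2_eq_Suc le_Suc_ex numeral_3_eq_3 add_Suc_right add_Suc)
  then show ?case
    using matching_G[OF M(1,3)] M(2,4) by (intro exI[of _ "M \<union> N"]) simp
qed

section \<open>Hub placements in \<open>T_k\<close>\<close>

text \<open>
  Unfolding the recursion, \<open>T_k\<close> consists of copies of \<open>T_5\<close> and \<open>T_4\<close>, joined at their vertices of
  maximum degree, the roots. The sets \<open>A\<close> and \<open>B\<close> contain the roots of the copies of \<open>T_5\<close> and \<open>T_4\<close>, and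
  \<open>L\<close> contains from each copy of \<open>T_5\<close> the leaf at distance three from the root. A root in \<open>B\<close> has three
  neighbours in its copy, and exactly one other neighbour, which is in \<open>A\<close>. If the root is left out of
  the set, the edge to this neighbour crosses from the set to the outside: leaving out a root in \<open>B\<close>
  loses three edges and gains one, hence the coefficients of \<open>card B\<close> and \<open>card B'\<close>.
\<close>

definition T_frame :: "'a ugraph \<Rightarrow> 'a \<Rightarrow> 'a set \<Rightarrow> 'a set \<Rightarrow> 'a set \<Rightarrow> bool" where
  "T_frame G u A B L \<longleftrightarrow> A \<union> B \<union> L \<subseteq> verts G \<and> A \<inter> B = {} \<and> A \<inter> L = {} \<and> B \<inter> L = {} \<and> u \<in> A \<and>
     (\<forall>l\<in>L. card {w. {l, w} \<in> edges G} \<le> 1) \<and>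
     (\<forall>B'\<subseteq>B. \<forall>L'\<subseteq>L. no_shared_neighbour G (A \<union> B' \<union> L') \<and>
        card (boundary G (A \<union> B' \<union> L')) = 4 * card A + card B + 2 * card B' + card L' \<and>
        card (inner G (A \<union> B' \<union> L')) + 1 = card A + card B')"

lemma T_frameD:
  assumes "T_frame G u A B L"
  shows "A \<subseteq> verts G" "B \<subseteq> verts G" "L \<subseteq> verts G" "A \<inter> B = {}" "A \<inter> L = {}" "B \<inter> L = {}" "u \<in> A"
    "l \<in> L \<Longrightarrow> card {w. {l, w} \<in> edges G} \<le> 1"
  using assms by (auto simp: T_frame_def)

lemma T_frame_count:
  assumes "T_frame G u A B L" "B' \<subseteq> B" "L' \<subseteq> L"
  shows "no_shared_neighbour G (A \<union> B' \<union> L')"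
    "card (boundary G (A \<union> B' \<union> L')) = 4 * card A + card B + 2 * card B' + card L'"
    "card (inner G (A \<union> B' \<union> L')) + 1 = card A + card B'"
  using assms by (simp_all add: T_frame_def)

text \<open>
  \<open>T_5\<close> is \<open>T_4\<close>, whose root has degree three, joined to an inner vertex of the path \<open>T_3\<close>. The leaf is
  the end of this path that is not adjacent to the joining edge.
\<close>

lemma T_frame_5:
  fixes G :: "'a ugraph"
  assumes "T_tree 5 G" "max_degree_vertex G u"
  shows "\<exists>l. T_frame G u {u} {} {l}"
proof -
  have "5 \<ge> (4::nat)" by simp
  from T_tree_rootE[OF assms this] obtain H J v where
    J: "G = join_by_edge H u J v" "T_tree (5 - 1) H" "T_tree (5 - 2) J"
    "max_degree_vertex H u" "max_degree_vertex J v" "edge_join H u J v" by blast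
  interpret edge_join H u J v by (rule J(6))
  have dH: "degree H u = 3" using T_tree_max_degree[OF J(2,4)] by simp
  obtain a w l where p: "path4 J a v w l" using T_tree_3_path4[OF _ J(5)] J(3) by auto
  note pe = path4_end[OF p simple_J]
  have lJ: "l \<in> verts J" "l \<noteq> v" "w \<noteq> v" "{v, l} \<notin> edges J" "u \<noteq> l"
    using p u_neq_v by (auto simp: path4_def doubleton_eq_iff)
  have "T_frame (join_by_edge H u J v) u {u} {} {l}"
    unfolding T_frame_def
  proof (intro conjI allI impI ballI)
    show "{u} \<union> {} \<union> {l} \<subseteq> verts (join_by_edge H u J v)" using u lJ by (simp add: verts_G)
    show "{u} \<inter> {l} = {}" using lJ by simp
    fix l' assume "l' \<in> {l}"
    then have "{w. {l', w} \<in> edges (join_by_edge H u J v)} = {z. {l, z} \<in> edges J}"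
      using edge_join.neighbours_G[OF edge_join_commute[OF J(6)] lJ(1,2)]
      by (simp add: join_by_edge_commute)
    then show "card {w. {l', w} \<in> edges (join_by_edge H u J v)} \<le> 1" using pe(2) by simp
  next
    fix B' L' :: "'a set" assume "B' \<subseteq> {}" "L' \<subseteq> {l}"
    then have X: "{u} \<union> B' \<union> L' = {u} \<union> L'" "B' = {}" and L': "L' = {} \<or> L' = {l}" by auto
    have sub: "{u} \<subseteq> verts H" "L' \<subseteq> verts J" using u L' lJ(1) by auto
    have vL: "v \<notin> L'" using L' lJ by auto
    show "no_shared_neighbour (join_by_edge H u J v) ({u} \<union> B' \<union> L')"
      unfolding X(1)
      by (rule no_shared_neighbour_G[OF no_shared_neighbour_single sub(1) _ sub(2)])
        (use L' lJ no_shared_neighbour_single no_shared_neighbour_empty in auto)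
    have "card (boundary J L') = card L'" "inner J L' = {}"
      using L' pe(1) inner_single[OF simple_J] inner_empty[OF simple_J] by auto
    then show "card (boundary (join_by_edge H u J v) ({u} \<union> B' \<union> L')) =
        4 * card {u} + card {} + 2 * card B' + card L'"
      "card (inner (join_by_edge H u J v) ({u} \<union> B' \<union> L')) + 1 = card {u} + card B'"
      unfolding X(1) card_boundary_Un[OF sub] card_inner_Un[OF sub]
      using vL dH X(2) by (simp_all add: card_boundary_single[OF simple_H] inner_single[OF simple_H])
  qed auto
  then show ?thesis using J(1) by auto
qed

lemma T_frame_6:
  fixes G :: "'a ugraph"
  assumes "T_tree 6 G" "max_degree_vertex G u"
  shows "\<exists>v l. T_frame G u {u} {v} {l}"
proof -
  have "6 \<ge> (4::nat)" by simp
  from T_tree_rootE[OF assms this] obtain H J v where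
    J: "G = join_by_edge H u J v" "T_tree (6 - 1) H" "T_tree (6 - 2) J"
    "max_degree_vertex H u" "max_degree_vertex J v" "edge_join H u J v" by blast
  interpret edge_join H u J v by (rule J(6))
  have dJ: "degree J v = 3" using T_tree_max_degree[OF J(3,5)] by simp
  obtain l where F: "T_frame H u {u} {} {l}" using T_frame_5[OF _ J(4)] J(2) by auto
  note FD = T_frameD[OF F]
  have "T_frame (join_by_edge H u J v) u {u} {v} {l}"
    unfolding T_frame_def
  proof (intro conjI allI impI ballI)
    show "{u} \<union> {v} \<union> {l} \<subseteq> verts (join_by_edge H u J v)" using u v FD(3) by (simp add: verts_G)
    show "{u} \<inter> {v} = {}" "{u} \<inter> {l} = {}" "{v} \<inter> {l} = {}" using u_neq_v FD(3,5) by auto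
    fix l' assume "l' \<in> {l}"
    then show "card {w. {l', w} \<in> edges (join_by_edge H u J v)} \<le> 1"
      using neighbours_G[of l'] FD(3,5,8) by auto
  next
    fix B' L' :: "'a set" assume B': "B' \<subseteq> {v}" and L': "L' \<subseteq> {l}"
    have X: "{u} \<union> B' \<union> L' = ({u} \<union> {} \<union> L') \<union> B'" by auto
    note H_count = T_frame_count[OF F empty_subsetI L']
    have sub: "{u} \<union> {} \<union> L' \<subseteq> verts H" "B' \<subseteq> verts J" using u v L' B' FD(3) by auto
    have B'_cases: "B' = {} \<or> B' = {v}" using B' by auto
    show "no_shared_neighbour (join_by_edge H u J v) ({u} \<union> B' \<union> L')"
      unfolding X
      by (rule no_shared_neighbour_G[OF H_count(1) sub(1) _ sub(2)])
        (use B'_cases no_shared_neighbour_single no_shared_neighbour_empty in auto)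
    show "card (boundary (join_by_edge H u J v) ({u} \<union> B' \<union> L')) =
        4 * card {u} + card {v} + 2 * card B' + card L'"
      "card (inner (join_by_edge H u J v) ({u} \<union> B' \<union> L')) + 1 = card {u} + card B'"
      unfolding X card_boundary_Un[OF sub] card_inner_Un[OF sub]
      using B'_cases H_count(2,3) dJ
      by (auto simp: card_boundary_single[OF simple_J] inner_single[OF simple_J] inner_empty[OF simple_J])
  qed auto
  then show ?thesis using J(1) by auto
qed

lemma T_frame_join:
  fixes H :: "'a ugraph"
  assumes j: "edge_join H u J v" and H: "T_frame H u A1 B1 L1" and J: "T_frame J v A2 B2 L2"
  shows "T_frame (join_by_edge H u J v) u (A1 \<union> A2) (B1 \<union> B2) (L1 \<union> L2)"
proof -
  interpret edge_join H u J v by (rule j)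
  note HD = T_frameD[OF H] and JD = T_frameD[OF J]
  have fin: "finite X" if "X \<subseteq> verts H \<or> X \<subseteq> verts J" for X
    using that simple_graphD(1)[OF simple_H] simple_graphD(1)[OF simple_J] finite_subset by blast
  have card_Un: "card (X \<union> Y) = card X + card Y" if "X \<subseteq> verts H" "Y \<subseteq> verts J" for X Y
    using that disjoint fin by (intro card_Un_disjoint) auto
  show ?thesis
    unfolding T_frame_def
  proof (intro conjI allI impI ballI)
    show "(A1 \<union> A2) \<union> (B1 \<union> B2) \<union> (L1 \<union> L2) \<subseteq> verts (join_by_edge H u J v)"
      using HD(1-3) JD(1-3) by (auto simp: verts_G)
    show "(A1 \<union> A2) \<inter> (B1 \<union> B2) = {}" "(A1 \<union> A2) \<inter> (L1 \<union> L2) = {}"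
      "(B1 \<union> B2) \<inter> (L1 \<union> L2) = {}"
    proof -
      have "(P1 \<union> P2) \<inter> (Q1 \<union> Q2) = {}"
        if "P1 \<subseteq> verts H" "Q1 \<subseteq> verts H" "P2 \<subseteq> verts J" "Q2 \<subseteq> verts J" "P1 \<inter> Q1 = {}" "P2 \<inter> Q2 = {}"
        for P1 P2 Q1 Q2
        using that disjoint by blast
      from this[OF HD(1,2) JD(1,2) HD(4) JD(4)] this[OF HD(1,3) JD(1,3) HD(5) JD(5)]
        this[OF HD(2,3) JD(2,3) HD(6) JD(6)]
      show "(A1 \<union> A2) \<inter> (B1 \<union> B2) = {}" "(A1 \<union> A2) \<inter> (L1 \<union> L2) = {}"
        "(B1 \<union> B2) \<inter> (L1 \<union> L2) = {}" .
    qed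
    show "u \<in> A1 \<union> A2" using HD(7) by simp
    fix l assume "l \<in> L1 \<union> L2"
    then show "card {w. {l, w} \<in> edges (join_by_edge H u J v)} \<le> 1"
    proof
      assume l: "l \<in> L1"
      then have "l \<in> verts H" "l \<noteq> u" using HD(3,5,7) by auto
      then show ?thesis using neighbours_G HD(8)[OF l] by simp
    next
      assume l: "l \<in> L2"
      then have "l \<in> verts J" "l \<noteq> v" using JD(3,5,7) by auto
      then show ?thesis
        using edge_join.neighbours_G[OF edge_join_commute[OF j]] JD(8)[OF l]
        by (simp add: join_by_edge_commute[of H])
    qed
  next
    fix B' L' :: "'a set" assume B': "B' \<subseteq> B1 \<union> B2" and L': "L' \<subseteq> L1 \<union> L2"
    define X where "X = A1 \<union> (B' \<inter> B1) \<union> (L' \<inter> L1)"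
    define Y where "Y = A2 \<union> (B' \<inter> B2) \<union> (L' \<inter> L2)"
    have XY: "(A1 \<union> A2) \<union> B' \<union> L' = X \<union> Y" using B' L' by (auto simp: X_def Y_def)
    have sub: "X \<subseteq> verts H" "Y \<subseteq> verts J" using HD(1-3) JD(1-3) by (auto simp: X_def Y_def)
    have uv: "u \<in> X" "v \<in> Y" using HD(7) JD(7) by (auto simp: X_def Y_def)
    note Hc = T_frame_count[OF H Int_lower2[of B'] Int_lower2[of L'], folded X_def]
    note Jc = T_frame_count[OF J Int_lower2[of B'] Int_lower2[of L'], folded Y_def]
    show "no_shared_neighbour (join_by_edge H u J v) (A1 \<union> A2 \<union> B' \<union> L')"
      unfolding XY by (rule no_shared_neighbour_G[OF Hc(1) sub(1) Jc(1) sub(2)]) (use uv in auto)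
    have "card ((B' \<inter> B1) \<union> (B' \<inter> B2)) = card (B' \<inter> B1) + card (B' \<inter> B2)"
      "card ((L' \<inter> L1) \<union> (L' \<inter> L2)) = card (L' \<inter> L1) + card (L' \<inter> L2)"
      using HD(2,3) JD(2,3) by (auto intro!: card_Un)
    moreover have "(B' \<inter> B1) \<union> (B' \<inter> B2) = B'" "(L' \<inter> L1) \<union> (L' \<inter> L2) = L'" using B' L' by auto
    ultimately have cards: "card B' = card (B' \<inter> B1) + card (B' \<inter> B2)"
      "card L' = card (L' \<inter> L1) + card (L' \<inter> L2)" by simp_all
    have cA: "card (A1 \<union> A2) = card A1 + card A2" "card (B1 \<union> B2) = card B1 + card B2"
      using HD(1,2) JD(1,2) by (auto intro!: card_Un)
    show "card (boundary (join_by_edge H u J v) (A1 \<union> A2 \<union> B' \<union> L')) =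
        4 * card (A1 \<union> A2) + card (B1 \<union> B2) + 2 * card B' + card L'"
      "card (inner (join_by_edge H u J v) (A1 \<union> A2 \<union> B' \<union> L')) + 1 = card (A1 \<union> A2) + card B'"
      unfolding XY card_boundary_Un[OF sub] card_inner_Un[OF sub] cA cards
      using Hc(2,3) Jc(2,3) uv by simp_all
  qed
qed

lemma fib_rec: "n \<ge> 2 \<Longrightarrow> fib n = fib (n - 1) + fib (n - 2)"
  by (metis add_2_eq_Suc diff_Suc_1 diff_add_inverse fib.simps(3) le_Suc_ex)

lemma T_frame_exists:
  "T_tree k G \<Longrightarrow> max_degree_vertex G u \<Longrightarrow> k \<ge> 5 \<Longrightarrow>
     \<exists>A B L. T_frame G u A B L \<and> card A = fib (k - 4) \<and> card B = fib (k - 5) \<and> card L = fib (k - 4)"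
proof (induction k arbitrary: G u rule: less_induct)
  case (less k)
  consider "k = 5" | "k = 6" | "k \<ge> 7" using less.prems(3) by linarith
  then show ?case
  proof cases
    case 1
    obtain l where "T_frame G u {u} {} {l}" using T_frame_5[of G u] less.prems(1,2) 1 by auto
    then show ?thesis using 1 by (intro exI[of _ "{u}"] exI[of _ "{}"] exI[of _ "{l}"]) simp
  next
    case 2
    obtain v l where "T_frame G u {u} {v} {l}" using T_frame_6[of G u] less.prems(1,2) 2 by auto
    then show ?thesis using 2
      by (intro exI[of _ "{u}"] exI[of _ "{v}"] exI[of _ "{l}"]) (simp add: numeral_2_eq_2)
  next
    case 3
    then have "k \<ge> 4" by simp
    from T_tree_rootE[OF less.prems(1,2) this] obtain H J v where
      J: "G = join_by_edge H u J v" "T_tree (k - 1) H" "T_tree (k - 2) J"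
      "max_degree_vertex H u" "max_degree_vertex J v" "edge_join H u J v" by blast
    have k: "k - 1 < k" "k - 2 < k" "k - 1 \<ge> 5" "k - 2 \<ge> 5" using 3 by simp_all
    obtain A1 B1 L1 where 1: "T_frame H u A1 B1 L1" "card A1 = fib (k - 1 - 4)"
      "card B1 = fib (k - 1 - 5)" "card L1 = fib (k - 1 - 4)"
      using less.IH[OF k(1) J(2,4) k(3)] by blast
    obtain A2 B2 L2 where 2: "T_frame J v A2 B2 L2" "card A2 = fib (k - 2 - 4)"
      "card B2 = fib (k - 2 - 5)" "card L2 = fib (k - 2 - 4)"
      using less.IH[OF k(2) J(3,5) k(4)] by blast
    interpret edge_join H u J v by (rule J(6))
    note HD = T_frameD[OF 1(1)] and JD = T_frameD[OF 2(1)]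
    have card_Un: "card (X \<union> Y) = card X + card Y" if "X \<subseteq> verts H" "Y \<subseteq> verts J" for X Y
      using that disjoint simple_graphD(1)[OF simple_H] simple_graphD(1)[OF simple_J]
      by (intro card_Un_disjoint) (auto intro: finite_subset)
    have f: "fib (k - 4) = fib (k - 1 - 4) + fib (k - 2 - 4)"
      "fib (k - 5) = fib (k - 1 - 5) + fib (k - 2 - 5)"
      using fib_rec[of "k - 4"] fib_rec[of "k - 5"] 3 by simp_all
    show ?thesis
    proof (intro exI conjI)
      show "T_frame G u (A1 \<union> A2) (B1 \<union> B2) (L1 \<union> L2)"
        unfolding J(1) by (rule T_frame_join[OF J(6) 1(1) 2(1)])
      show "card (A1 \<union> A2) = fib (k - 4)" using card_Un[OF HD(1) JD(1)] 1(2) 2(2) f(1) by simp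
      show "card (B1 \<union> B2) = fib (k - 5)" using card_Un[OF HD(2) JD(2)] 1(3) 2(3) f(2) by simp
      show "card (L1 \<union> L2) = fib (k - 4)" using card_Un[OF HD(3) JD(3)] 1(4) 2(4) f(1) by simp
    qed
  qed
qed

text \<open>
  Put hubs on all of \<open>A\<close> and \<open>B\<close> and on \<open>q\<close> leaves of \<open>L\<close>. The edges leaving this set are at least
  \<open>fib k - 1\<close>, half of all edges, and the edges inside the set add an unknown number. To correct a
  surplus, remove elements of \<open>B\<close> one at a time. Each removal decreases the number of edges obtained by
  at most three: two edges leaving the set, and at most one inside. When all of \<open>B\<close> is removed, at most
  \<open>fib k + 1\<close> are left. So at some point the number is \<open>fib k - 1\<close>, \<open>fib k\<close> or \<open>fib k + 1\<close>. In the last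
  case removing the leaf \<open>l\<close> decreases it by exactly one.
\<close>

lemma T_tree_hub_placement:
  assumes T: "T_tree k G" and k: "k \<ge> 6"
    and q: "1 \<le> q" "q \<le> fib (k - 4)" "fib (k - 4) \<le> q + 1"
  shows "\<exists>P l. hub_placement G (fib (k - 3) + q) P l"
proof -
  note jt = T_tree_join_tree[OF T]
  note G = join_tree_simple[OF jt]
  obtain u where "max_degree_vertex G u" using ex_max_degree_vertex_tree[OF jt] by blast
  then obtain A B L where F: "T_frame G u A B L" and
    cA: "card A = fib (k - 4)" and cB: "card B = fib (k - 5)" and cL: "card L = fib (k - 4)"
    using T_frame_exists[OF T] k by force
  note FD = T_frameD[OF F]
  have fin: "finite A" "finite B" "finite L"
    using FD(1-3) simple_graphD(1)[OF G] finite_subset by blast+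
  obtain L1 where L1: "L1 \<subseteq> L" "card L1 = q" "finite L1"
    using obtain_subset_with_card_n[of q L] q(2) cL by metis
  then obtain l where l: "l \<in> L1" using q(1) by fastforce
  have fib1: "fib (k - 3) = fib (k - 4) + fib (k - 5)" "fib (k - 4) = fib (k - 5) + fib (k - 6)"
    "fib k = fib (k - 1) + fib (k - 2)" "fib (k - 1) = fib (k - 2) + fib (k - 3)"
    "fib (k - 2) = fib (k - 3) + fib (k - 4)"
  proof -
    obtain m where m: "k = m + 6" using k by (metis le_add_diff_inverse2)
    have e: "k - 1 = m + 5" "k - 2 = m + 4" "k - 3 = m + 3" "k - 4 = m + 2" "k - 5 = m + 1" "k - 6 = m"
      by (simp_all add: m)
    show "fib (k - 3) = fib (k - 4) + fib (k - 5)" "fib (k - 4) = fib (k - 5) + fib (k - 6)"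
      "fib k = fib (k - 1) + fib (k - 2)" "fib (k - 1) = fib (k - 2) + fib (k - 3)"
      "fib (k - 2) = fib (k - 3) + fib (k - 4)"
      unfolding e unfolding m
      by (simp_all add: numeral_eq_Suc)
  qed
  have fibk: "fib k = 5 * card A + 3 * card B" unfolding cA cB using fib1 by linarith
  have "fib (k - 6) \<le> fib (k - 5)" by (rule fib_mono) simp
  then have AB: "card A \<le> 2 * card B" using fib1(2) by (simp add: cA cB)
  have posA: "card A \<ge> 1" using q by (simp add: cA)
  have cE: "card (edges G) + 1 = 2 * fib k" using T_tree_card[OF T] join_tree_card[OF jt] by simp
  have half_iff: "half G r \<longleftrightarrow> r + 1 = fib k \<or> r = fib k" for r
    using cE by (auto simp: half_def)
  have "\<exists>Q\<subseteq>A \<union> B \<union> L1. no_shared_neighbour G Q \<and>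
      half G (card (boundary G Q) + card {e \<in> inner G Q. \<kappa> e})" for \<kappa>
  proof -
    \<comment> \<open>\<open>val B'\<close> is the number of edges obtained when exactly \<open>B'\<close> remains from \<open>B\<close>.\<close>
    define X where "X B' = A \<union> B' \<union> L1" for B'
    define \<kappa>n where "\<kappa>n B' = card {e \<in> inner G (X B'). \<kappa> e}" for B'
    define val where "val B' = card (boundary G (X B')) + \<kappa>n B'" for B'
    have fin_inner: "finite (inner G Y)" for Y
      using simple_graphD(2)[OF G] by (simp add: inner_def)
    have val: "val B' = 4 * card A + card B + 2 * card B' + q + \<kappa>n B'" if "B' \<subseteq> B" for B'
      using T_frame_count(2)[OF F that L1(1)] L1(2) by (simp add: val_def X_def)
    have inn: "card (inner G (X B')) + 1 = card A + card B'" if "B' \<subseteq> B" for B'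
      using T_frame_count(3)[OF F that L1(1)] by (simp add: X_def)
    have "val B \<ge> 4 * card A + 3 * card B + q" using val[of B] by simp
    then have top: "val B + 1 \<ge> fib k" using q(3) cA fibk by linarith
    have "\<kappa>n {} \<le> card (inner G (X {}))"
      unfolding \<kappa>n_def by (intro card_mono fin_inner) auto
    then have "val {} + 1 \<le> 5 * card A + card B + q" using val[of "{}"] inn[of "{}"] by simp
    then have bottom: "val {} \<le> fib k + 1" using q(2) cA fibk AB by linarith
    have step: "val (insert b B') \<le> val B' + 3" if b: "insert b B' \<subseteq> B" "b \<notin> B'" for b B'
    proof -
      have fB': "finite B'" using b finite_subset[OF _ fin(2), of B'] by simp
      have sub: "inner G (X B') \<subseteq> inner G (X (insert b B'))" by (auto simp: inner_def X_def)
      have "card (inner G (X (insert b B')) - inner G (X B')) = 1"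
        using inn[of B'] inn[of "insert b B'"] b fB' posA
        by (subst card_Diff_subset[OF fin_inner sub]) simp
      then have "card ({e \<in> inner G (X B'). \<kappa> e} \<union> (inner G (X (insert b B')) - inner G (X B'))) \<le> \<kappa>n B' + 1"
        using card_Un_le[of "{e \<in> inner G (X B'). \<kappa> e}"] unfolding \<kappa>n_def by metis
      moreover have "\<kappa>n (insert b B') \<le>
          card ({e \<in> inner G (X B'). \<kappa> e} \<union> (inner G (X (insert b B')) - inner G (X B')))"
        unfolding \<kappa>n_def using fin_inner by (intro card_mono) auto
      ultimately show ?thesis using val[of B'] val[of "insert b B'"] b fB' by simp
    qed
    \<comment> \<open>A smallest \<open>B'\<close> that still suffices exceeds half by at most two, by \<open>step\<close>.\<close>
    have "B \<subseteq> B \<and> val B + 1 \<ge> fib k" using top by simp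
    from ex_has_least_nat[of "\<lambda>B'. B' \<subseteq> B \<and> val B' + 1 \<ge> fib k" B card, OF this]
    obtain B' where "(B' \<subseteq> B \<and> val B' + 1 \<ge> fib k) \<and>
        (\<forall>C. C \<subseteq> B \<and> val C + 1 \<ge> fib k \<longrightarrow> card B' \<le> card C)"
      by (rule exE)
    then have B': "B' \<subseteq> B" "val B' + 1 \<ge> fib k"
      and least: "\<And>C. C \<subseteq> B \<Longrightarrow> val C + 1 \<ge> fib k \<Longrightarrow> card B' \<le> card C"
      by simp_all
    have "val B' \<le> fib k + 1"
    proof (cases "B' = {}")
      case True then show ?thesis using bottom by simp
    next
      case False
      then obtain b C where C: "B' = insert b C" "b \<notin> C" by (metis Set.set_insert ex_in_conv)
      have "finite C" using C B'(1) finite_subset[OF _ fin(2), of C] by auto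
      then have "card C < card B'" using C by simp
      then have "\<not> val C + 1 \<ge> fib k" using least[of C] C B'(1) by auto
      then show ?thesis using step[of b C] C B'(1) by auto
    qed
    then consider "half G (val B')" | "val B' = fib k + 1" using B'(2) half_iff by force
    then show ?thesis
    proof cases
      case 1
      have "no_shared_neighbour G (X B')" using T_frame_count(1)[OF F B'(1) L1(1)] by (simp add: X_def)
      then show ?thesis using 1 B'(1)
        by (intro exI[of _ "X B'"]) (auto simp: X_def val_def \<kappa>n_def)
    next
      case 2
      define Q where "Q = A \<union> B' \<union> (L1 - {l})"
      have sub: "L1 - {l} \<subseteq> L" using L1(1) by auto
      note Qc = T_frame_count[OF F B'(1) sub, folded Q_def]
      have "inner G Q \<subseteq> inner G (X B')" by (auto simp: inner_def X_def Q_def)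
      moreover have "card (inner G Q) = card (inner G (X B'))" using Qc(3) inn[OF B'(1)] by simp
      ultimately have "inner G Q = inner G (X B')" using fin_inner card_subset_eq by metis
      moreover have "card (boundary G Q) + 1 = card (boundary G (X B'))"
        using Qc(2) T_frame_count(2)[OF F B'(1) L1(1)] l L1(2,3) q(1) by (simp add: X_def)
      ultimately have "card (boundary G Q) + card {e \<in> inner G Q. \<kappa> e} + 1 = val B'"
        by (simp add: val_def \<kappa>n_def)
      then have "half G (card (boundary G Q) + card {e \<in> inner G Q. \<kappa> e})"
        using 2 half_iff by simp
      then show ?thesis using Qc(1) B'(1) by (intro exI[of _ Q]) (auto simp: Q_def)
    qed
  qed
  moreover have "card (A \<union> B \<union> L1) = fib (k - 3) + q"
  proof -
    have "(A \<union> B) \<inter> L1 = {}" using FD(5,6) L1(1) by auto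
    then show ?thesis
      using fin L1(2,3) FD(4) fib1(1) by (simp add: card_Un_disjoint cA cB)
  qed
  moreover have "A \<union> B \<union> L1 \<subseteq> verts G" using FD(1-3) L1(1) by auto
  moreover have "card {w. {l, w} \<in> edges G} \<le> 1" using FD(8) l L1(1) by auto
  ultimately have "hub_placement G (fib (k - 3) + q) (A \<union> B \<union> L1) l"
    using l unfolding hub_placement_def by blast
  then show ?thesis by blast
qed

text \<open>
  Cut \<open>T_k\<close> into \<open>fib (k - 3)\<close> copies of \<open>T_5\<close> and \<open>T_4\<close>, which have maximum degree at most four, and
  count all edges between the copies as touched.
\<close>

lemma T_tree_touched:
  "T_tree k G \<Longrightarrow> k \<ge> 4 \<Longrightarrow> card (touched G S) \<le> 4 * card (S \<inter> verts G) + (fib (k - 3) - 1)"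
proof (induction k arbitrary: G rule: less_induct)
  case (less k)
  show ?case
  proof (cases "k \<le> 5")
    case True
    note jt = T_tree_join_tree[OF less.prems(1)]
    obtain x where x: "max_degree_vertex G x" using ex_max_degree_vertex_tree[OF jt] by blast
    have "degree G y \<le> 4" if "y \<in> verts G" for y
      using x that T_tree_max_degree[OF less.prems(1) x] True
      by (force simp: max_degree_vertex_def)
    from touched_le_degree[OF join_tree_simple[OF jt] this, of S] show ?thesis by simp
  next
    case False
    then have "k \<ge> 3" by simp
    from T_tree_joinE[OF less.prems(1) this] obtain H u J v where
      J: "G = join_by_edge H u J v" "T_tree (k - 1) H" "T_tree (k - 2) J"
      "max_degree_vertex H u" "max_degree_vertex J v" "edge_join H u J v" .
    interpret edge_join H u J v by (rule J(6))
    have "card (touched H S) \<le> 4 * card (S \<inter> verts H) + (fib (k - 1 - 3) - 1)"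
      "card (touched J S) \<le> 4 * card (S \<inter> verts J) + (fib (k - 2 - 3) - 1)"
      using less.IH[OF _ J(2)] less.IH[OF _ J(3)] False by simp_all
    moreover have "S \<inter> verts G = (S \<inter> verts H) \<union> (S \<inter> verts J)" by (auto simp: J(1) verts_G)
    then have "card (S \<inter> verts G) = card (S \<inter> verts H) + card (S \<inter> verts J)"
      using disjoint simple_graphD(1)[OF simple_H] simple_graphD(1)[OF simple_J]
      by (simp, intro card_Un_disjoint) auto
    moreover have "fib (k - 3) = fib (k - 1 - 3) + fib (k - 2 - 3)"
      using fib_rec[of "k - 3"] False by simp
    moreover have "fib (k - 1 - 3) \<ge> 1" "fib (k - 2 - 3) \<ge> 1"
      using False fib_neq_0_nat[of "k - 1 - 3"] fib_neq_0_nat[of "k - 2 - 3"] by simp_all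
    ultimately show ?thesis using card_touched_G[of S] unfolding J(1) by linarith
  qed
qed

section \<open>The structure of \<open>A_k\<close> and \<open>B_k\<close>\<close>

lemma A_tree_1:
  assumes "A_tree 1 G"
  shows "\<exists>v. G = \<lparr>verts = {v}, edges = {}\<rparr>"
  using assms by (cases rule: A_tree.cases) auto

lemma A_tree_pos: "A_tree k G \<Longrightarrow> k \<ge> 1"
  by (induction rule: A_tree.induct) auto

lemma A_tree_joinE:
  assumes "A_tree k G" "k \<ge> 2"
  obtains H u J v where "G = join_by_edge H u J v" "A_tree (k - 1) H" "A_tree (k - 1) J"
    "max_degree_vertex H u" "max_degree_vertex J v" "edge_join H u J v"
  using assms
proof (cases rule: A_tree.cases)
  case (A_step H J u v)
  then have "edge_join H u J v"
    by (intro edge_joinI A_tree_join_tree max_degree_vertex_in)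
  then show ?thesis using A_step by (intro that)
qed auto

lemma A_tree_max_degree:
  "A_tree k G \<Longrightarrow> max_degree_vertex G x \<Longrightarrow> degree G x = k - 1"
proof (induction k arbitrary: G x rule: less_induct)
  case (less k)
  show ?case
  proof (cases "k \<ge> 2")
    case False
    then have "k = 1" using A_tree_pos[OF less.prems(1)] by simp
    then obtain v where "G = \<lparr>verts = {v}, edges = {}\<rparr>" using A_tree_1 less.prems(1) by auto
    then show ?thesis using \<open>k = 1\<close> by (simp add: degree_def)
  next
    case True
    obtain H u J v where J: "G = join_by_edge H u J v" "A_tree (k - 1) H" "A_tree (k - 1) J"
      "max_degree_vertex H u" "max_degree_vertex J v" "edge_join H u J v"
      using A_tree_joinE[OF less.prems(1) True] .
    have d: "degree H u = k - 2" "degree J v = k - 2"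
      using less.IH[OF _ J(2,4)] less.IH[OF _ J(3,5)] True by simp_all
    have "degree G x = degree H u + 1"
      using edge_join.max_degree_vertex_G(1)[OF J(6,4,5)] less.prems(2) J(1) d by simp
    then show ?thesis using d True by simp
  qed
qed

text \<open>
  Both ends of the edge by which \<open>A_k\<close> was built have maximum degree. As the two copies play the same
  role, a given vertex of maximum degree may be assumed to be in the first one.
\<close>

lemma A_tree_rootE:
  assumes "A_tree k G" "max_degree_vertex G x" "k \<ge> 2"
  obtains H J v where "G = join_by_edge H x J v" "A_tree (k - 1) H" "A_tree (k - 1) J"
    "max_degree_vertex H x" "max_degree_vertex J v" "edge_join H x J v"
proof -
  obtain H u J v where J: "G = join_by_edge H u J v" "A_tree (k - 1) H" "A_tree (k - 1) J"
    "max_degree_vertex H u" "max_degree_vertex J v" "edge_join H u J v"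
    using A_tree_joinE[OF assms(1,3)] .
  have d: "degree H u = k - 2" "degree J v = k - 2"
    using A_tree_max_degree[OF J(2,4)] A_tree_max_degree[OF J(3,5)] by simp_all
  have "x = u \<or> x = v \<and> degree J v = degree H u"
    by (rule edge_join.max_degree_vertex_G(2)[OF J(6,4,5)]) (use d assms(2) J(1) in simp_all)
  then consider "x = u" | "x = v" by blast
  then show ?thesis
  proof cases
    case 1
    show ?thesis using J unfolding 1[symmetric] by (rule that)
  next
    case 2
    have "G = join_by_edge J x H u" using J(1) 2 join_by_edge_commute by metis
    moreover have "edge_join J x H u" using edge_join_commute[OF J(6)] 2 by simp
    ultimately show ?thesis using that J(2-5) 2 by simp
  qed
qed

lemma A_tree_card: "A_tree k G \<Longrightarrow> card (verts G) = 2 ^ (k - 1)"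
proof (induction rule: A_tree.induct)
  case (A_step k H J u v)
  have "edge_join H u J v"
    using A_step by (intro edge_joinI A_tree_join_tree max_degree_vertex_in)
  moreover obtain m where "k = Suc (Suc m)" using A_step.hyps(1)
    by (metis add_2_eq_Suc le_Suc_ex)
  ultimately show ?case using A_step.IH by (simp add: edge_join.card_verts_G)
qed simp

text \<open>
  Mapping a given vertex of maximum degree to another one is the invariant that makes the
  isomorphisms of the two halves fit together along the joining edge.
\<close>

lemma A_tree_iso:
  fixes G G' :: "'a ugraph"
  shows "A_tree k G \<Longrightarrow> A_tree k G' \<Longrightarrow> max_degree_vertex G x \<Longrightarrow> max_degree_vertex G' x' \<Longrightarrow>
    \<exists>\<phi>. bij_betw \<phi> (verts G) (verts G') \<and> edges G' = (\<lambda>e. \<phi> ` e) ` edges G \<and> \<phi> x = x'"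
proof (induction k arbitrary: G G' x x' rule: less_induct)
  case (less k)
  show ?case
  proof (cases "k \<ge> 2")
    case False
    then have "k = 1" using A_tree_pos[OF less.prems(1)] by simp
    then obtain v v' where "G = \<lparr>verts = {v}, edges = {}\<rparr>" "G' = \<lparr>verts = {v'}, edges = {}\<rparr>"
      using A_tree_1 less.prems(1,2) by metis
    then show ?thesis using max_degree_vertex_in[OF less.prems(3)] max_degree_vertex_in[OF less.prems(4)]
      by (intro exI[of _ "\<lambda>_. v'"]) (simp add: bij_betw_def)
  next
    case True
    obtain H J v where J: "G = join_by_edge H x J v" "A_tree (k - 1) H" "A_tree (k - 1) J"
      "max_degree_vertex H x" "max_degree_vertex J v" "edge_join H x J v"
      using A_tree_rootE[OF less.prems(1,3) True] .
    obtain H' J' v' where J': "G' = join_by_edge H' x' J' v'" "A_tree (k - 1) H'" "A_tree (k - 1) J'"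
      "max_degree_vertex H' x'" "max_degree_vertex J' v'" "edge_join H' x' J' v'"
      using A_tree_rootE[OF less.prems(2,4) True] .
    have k: "k - 1 < k" using True by simp
    obtain \<phi> where \<phi>: "bij_betw \<phi> (verts H) (verts H')" "edges H' = (\<lambda>e. \<phi> ` e) ` edges H" "\<phi> x = x'"
      using less.IH[OF k J(2) J'(2) J(4) J'(4)] by blast
    obtain \<psi> where \<psi>: "bij_betw \<psi> (verts J) (verts J')" "edges J' = (\<lambda>e. \<psi> ` e) ` edges J" "\<psi> v = v'"
      using less.IH[OF k J(3) J'(3) J(5) J'(5)] by blast
    define f where "f w = (if w \<in> verts H then \<phi> w else \<psi> w)" for w
    interpret L: edge_join H x J v by (rule J(6))
    interpret R: edge_join H' x' J' v' by (rule J'(6))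
    have fH: "f w = \<phi> w" if "w \<in> verts H" for w using that by (simp add: f_def)
    have fJ: "f w = \<psi> w" if "w \<in> verts J" for w using that L.disjoint by (auto simp: f_def)
    have "bij_betw f (verts H) (verts H')" "bij_betw f (verts J) (verts J')"
      using \<phi>(1) \<psi>(1) fH fJ by (metis bij_betw_cong)+
    then have bij: "bij_betw f (verts H \<union> verts J) (verts H' \<union> verts J')"
      by (rule bij_betw_combine) (rule R.disjoint)
    have "f ` e = \<phi> ` e" if "e \<in> edges H" for e
      using simple_graphD(3)[OF L.simple_H that] fH by (intro image_cong) auto
    moreover have "f ` e = \<psi> ` e" if "e \<in> edges J" for e
      using simple_graphD(3)[OF L.simple_J that] fJ by (intro image_cong) auto
    moreover have "f x = x'" "f v = v'" using fH[OF L.u] fJ[OF L.v] \<phi>(3) \<psi>(3) by simp_all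
    ultimately have "edges (join_by_edge H' x' J' v') = (\<lambda>e. f ` e) ` edges (join_by_edge H x J v)"
      using \<phi>(2) \<psi>(2) by (simp add: L.edges_G R.edges_G image_Un)
    then show ?thesis
      using bij \<open>f x = x'\<close> unfolding J(1) J'(1) L.verts_G R.verts_G by blast
  qed
qed

lemma A_tree_2:
  assumes "A_tree 2 G"
  shows "edges G = {verts G}" "card (verts G) = 2"
proof -
  have "2 \<ge> (2::nat)" by simp
  from A_tree_joinE[OF assms this] obtain H u J v where
    J: "G = join_by_edge H u J v" "A_tree (2 - 1) H" "A_tree (2 - 1) J"
    "max_degree_vertex H u" "max_degree_vertex J v" "edge_join H u J v" .
  obtain a where a: "H = \<lparr>verts = {a}, edges = {}\<rparr>" using A_tree_1[of H] J(2) by auto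
  obtain b where b: "J = \<lparr>verts = {b}, edges = {}\<rparr>" using A_tree_1[of J] J(3) by auto
  have "u = a" "v = b" using max_degree_vertex_in[OF J(4)] max_degree_vertex_in[OF J(5)] a b by auto
  then show "edges G = {verts G}" using a b J(1) by (auto simp: join_by_edge_def)
  show "card (verts G) = 2" using A_tree_card[OF assms] by simp
qed

lemma A_tree_matching: "A_tree k G \<Longrightarrow> k \<ge> 2 \<Longrightarrow> \<exists>M. matching G M \<and> card M = 2 ^ (k - 2)"
proof (induction k arbitrary: G rule: less_induct)
  case (less k)
  show ?case
  proof (cases "k = 2")
    case True
    then show ?thesis using A_tree_2[of G] less.prems(1)
      by (intro exI[of _ "{verts G}"]) (simp add: matching_single_edge)
  next
    case False
    obtain H u J v where J: "G = join_by_edge H u J v" "A_tree (k - 1) H" "A_tree (k - 1) J"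
      "max_degree_vertex H u" "max_degree_vertex J v" "edge_join H u J v"
      using A_tree_joinE[OF less.prems] .
    interpret edge_join H u J v by (rule J(6))
    have k: "k - 1 < k" "k - 1 \<ge> 2" using False less.prems(2) by simp_all
    obtain M where M: "matching H M" "card M = 2 ^ (k - 1 - 2)" using less.IH[OF k(1) J(2) k(2)] by blast
    obtain N where N: "matching J N" "card N = 2 ^ (k - 1 - 2)" using less.IH[OF k(1) J(3) k(2)] by blast
    have "(2::nat) ^ (k - 2) = 2 ^ (k - 1 - 2) + 2 ^ (k - 1 - 2)"
    proof -
      have "k - 2 = Suc (k - 1 - 2)" using k by simp
      then show ?thesis by simp
    qed
    then show ?thesis using matching_G[OF M(1) N(1)] M(2) N(2)
      unfolding J(1) by (intro exI[of _ "M \<union> N"]) simp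
  qed
qed

text \<open>
  Independent hub positions that yield two edges each on average. As \<open>u\<close> is not among them, joining a
  further tree at \<open>u\<close> changes none of the counts.
\<close>

definition exact_frame :: "'a ugraph \<Rightarrow> 'a \<Rightarrow> 'a set \<Rightarrow> bool" where
  "exact_frame G u C \<longleftrightarrow> C \<subseteq> verts G \<and> u \<notin> C \<and> no_shared_neighbour G C \<and> inner G C = {} \<and>
     card (boundary G C) = 2 * card C"

lemma exact_frame_join:
  assumes j: "edge_join H u J v" and H: "exact_frame H u C" and J: "exact_frame J v C'"
  shows "exact_frame (join_by_edge H u J v) u (C \<union> C')" "card (C \<union> C') = card C + card C'"
proof -
  interpret edge_join H u J v by (rule j)
  have C: "C \<subseteq> verts H" "u \<notin> C" "no_shared_neighbour H C" "inner H C = {}"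
    "card (boundary H C) = 2 * card C" using H by (simp_all add: exact_frame_def)
  have C': "C' \<subseteq> verts J" "v \<notin> C'" "no_shared_neighbour J C'" "inner J C' = {}"
    "card (boundary J C') = 2 * card C'" using J by (simp_all add: exact_frame_def)
  show card: "card (C \<union> C') = card C + card C'"
    using C(1) C'(1) disjoint simple_graphD(1)[OF simple_H] simple_graphD(1)[OF simple_J]
    by (intro card_Un_disjoint) (auto intro: finite_subset)
  have "u \<notin> C'" using C'(1) u_neq_v by auto
  moreover have "no_shared_neighbour (join_by_edge H u J v) (C \<union> C')"
    by (rule no_shared_neighbour_G[OF C(3,1) C'(3,1)]) (use C(2) C'(2) in auto)
  moreover have "finite (inner (join_by_edge H u J v) (C \<union> C'))"
    using simple_graphD(2)[OF simple_G] by (simp add: inner_def)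
  then have "inner (join_by_edge H u J v) (C \<union> C') = {}"
    using card_inner_Un[OF C(1) C'(1)] C(2,4) C'(2,4) by simp
  moreover have "card (boundary (join_by_edge H u J v) (C \<union> C')) = 2 * card (C \<union> C')"
    unfolding card_boundary_Un[OF C(1) C'(1)] card using C(2,5) C'(2,5) by simp
  ultimately show "exact_frame (join_by_edge H u J v) u (C \<union> C')"
    using C(1,2) C'(1) by (auto simp: exact_frame_def verts_G)
qed

lemma A_tree_3_path4:
  assumes "A_tree 3 G" "max_degree_vertex G x"
  shows "\<exists>a w l. path4 G a x w l"
proof -
  have "3 \<ge> (2::nat)" by simp
  from A_tree_rootE[OF assms this] obtain H J v where
    J: "G = join_by_edge H x J v" "A_tree (3 - 1) H" "A_tree (3 - 1) J"
    "max_degree_vertex H x" "max_degree_vertex J v" "edge_join H x J v" .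
  have "A_tree 2 H" "A_tree 2 J" using J(2,3) by simp_all
  note H2 = A_tree_2[OF this(1)] and J2 = A_tree_2[OF this(2)]
  show ?thesis
    unfolding J(1) by (rule path4_join[OF J(6) refl H2 refl J2]) simp
qed

text \<open>
  From each copy of the path \<open>A_3\<close> in \<open>A_k\<close> take the inner vertex at which no edge was joined.
\<close>

lemma A_tree_exact_frame:
  "A_tree k G \<Longrightarrow> max_degree_vertex G x \<Longrightarrow> k \<ge> 3 \<Longrightarrow> \<exists>C. exact_frame G x C \<and> card C = 2 ^ (k - 3)"
proof (induction k arbitrary: G x rule: less_induct)
  case (less k)
  note G = join_tree_simple[OF A_tree_join_tree[OF less.prems(1)]]
  show ?case
  proof (cases "k = 3")
    case True
    then have "A_tree 3 G" using less.prems(1) by simp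
    from A_tree_3_path4[OF this less.prems(2)] obtain a w l where p: "path4 G a x w l"
      by (elim exE) (rule that)
    have "{x, w} \<noteq> {w, l}" "x \<noteq> w" "w \<in> verts G" using p by (auto simp: path4_def doubleton_eq_iff)
    then have "exact_frame G x {w}"
      using path4_end(5,6)[OF p G] inner_single[OF G, of w] by (simp add: exact_frame_def)
    then show ?thesis using True by (intro exI[of _ "{w}"]) simp
  next
    case False
    have "k \<ge> 2" using less.prems(3) by simp
    from A_tree_rootE[OF less.prems(1,2) this] obtain H J v where
      J: "G = join_by_edge H x J v" "A_tree (k - 1) H" "A_tree (k - 1) J"
      "max_degree_vertex H x" "max_degree_vertex J v" "edge_join H x J v" .
    have k: "k - 1 < k" "k - 1 \<ge> 3" using False less.prems(3) by simp_all
    obtain C where C: "exact_frame H x C" "card C = 2 ^ (k - 1 - 3)"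
      using less.IH[OF k(1) J(2,4) k(2)] by blast
    obtain C' where C': "exact_frame J v C'" "card C' = 2 ^ (k - 1 - 3)"
      using less.IH[OF k(1) J(3,5) k(2)] by blast
    have "k - 3 = Suc (k - 1 - 3)" using k by simp
    then have "(2::nat) ^ (k - 3) = 2 ^ (k - 1 - 3) + 2 ^ (k - 1 - 3)" by simp
    then show ?thesis
      using exact_frame_join[OF J(6) C(1) C'(1)] C(2) C'(2) J(1)
      by (intro exI[of _ "C \<union> C'"]) simp
  qed
qed

text \<open>
  A hub placement needs a leaf. In one copy of \<open>A_4\<close>, instead of one vertex of degree two from each of
  the two paths, take the vertex of degree three of one path, and from the other path the leaf that is
  not adjacent to the joining edge.
\<close>

lemma A_tree_exact_frame_leaf:
  "A_tree k G \<Longrightarrow> max_degree_vertex G x \<Longrightarrow> k \<ge> 4 \<Longrightarrow>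
    \<exists>C l. exact_frame G x C \<and> card C = 2 ^ (k - 3) \<and> l \<in> C \<and> card {w. {l, w} \<in> edges G} \<le> 1"
proof (induction k arbitrary: G x rule: less_induct)
  case (less k)
  have "k \<ge> 2" using less.prems(3) by simp
  from A_tree_rootE[OF less.prems(1,2) this] obtain H J v where
    J: "G = join_by_edge H x J v" "A_tree (k - 1) H" "A_tree (k - 1) J"
    "max_degree_vertex H x" "max_degree_vertex J v" "edge_join H x J v" .
  interpret edge_join H x J v by (rule J(6))
  show ?case
  proof (cases "k = 4")
    case True
    then have "A_tree 3 H" "A_tree 3 J" using J(2,3) by simp_all
    then obtain a w l a' w' l' where p: "path4 H a x w l" and p': "path4 J a' v w' l'"
      using A_tree_3_path4 J(4,5) by metis
    note pe = path4_end[OF p simple_H] and pe' = path4_end[OF p' simple_J]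
    have l: "l \<in> verts H" "l \<noteq> x" "{x, l} \<notin> edges H" "v \<noteq> l" "x \<noteq> v"
      using p u_neq_v by (auto simp: path4_def doubleton_eq_iff)
    have sub: "{l} \<subseteq> verts H" "{v} \<subseteq> verts J" using l v by simp_all
    have "no_shared_neighbour (join_by_edge H x J v) ({l} \<union> {v})"
      by (rule no_shared_neighbour_G[OF no_shared_neighbour_single sub(1) no_shared_neighbour_single sub(2)])
        (use l in auto)
    moreover have "card (boundary (join_by_edge H x J v) ({l} \<union> {v})) = 4"
      unfolding card_boundary_Un[OF sub]
      using pe(1) pe'(4) l by (simp add: card_boundary_single[OF simple_J])
    moreover have "finite (inner (join_by_edge H x J v) ({l} \<union> {v}))"
      using simple_graphD(2)[OF simple_G] by (simp add: inner_def)
    then have "inner (join_by_edge H x J v) ({l} \<union> {v}) = {}"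
      using card_inner_Un[OF sub] l inner_single[OF simple_H] inner_single[OF simple_J] by simp
    ultimately have "exact_frame (join_by_edge H x J v) x ({l} \<union> {v})"
      using l sub by (auto simp: exact_frame_def verts_G)
    moreover have "card {z. {l, z} \<in> edges (join_by_edge H x J v)} \<le> 1"
      using neighbours_G[OF l(1,2)] pe(2) by simp
    ultimately show ?thesis
      using True J(1) l by (intro exI[of _ "{l} \<union> {v}"] exI[of _ l]) simp
  next
    case False
    have k: "k - 1 < k" "k - 1 \<ge> 4" "k - 1 \<ge> 3" using False less.prems(3) by simp_all
    obtain C l where C: "exact_frame H x C" "card C = 2 ^ (k - 1 - 3)" "l \<in> C"
      "card {w. {l, w} \<in> edges H} \<le> 1"
      using less.IH[OF k(1) J(2,4) k(2)] by blast
    obtain C' where C': "exact_frame J v C'" "card C' = 2 ^ (k - 1 - 3)"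
      using A_tree_exact_frame[OF J(3,5) k(3)] by blast
    have "k - 3 = Suc (k - 1 - 3)" using k by simp
    then have "(2::nat) ^ (k - 3) = 2 ^ (k - 1 - 3) + 2 ^ (k - 1 - 3)" by simp
    moreover have "l \<in> verts H" "l \<noteq> x" using C(1,3) by (auto simp: exact_frame_def)
    then have "card {w. {l, w} \<in> edges (join_by_edge H x J v)} \<le> 1" using neighbours_G C(4) by simp
    ultimately show ?thesis
      using exact_frame_join[OF J(6) C(1) C'(1)] C(2,3) C'(2) J(1)
      by (intro exI[of _ "C \<union> C'"] exI[of _ l]) simp
  qed
qed

lemma B_treeE:
  assumes "B_tree k G"
  obtains H u z where "A_tree k H" "max_degree_vertex H u" "edge_join H u \<lparr>verts = {z}, edges = {}\<rparr> z"
    "G = join_by_edge H u \<lparr>verts = {z}, edges = {}\<rparr> z"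
proof -
  obtain H u z where H: "A_tree k H" "max_degree_vertex H u" "z \<notin> verts H"
    "G = \<lparr>verts = insert z (verts H), edges = insert {u, z} (edges H)\<rparr>"
    using assms unfolding B_tree_def by blast
  have "edge_join H u \<lparr>verts = {z}, edges = {}\<rparr> z"
    by (rule edge_joinI[OF A_tree_join_tree[OF H(1)] join_tree.single])
      (use H max_degree_vertex_in in auto)
  moreover have "G = join_by_edge H u \<lparr>verts = {z}, edges = {}\<rparr> z"
    using H(4) by (simp add: join_by_edge_def)
  ultimately show ?thesis using that H(1,2) by blast
qed

lemma B_tree_join_tree: "B_tree k G \<Longrightarrow> join_tree G"
  by (elim B_treeE) (auto intro!: join_tree.intros dest: A_tree_join_tree simp: edge_join_def)

lemma B_tree_card:
  assumes "B_tree k G"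
  shows "card (verts G) = 2 ^ (k - 1) + 1" "card (edges G) = 2 ^ (k - 1)"
proof -
  obtain H u z where H: "A_tree k H" "max_degree_vertex H u"
    "edge_join H u \<lparr>verts = {z}, edges = {}\<rparr> z" "G = join_by_edge H u \<lparr>verts = {z}, edges = {}\<rparr> z"
    using B_treeE[OF assms] .
  show "card (verts G) = 2 ^ (k - 1) + 1"
    using edge_join.card_verts_G[OF H(3)] A_tree_card[OF H(1)] H(4) by simp
  then show "card (edges G) = 2 ^ (k - 1)"
    using join_tree_card[OF B_tree_join_tree[OF assms]] by simp
qed

lemma B_tree_matching:
  assumes "B_tree k G" "k \<ge> 2"
  shows "\<exists>M. matching G M \<and> card M = 2 ^ (k - 2)"
proof -
  obtain H u z where H: "A_tree k H" "max_degree_vertex H u"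
    "edge_join H u \<lparr>verts = {z}, edges = {}\<rparr> z" "G = join_by_edge H u \<lparr>verts = {z}, edges = {}\<rparr> z"
    using B_treeE[OF assms(1)] .
  obtain M where M: "matching H M" "card M = 2 ^ (k - 2)" using A_tree_matching[OF H(1) assms(2)] by blast
  have "matching \<lparr>verts = {z}, edges = {}\<rparr> {}" by (simp add: matching_def)
  from edge_join.matching_G(1)[OF H(3) M(1) this] M(2) H(4) show ?thesis
    by (intro exI[of _ M]) simp
qed

lemma B_tree_hub_placement:
  assumes "B_tree k G" "k \<ge> 4"
  shows "\<exists>P l. hub_placement G (2 ^ (k - 3)) P l"
proof -
  obtain H u z where H: "A_tree k H" "max_degree_vertex H u"
    "edge_join H u \<lparr>verts = {z}, edges = {}\<rparr> z" "G = join_by_edge H u \<lparr>verts = {z}, edges = {}\<rparr> z"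
    using B_treeE[OF assms(1)] .
  obtain C l where C: "exact_frame H u C" "card C = 2 ^ (k - 3)" "l \<in> C" "card {w. {l, w} \<in> edges H} \<le> 1"
    using A_tree_exact_frame_leaf[OF H(1,2) assms(2)] by blast
  have "exact_frame \<lparr>verts = {z}, edges = {}\<rparr> z {}"
    by (simp add: exact_frame_def inner_def no_shared_neighbour_empty)
  from exact_frame_join(1)[OF H(3) C(1) this] have F: "exact_frame G u C" using H(4) by simp
  have "l \<in> verts H" "l \<noteq> u" using C(1,3) by (auto simp: exact_frame_def)
  then have l: "card {w. {l, w} \<in> edges G} \<le> 1"
    using edge_join.neighbours_G[OF H(3)] C(4) H(4) by simp
  have "k - 1 = Suc (Suc (k - 3))" using assms(2) by simp
  then have "card (edges G) = 4 * 2 ^ (k - 3)" using B_tree_card(2)[OF assms(1)] by simp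
  then have "half G (card (boundary G C) + card {e \<in> inner G C. \<kappa> e})" for \<kappa>
    using F C(2) by (simp add: exact_frame_def half_def)
  then have "hub_placement G (2 ^ (k - 3)) C l"
    using F C(2,3) l unfolding hub_placement_def exact_frame_def by blast
  then show ?thesis by blast
qed

text \<open>
  A graph with an even number of edges has equally many edges of both colors in a balanced copy, so
  that deleting any edge leaves the copy balanced.
\<close>

lemma half_copy_delete_leaf:
  assumes j: "edge_join H u \<lparr>verts = {z}, edges = {}\<rparr> z"
    and c: "half_copy V R (join_by_edge H u \<lparr>verts = {z}, edges = {}\<rparr> z)"
    and even: "even (card (edges (join_by_edge H u \<lparr>verts = {z}, edges = {}\<rparr> z)))"
  shows "half_copy V R H"
proof -
  interpret edge_join H u "\<lparr>verts = {z}, edges = {}\<rparr>" z by (rule j)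
  obtain g where g: "inj_on g (verts G)" "g ` verts G \<subseteq> V" "half G (card {e \<in> edges G. g ` e \<in> R})"
    using c unfolding half_copy_def by blast
  have E: "edges G = insert {u, z} (edges H)" by (simp add: edges_G)
  have cE: "card (edges G) = card (edges H) + 1" by (simp add: card_edges_G)
  have fin: "finite {e \<in> edges H. g ` e \<in> R}" using simple_graphD(2)[OF simple_H] by simp
  have "{e \<in> edges G. g ` e \<in> R} = (if g ` {u, z} \<in> R then {{u, z}} else {}) \<union> {e \<in> edges H. g ` e \<in> R}"
    unfolding E by auto
  then have "card {e \<in> edges G. g ` e \<in> R} =
      (if g ` {u, z} \<in> R then 1 else 0) + card {e \<in> edges H. g ` e \<in> R}"
    using fin edges_disjoint(2) by (auto simp: card_insert_if)
  then have "half H (card {e \<in> edges H. g ` e \<in> R})"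
    using g(3) even cE by (auto simp: half_def split: if_splits elim!: evenE)
  moreover have "verts H \<subseteq> verts G" by (auto simp: verts_G)
  ultimately show ?thesis
    unfolding half_copy_def using inj_on_subset[OF g(1)] g(2) by (intro exI[of _ g]) blast
qed

lemma bal_A_le_bal_B:
  fixes A B :: "'a ugraph"
  assumes A: "A_tree k A" and B: "B_tree k B" and k: "k \<ge> 2"
  shows "bal n A \<le> bal n B"
proof (rule bal_mono)
  fix c assume "\<exists>C. balanced_copy n c B C"
  then have hB: "half_copy {..<n} (color_class n c Red) B"
    using ex_balanced_copy_iff[OF join_tree_simple[OF B_tree_join_tree[OF B]]] by blast
  obtain H u z where H: "A_tree k H" "max_degree_vertex H u"
    "edge_join H u \<lparr>verts = {z}, edges = {}\<rparr> z" "B = join_by_edge H u \<lparr>verts = {z}, edges = {}\<rparr> z"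
    using B_treeE[OF B] .
  have "even (card (edges B))" using B_tree_card(2)[OF B] k by simp
  then have hH: "half_copy {..<n} (color_class n c Red) H"
    using half_copy_delete_leaf[OF H(3)] hB H(4) by simp
  note jt = A_tree_join_tree[OF A]
  obtain x where "max_degree_vertex A x" using ex_max_degree_vertex_tree[OF jt] by blast
  then obtain \<phi> where "bij_betw \<phi> (verts A) (verts H)" "edges H = (\<lambda>e. \<phi> ` e) ` edges A"
    using A_tree_iso[OF A H(1) _ H(2)] by blast
  then show "\<exists>C. balanced_copy n c A C"
    using half_copy_iso[OF hH _ _ join_tree_simple[OF jt]]
      ex_balanced_copy_iff[OF join_tree_simple[OF jt]] by blast
qed

text \<open>
  Cut \<open>A_k\<close> into \<open>2 ^ (k - 5)\<close> copies of \<open>A_5\<close>, which has maximum degree four.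
\<close>

lemma A_tree_touched:
  "A_tree k G \<Longrightarrow> k \<ge> 5 \<Longrightarrow> card (touched G S) \<le> 4 * card (S \<inter> verts G) + (2 ^ (k - 5) - 1)"
proof (induction k arbitrary: G rule: less_induct)
  case (less k)
  show ?case
  proof (cases "k = 5")
    case True
    note jt = A_tree_join_tree[OF less.prems(1)]
    obtain x where x: "max_degree_vertex G x" using ex_max_degree_vertex_tree[OF jt] by blast
    have "degree G y \<le> 4" if "y \<in> verts G" for y
      using x that A_tree_max_degree[OF less.prems(1) x] True
      by (force simp: max_degree_vertex_def)
    from touched_le_degree[OF join_tree_simple[OF jt] this, of S] show ?thesis by (rule trans_le_add1)
  next
    case False
    have "k \<ge> 2" using less.prems(2) by simp
    from A_tree_joinE[OF less.prems(1) this] obtain H u J v where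
      J: "G = join_by_edge H u J v" "A_tree (k - 1) H" "A_tree (k - 1) J"
      "max_degree_vertex H u" "max_degree_vertex J v" "edge_join H u J v" .
    interpret edge_join H u J v by (rule J(6))
    have "card (touched H S) \<le> 4 * card (S \<inter> verts H) + (2 ^ (k - 1 - 5) - 1)"
      "card (touched J S) \<le> 4 * card (S \<inter> verts J) + (2 ^ (k - 1 - 5) - 1)"
      using less.IH[OF _ J(2)] less.IH[OF _ J(3)] False less.prems(2) by simp_all
    moreover have "S \<inter> verts G = (S \<inter> verts H) \<union> (S \<inter> verts J)" by (auto simp: J(1) verts_G)
    then have "card (S \<inter> verts G) = card (S \<inter> verts H) + card (S \<inter> verts J)"
      using disjoint simple_graphD(1)[OF simple_H] simple_graphD(1)[OF simple_J]
      by (simp, intro card_Un_disjoint) auto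
    moreover have "(2::nat) ^ (k - 5) = 2 ^ (k - 1 - 5) + 2 ^ (k - 1 - 5)"
    proof -
      have "k - 5 = Suc (k - 1 - 5)" using False less.prems(2) by simp
      then show ?thesis by simp
    qed
    moreover have "(2::nat) ^ (k - 1 - 5) \<ge> 1" by simp
    ultimately show ?thesis using card_touched_G[of S] unfolding J(1) by linarith
  qed
qed

section \<open>The balancing numbers of the three families\<close>

lemma card_boundary_le_touched:
  assumes "simple_graph G"
  shows "card (boundary G S) \<le> card (touched G S)"
  using simple_graphD(2)[OF assms] by (intro card_mono) (auto simp: boundary_def touched_def)

lemma fib_add_5: "fib (m + 5) = 5 * fib (m + 1) + 3 * fib m"
  by (simp add: numeral_eq_Suc)

lemma fib_ge_2: "k \<ge> 7 \<Longrightarrow> fib (k - 4) \<ge> 2"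
proof -
  assume "k \<ge> 7"
  then have "fib 3 \<le> fib (k - 4)" by (intro fib_mono) simp
  then show ?thesis by (simp add: numeral_eq_Suc)
qed

text \<open>
  With \<open>a = fib (k - 4)\<close> and \<open>b = fib (k - 5)\<close>, a set of \<open>a\<close> vertices touches at most \<open>5 * a + b - 1\<close>
  edges, while half of the edges are \<open>fib k - 1 = 5 * a + 3 * b - 1\<close>.
\<close>

lemma bal_T_tree_lower:
  assumes T: "T_tree k T" and k: "k \<ge> 6" and n: "n \<ge> 3 * fib (k - 4) + 1"
  shows "int (fib (k - 4)) * (int n - int (fib (k - 4))) \<le> int (bal n T)"
proof -
  note jt = T_tree_join_tree[OF T]
  note G = join_tree_simple[OF jt]
  obtain m where m: "k = m + 5" using k by (intro that[of "k - 5"]) simp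
  have e: "k - 4 = m + 1" "k - 3 = m + 2" by (simp_all add: m)
  have pos: "fib m > 0" using k m by (intro fib_neq_0_nat) simp
  have cE: "card (edges T) + 1 = 2 * fib k" using T_tree_card[OF T] join_tree_card[OF jt] by simp
  have "fib (k - 4) * (n - fib (k - 4)) \<le> bal n T"
  proof (rule bal_lower_bound[OF G n])
    fix S assume S: "S \<subseteq> verts T" "card S \<le> fib (k - 4)"
    have "card (boundary T S) \<le> 4 * card (S \<inter> verts T) + (fib (k - 3) - 1)"
      using card_boundary_le_touched[OF G, of S] T_tree_touched[OF T, of S] k by simp
    moreover have "S \<inter> verts T = S" using S(1) by auto
    ultimately have "card (boundary T S) \<le> 4 * fib (k - 4) + (fib (k - 3) - 1)" using S(2) by simp
    moreover have "fib (k - 3) = fib (m + 1) + fib m" unfolding e by (simp add: numeral_2_eq_2)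
    moreover have "card (edges T) div 2 = fib k - 1" using cE by linarith
    ultimately show "card (boundary T S) < card (edges T) div 2"
      using fib_add_5[of m] pos unfolding m[symmetric] e by linarith
  qed
  then have "int (fib (k - 4) * (n - fib (k - 4))) \<le> int (bal n T)" by (simp only: of_nat_le_iff)
  then show ?thesis using n by (simp add: of_nat_diff)
qed

lemma bal_T_tree_upper:
  fixes k q :: nat
  assumes k: "k \<ge> 6" and q: "1 \<le> q" "q \<le> fib (k - 4)" "fib (k - 4) \<le> q + 1"
  defines "t \<equiv> fib (k - 3) + q"
  shows "\<forall>\<^sub>F n in sequentially. \<forall>T :: 'a ugraph. T_tree k T \<longrightarrow>
    int (bal n T) \<le> (int t - 1) * int n - int (t choose 2)"
proof -
  have "t > 0" using q(1) by (simp add: t_def)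
  from bal_upper_bound[OF this, of "2 * fib k"] obtain n0 where
    n0: "\<forall>n\<ge>n0. \<forall>(G :: 'a ugraph) M P l. join_tree G \<longrightarrow> card (verts G) = 2 * fib k \<longrightarrow>
     matching G M \<longrightarrow> half G (card M) \<longrightarrow> hub_placement G t P l \<longrightarrow>
     int (bal n G) \<le> (int t - 1) * int n - int (t choose 2)"
    by (rule exE)
  show ?thesis
    unfolding eventually_sequentially
  proof (intro exI[of _ n0] allI impI)
    fix n and T :: "'a ugraph"
    assume n: "n0 \<le> n" and T: "T_tree k T"
    note jt = T_tree_join_tree[OF T]
    obtain M where M: "matching T M" "card M = fib k" using T_tree_matching[OF T] by blast
    have "card (edges T) + 1 = 2 * fib k" using T_tree_card[OF T] join_tree_card[OF jt] by simp
    then have "half T (card M)" using M(2) by (simp add: half_def)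
    moreover obtain P l where "hub_placement T t P l"
      using T_tree_hub_placement[OF T k q] unfolding t_def by blast
    ultimately show "int (bal n T) \<le> (int t - 1) * int n - int (t choose 2)"
      using n0 n jt T_tree_card[OF T] M(1) by blast
  qed
qed

text \<open>
  With \<open>s = 2 ^ (k - 5)\<close>, a set of \<open>s\<close> vertices touches at most \<open>5 * s - 1\<close> edges, while half of the
  edges are \<open>8 * s - 1\<close>.
\<close>

lemma bal_A_tree_lower:
  assumes A: "A_tree k A" and k: "k \<ge> 5" and n: "n \<ge> 3 * 2 ^ (k - 5) + 1"
  shows "2 ^ (k - 5) * (int n - 2 ^ (k - 5)) \<le> int (bal n A)"
proof -
  note jt = A_tree_join_tree[OF A]
  note G = join_tree_simple[OF jt]
  define s where "s = (2::nat) ^ (k - 5)"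
  have "k - 1 = (k - 5) + 4" using k by simp
  then have "(2::nat) ^ (k - 1) = 2 ^ ((k - 5) + 4)" by (rule arg_cong)
  also have "\<dots> = 16 * s" by (simp add: s_def power_add)
  finally have "card (verts A) = 16 * s" using A_tree_card[OF A] by simp
  then have cE: "card (edges A) + 1 = 16 * s" using join_tree_card[OF jt] by simp
  have "s * (n - s) \<le> bal n A"
  proof (rule bal_lower_bound[OF G])
    show "3 * s + 1 \<le> n" using n by (simp add: s_def)
    fix S assume S: "S \<subseteq> verts A" "card S \<le> s"
    have "card (boundary A S) \<le> 4 * card (S \<inter> verts A) + (s - 1)"
      using card_boundary_le_touched[OF G, of S] A_tree_touched[OF A k, of S] by (simp add: s_def)
    moreover have "S \<inter> verts A = S" using S(1) by auto
    ultimately have "card (boundary A S) \<le> 4 * s + (s - 1)" using S(2) by simp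
    moreover have "s > 0" by (simp add: s_def)
    ultimately show "card (boundary A S) < card (edges A) div 2" using cE by linarith
  qed
  then have "int (s * (n - s)) \<le> int (bal n A)" by (simp only: of_nat_le_iff)
  moreover have "s \<le> n" using n by (simp add: s_def)
  ultimately have "int s * (int n - int s) \<le> int (bal n A)" by (simp add: of_nat_diff)
  then show ?thesis by (simp add: s_def)
qed

lemma bal_B_tree_upper:
  assumes k: "k \<ge> 5"
  shows "\<forall>\<^sub>F n in sequentially. \<forall>B :: 'a ugraph. B_tree k B \<longrightarrow>
    int (bal n B) \<le> (2 ^ (k - 3) - 1) * int n - int (2 ^ (k - 3) choose 2)"
proof -
  have "(2::nat) ^ (k - 3) > 0" by simp
  from bal_upper_bound[OF this, of "2 ^ (k - 1) + 1"] obtain n0 where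
    n0: "\<forall>n\<ge>n0. \<forall>(G :: 'a ugraph) M P l. join_tree G \<longrightarrow> card (verts G) = 2 ^ (k - 1) + 1 \<longrightarrow>
     matching G M \<longrightarrow> half G (card M) \<longrightarrow> hub_placement G (2 ^ (k - 3)) P l \<longrightarrow>
     int (bal n G) \<le> (int (2 ^ (k - 3)) - 1) * int n - int ((2 ^ (k - 3)) choose 2)"
    by (rule exE)
  show ?thesis
    unfolding eventually_sequentially
  proof (intro exI[of _ n0] allI impI)
    fix n and B :: "'a ugraph"
    assume n: "n0 \<le> n" and B: "B_tree k B"
    obtain M where M: "matching B M" "card M = 2 ^ (k - 2)" using B_tree_matching[OF B] k by auto
    have "k - 1 = Suc (k - 2)" using k by simp
    then have "card (edges B) = 2 * 2 ^ (k - 2)" using B_tree_card(2)[OF B] by simp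
    then have "half B (card M)" using M(2) by (simp add: half_def)
    moreover obtain P l where "hub_placement B (2 ^ (k - 3)) P l"
      using B_tree_hub_placement[OF B] k by auto
    ultimately have "int (bal n B) \<le> (int (2 ^ (k - 3)) - 1) * int n - int ((2 ^ (k - 3)) choose 2)"
      using n0 n B_tree_join_tree[OF B] B_tree_card(1)[OF B] M(1) by blast
    then show "int (bal n B) \<le> (2 ^ (k - 3) - 1) * int n - int (2 ^ (k - 3) choose 2)" by simp
  qed
qed

theorem theorem15:
  shows "(\<forall>\<^sub>F n in sequentially. \<forall>T :: 'a ugraph. T_tree 6 T \<longrightarrow>
            int n - 1 \<le> int (bal n T) \<and> int (bal n T) \<le> 2 * int n - 2)
       \<and> (\<forall>k\<ge>7. \<forall>\<^sub>F n in sequentially. \<forall>T :: 'a ugraph. T_tree k T \<longrightarrow>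
            int (fib (k - 4)) * (int n - int (fib (k - 4))) \<le> int (bal n T) \<and>
            int (bal n T) \<le> (int (fib (k - 2)) - 2) * int n - int ((fib (k - 2) - 1) choose 2)
                             + (if k = 7 then 1 else 0))
       \<and> (\<forall>k\<ge>5. \<forall>\<^sub>F n in sequentially. \<forall>(A :: 'a ugraph) (B :: 'a ugraph).
            A_tree k A \<and> B_tree k B \<longrightarrow>
            2 ^ (k - 5) * (int n - 2 ^ (k - 5)) \<le> int (bal n A) \<and>
            bal n A \<le> bal n B \<and>
            int (bal n B) \<le> (2 ^ (k - 3) - 1) * int n - int (2 ^ (k - 3) choose 2))"
proof (intro conjI allI impI)
  \<comment> \<open>For \<open>k = 6\<close> there is a single leaf position, which gives \<open>t = 3\<close> and the bound \<open>2 * n - 3\<close>.\<close>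
  have f: "fib (6 - 4) = 1" "fib (6 - 3) = 2" by (simp_all add: numeral_eq_Suc)
  have "\<forall>\<^sub>F n in sequentially. \<forall>T :: 'a ugraph. T_tree 6 T \<longrightarrow>
      int (bal n T) \<le> (int (fib (6 - 3) + 1) - 1) * int n - int ((fib (6 - 3) + 1) choose 2)"
    by (rule bal_T_tree_upper) (simp_all add: f)
  then show "\<forall>\<^sub>F n in sequentially. \<forall>T :: 'a ugraph. T_tree 6 T \<longrightarrow>
      int n - 1 \<le> int (bal n T) \<and> int (bal n T) \<le> 2 * int n - 2"
    using eventually_ge_at_top[of 4]
  proof eventually_elim
    case (elim n)
    have "(3 choose 2) = (3::nat)" by (simp add: choose_two)
    moreover have "int n - 1 \<le> int (bal n T)" if "T_tree 6 T" for T :: "'a ugraph"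
      using bal_T_tree_lower[OF that, of n] elim(2) f by simp
    ultimately show ?case using elim(1) f by fastforce
  qed
next
  fix k :: nat assume k: "7 \<le> k"
  \<comment> \<open>All leaf positions but one, so that the number of hubs is \<open>fib (k - 2) - 1\<close>.\<close>
  define q where "q = fib (k - 4) - 1"
  have q: "1 \<le> q" "q \<le> fib (k - 4)" "fib (k - 4) \<le> q + 1" using fib_ge_2[OF k] by (simp_all add: q_def)
  have "fib (k - 2) = fib (k - 3) + fib (k - 4)" using fib_rec[of "k - 2"] k by simp
  then have t: "fib (k - 3) + q = fib (k - 2) - 1" "int (fib (k - 2) - 1) - 1 = int (fib (k - 2)) - 2"
    using fib_ge_2[OF k] by (simp_all add: q_def)
  have "k \<ge> 6" using k by simp
  from bal_T_tree_upper[OF this q, where 'a = 'a]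
  show "\<forall>\<^sub>F n in sequentially. \<forall>T :: 'a ugraph. T_tree k T \<longrightarrow>
      int (fib (k - 4)) * (int n - int (fib (k - 4))) \<le> int (bal n T) \<and>
      int (bal n T) \<le> (int (fib (k - 2)) - 2) * int n - int ((fib (k - 2) - 1) choose 2)
                       + (if k = 7 then 1 else 0)"
    unfolding t using eventually_ge_at_top[of "3 * fib (k - 4) + 1"]
  proof eventually_elim
    case (elim n)
    show ?case
    proof (intro allI impI conjI)
      fix T :: "'a ugraph" assume T: "T_tree k T"
      show "int (fib (k - 4)) * (int n - int (fib (k - 4))) \<le> int (bal n T)"
        by (rule bal_T_tree_lower[OF T \<open>k \<ge> 6\<close> elim(2)])
      have "int (bal n T) \<le> (int (fib (k - 2)) - 2) * int n - int ((fib (k - 2) - 1) choose 2)"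
        using elim(1) T by blast
      moreover have "(0::int) \<le> (if k = 7 then 1 else 0)" by simp
      ultimately show "int (bal n T) \<le> (int (fib (k - 2)) - 2) * int n - int ((fib (k - 2) - 1) choose 2)
          + (if k = 7 then 1 else 0)" by linarith
    qed
  qed
next
  fix k :: nat assume k: "5 \<le> k"
  show "\<forall>\<^sub>F n in sequentially. \<forall>(A :: 'a ugraph) (B :: 'a ugraph). A_tree k A \<and> B_tree k B \<longrightarrow>
      2 ^ (k - 5) * (int n - 2 ^ (k - 5)) \<le> int (bal n A) \<and> bal n A \<le> bal n B \<and>
      int (bal n B) \<le> (2 ^ (k - 3) - 1) * int n - int (2 ^ (k - 3) choose 2)"
    using bal_B_tree_upper[OF k, where 'a = 'a] eventually_ge_at_top[of "3 * 2 ^ (k - 5) + 1"]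
  proof eventually_elim
    case (elim n)
    then show ?case using bal_A_tree_lower[OF _ k, of _ n] bal_A_le_bal_B[of k _ _ n] k by auto
  qed
qed

end
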